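(* (i) For every $\gamma\in(-\infty,\gamma_1^-]\cup[\gamma_1^+,+\infty)$ we have $\beta_\gamma<+\infty$. More precisely, if $\gamma\in(-\infty,\gamma_2^-]\cup[\gamma_2^+,+\infty)$, then $$\beta_\gamma\le\sqrt{\frac{3}{\gamma}-\frac12-\mu\cdot\frac{\cosh\frac12\cosh\mu-1}{\sinh\frac12\sinh\mu}}\,.$$ If otherwise $\gamma\in[\gamma_2^-,\gamma_1^-]\cup[\gamma_1^+,\gamma_2^+]$, then $$\beta_\gamma\le-\frac b2+\frac12\sqrt{b^2-4c},$$ where, writing $\alpha=\frac{3-\gamma}{\gamma}$, $$A=-\frac12+\mu\cdot\frac{\cosh\frac12\cosh\mu-1}{\sinh\frac12\sinh\mu},\qquad L=\frac{(e+1)^2}{2e}\cdot\frac{P'_{-1/2+\mu}(\cosh1)}{P_{-1/2+\mu}(\cosh1)},$$ $$b=\frac{e-1}{2}(L-A),\qquad c=\frac{e+1}{2}A-\frac{e-1}{2}L-\alpha.$$ (ii) The limit $\beta_\infty=\lim_{\gamma\to\pm\infty}\beta_\gamma$ exists (with the same value at $+\infty$ and $-\infty$) and $$\beta_\infty\le\sqrt{\frac{\sqrt3\,\bigl(1-\cosh\frac12\cos\frac{\sqrt3}{2}\bigr)}{2\sinh\frac12\,\sin\frac{\sqrt3}{2}}-\frac12}=0.296\ldots$$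
   Context: Let $p$ be the continuous 1-periodic function $p(x)=\frac{\cosh(x-[x]-1/2)}{2\sinh(1/2)}$ ($[\cdot]$ is the integer part). For $\alpha,\beta\in\mathbb{R}$, $$I(\alpha,\beta)=\inf\Bigl\{\int_0^1(p+\beta p_x)(\alpha u^2+u_x^2)\,dx:\ u\in H^1(0,1),\ u(0)=u(1)=1\Bigr\}\in\mathbb{R}\cup\{-\infty\}.$$ For $\gamma\in\mathbb{R}\setminus\{0\}$, $$\beta_\gamma=\inf\Bigl\{\beta\ge0:\ \beta^2+I\bigl(\tfrac{3-\gamma}{\gamma},\beta\bigr)-\tfrac{3-\gamma}{\gamma}\ge0\Bigr\}\in[0,+\infty],$$ with $\beta_\gamma=+\infty$ if the set is empty. For $\gamma\ne0$, $\mu=\frac12\sqrt{1+4(3-\gamma)/\gamma}\in\mathbb{C}$, where the square root is any of the two complex square roots (the choice does not affect the results). When $\mu=0$ (i.e. $\gamma=4$) the expression containing $\mu/\sinh\mu$ is understood by continuity (removable singularity). $P_\nu$ is the Legendre function of the first kind of degree $\nu$, $P_\nu(z)={}_2F_1(-\nu,\nu+1;1;\frac{1-z}{2})$, and $P_\nu'$ is its derivative in $z$. The constants $\gamma_1^\pm,\gamma_2^\pm$ are defined as follows: $\alpha_1^-<0<\alpha_1^+$ are the numbers such that $\bigl(\frac{e+1}{e-1}\bigr)^2+I\bigl(\alpha,\frac{e+1}{e-1}\bigr)-\alpha\ge0\iff\alpha_1^-\le\alpha\le\alpha_1^+$; $\alpha_2^-<0<\alpha_2^+$ are the numbers such that $1+I(\alpha,1)-\alpha\ge0\iff\alpha_2^-\le\alpha\le\alpha_2^+$;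 and $\gamma_j^\pm=\frac{3}{1+\alpha_j^\pm}$ for $j=1,2$. Numerically $\gamma_1^-=-1.036\ldots$, $\gamma_1^+=0.269\ldots$, $\gamma_2^-=-1.508\ldots$, $\gamma_2^+=0.575\ldots$. *)

theory Defs
  imports "HOL-Analysis.Analysis"
begin

definition pker :: "real \<Rightarrow> real" where
  "pker x = cosh (x - of_int \<lfloor>x\<rfloor> - 1/2) / (2 * sinh (1/2))"

text \<open>
  Elements of \<open>L\<^sup>2(0,1)\<close> are represented by Borel functions on the real line (every
  almost-everywhere class has a Borel representative); values outside the open interval are
  irrelevant.
\<close>

definition L2_01 :: "(real \<Rightarrow> real) set" where
  "L2_01 = {f. set_borel_measurable lborel {0<..<1} f \<and>
               set_integrable lborel {0<..<1} (\<lambda>x. (f x)\<^sup>2)}"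

text \<open>
  Test functions \<open>C\<^sub>c\<^sup>1(0,1)\<close>, extended by zero to the real line.  The support is
  automatically compact, being closed and bounded.
\<close>

definition test_functions :: "(real \<Rightarrow> real) set" where
  "test_functions = {\<phi>. \<phi> C1_differentiable_on UNIV \<and> closure {x. \<phi> x \<noteq> 0} \<subseteq> {0<..<1}}"

definition weak_deriv_01 :: "(real \<Rightarrow> real) \<Rightarrow> (real \<Rightarrow> real) \<Rightarrow> bool" where
  "weak_deriv_01 u v \<longleftrightarrow>
     (\<forall>\<phi>\<in>test_functions.
        set_lebesgue_integral lborel {0<..<1} (\<lambda>x. u x * deriv \<phi> x) =
        - set_lebesgue_integral lborel {0<..<1} (\<lambda>x. v x * \<phi> x))"

text \<open>
  \<open>H1_deriv u v\<close>: \<open>u \<in> H\<^sup>1(0,1)\<close> and \<open>u\<^sub>x = v\<close> (the weak derivative is unique almost everywhere).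
\<close>

definition H1_deriv :: "(real \<Rightarrow> real) \<Rightarrow> (real \<Rightarrow> real) \<Rightarrow> bool" where
  "H1_deriv u v \<longleftrightarrow> u \<in> L2_01 \<and> v \<in> L2_01 \<and> weak_deriv_01 u v"

definition energy :: "real \<Rightarrow> real \<Rightarrow> (real \<Rightarrow> real) \<Rightarrow> (real \<Rightarrow> real) \<Rightarrow> real" where
  "energy \<alpha> \<beta> u v =
     set_lebesgue_integral lborel {0<..<1}
       (\<lambda>x. (pker x + \<beta> * deriv pker x) * (\<alpha> * (u x)\<^sup>2 + (v x)\<^sup>2))"

text \<open>
  The boundary values of \<open>u \<in> H\<^sup>1(0,1)\<close> are those of its representative that is continuous on
  the closed interval.
\<close>

definition I_inf :: "real \<Rightarrow> real \<Rightarrow> ereal" where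
  "I_inf \<alpha> \<beta> =
     Inf {ereal (energy \<alpha> \<beta> u v) | u v.
            H1_deriv u v \<and> continuous_on {0..1} u \<and> u 0 = 1 \<and> u 1 = 1}"

definition admissible :: "real \<Rightarrow> real \<Rightarrow> bool" where
  "admissible \<alpha> \<beta> \<longleftrightarrow> ereal (\<beta>\<^sup>2) + I_inf \<alpha> \<beta> - ereal \<alpha> \<ge> 0"

definition beta_crit :: "real \<Rightarrow> ereal" where
  "beta_crit \<gamma> = Inf {ereal \<beta> | \<beta>. \<beta> \<ge> 0 \<and> admissible ((3 - \<gamma>) / \<gamma>) \<beta>}"

definition alpha_bounds :: "real \<Rightarrow> real \<Rightarrow> real \<Rightarrow> bool" where
  "alpha_bounds \<beta> a b \<longleftrightarrow>
     a < 0 \<and> 0 < b \<and> (\<forall>\<alpha>. admissible \<alpha> \<beta> \<longleftrightarrow> a \<le> \<alpha> \<and> \<alpha> \<le> b)"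

definition alpha_minus :: "real \<Rightarrow> real" where
  "alpha_minus \<beta> = (THE a. \<exists>b. alpha_bounds \<beta> a b)"

definition alpha_plus :: "real \<Rightarrow> real" where
  "alpha_plus \<beta> = (THE b. \<exists>a. alpha_bounds \<beta> a b)"

definition gamma1_minus :: real where
  "gamma1_minus = 3 / (1 + alpha_minus ((exp 1 + 1) / (exp 1 - 1)))"

definition gamma1_plus :: real where
  "gamma1_plus = 3 / (1 + alpha_plus ((exp 1 + 1) / (exp 1 - 1)))"

definition gamma2_minus :: real where
  "gamma2_minus = 3 / (1 + alpha_minus 1)"

definition gamma2_plus :: real where
  "gamma2_plus = 3 / (1 + alpha_plus 1)"

text \<open>
  The series for \<open>\<^sub>2F\<^sub>1(-\<nu>, \<nu>+1; 1; (1-z)/2)\<close>, hence the Legendre function only for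
  \<open>cmod (1 - z) < 2\<close>; this covers a neighbourhood of \<open>cosh 1 \<approx> 1.54\<close>.
\<close>

definition legendre_P :: "complex \<Rightarrow> complex \<Rightarrow> complex" where
  "legendre_P \<nu> z = eval_fps (fps_hypergeo [- \<nu>, \<nu> + 1] [1] 1) ((1 - z) / 2)"

text \<open>\<open>\<mu> / sinh \<mu>\<close> with its removable singularity at \<open>0\<close> filled in.\<close>

definition div_sinh :: "complex \<Rightarrow> complex" where
  "div_sinh \<mu> = (if \<mu> = 0 then 1 else \<mu> / sinh \<mu>)"

definition M_const :: "complex \<Rightarrow> complex" where
  "M_const \<mu> = div_sinh \<mu> * ((cosh (1/2) * cosh \<mu> - 1) / sinh (1/2))"

definition A_const :: "complex \<Rightarrow> complex" where
  "A_const \<mu> = - 1/2 + M_const \<mu>"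

definition L_const :: "complex \<Rightarrow> complex" where
  "L_const \<mu> =
     of_real ((exp 1 + 1)\<^sup>2 / (2 * exp 1)) *
     (deriv (legendre_P (- 1/2 + \<mu>)) (cosh 1) / legendre_P (- 1/2 + \<mu>) (cosh 1))"

definition b_const :: "complex \<Rightarrow> complex" where
  "b_const \<mu> = of_real ((exp 1 - 1) / 2) * (L_const \<mu> - A_const \<mu>)"

definition c_const :: "real \<Rightarrow> complex \<Rightarrow> complex" where
  "c_const \<alpha> \<mu> =
     of_real ((exp 1 + 1) / 2) * A_const \<mu> - of_real ((exp 1 - 1) / 2) * L_const \<mu> - of_real \<alpha>"

end

theory Submission
  imports Defs
begin

text \<open>
  For a fixed competitor the energy is affine in \<open>\<alpha>\<close> and in \<open>\<beta>\<close>, so \<open>I\<close> is concave in each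
  variable; it is moreover even in \<open>\<beta>\<close>, by the reflection \<open>x \<mapsto> 1 - x\<close>. On \<open>(0,1)\<close> the weight
  \<open>p + \<beta> p\<^sub>x\<close> is a multiple of \<open>exp x\<close> for \<open>\<beta> = 1\<close> and of \<open>sinh x\<close> for \<open>\<beta> = (e+1)/(e-1)\<close>. There
  the Euler-Lagrange equation \<open>(w y')' = \<alpha> w y\<close> is solved by \<open>exp (-x/2)\<close> times trigonometric or
  hyperbolic functions, respectively by \<open>P\<^sub>\<nu> (cosh x)\<close> with \<open>\<nu> (\<nu> + 1) = \<alpha>\<close>. A positive solution
  bounds the energy from below by the flux difference of \<open>w y' / y\<close> (completion of the square), and
  testing with \<open>y\<close> shows that the bound is attained, respectively approached through logarithmic
  cutoffs at the degenerate endpoint. Hence \<open>I(\<alpha>,1) = A\<close> and \<open>I(\<alpha>,(e+1)/(e-1)) = L\<close>. For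
  \<open>\<bar>\<beta>\<bar> \<le> 1\<close> one uses \<open>I(\<alpha>,\<beta>) \<ge> A\<close>, and between the two values of \<open>\<beta>\<close> linear interpolation, which
  leads to the two quadratic inequalities. For the limit, at \<open>\<alpha> = -1\<close> concavity makes
  \<open>\<beta>\<^sup>2 + I - \<alpha>\<close> strictly positive immediately to the right of its first admissible \<open>\<beta>\<close>, which gives
  the continuity of the critical value there.
\<close>

section \<open>Weak derivatives on the unit interval\<close>

text \<open>Positivity of the solution \<open>y\<close> cannot be read off from a formula; it has to
  be extracted from admissibility. Where it fails there is a direction along which the quadratic
  part of the energy is nonpositive while the linear part is not zero, so the energy is unbounded
  below. This gives 1/4 + \<alpha> > - pi^2 for \<beta> = 1 and \<open>leg_y\<close> > 0 for the
  degenerate weight.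

  The constants given by \<open>THE\<close> exist because the admissible \<alpha> form a compact
  interval. That it reaches below -1, which makes the lower thresholds for \<gamma> negative, is
  seen at \<alpha> = -21/20 with a truncated Legendre series as supersolution. The same value is the
  left comparison point for continuity at \<alpha> = -1.

  Strictness to the right of the first admissible \<beta> at \<alpha> = -1 is not automatic: the
  chord to \<beta> = 1 gains at once only if 2 \<beta> - \<beta>^2 exceeds \<open>R_sq\<close>,
  about 0.088. A test function excludes every \<beta> below 1/20, the only range where this could
  fail.\<close>

definition step_fun :: "real \<Rightarrow> real" where
  "step_fun t = 2 * (max 0 t)\<^sup>2 - 4 * (max 0 (t - 1/2))\<^sup>2 + 2 * (max 0 (t - 1))\<^sup>2"

text \<open>The hat function of height 2 on [0,1]: a continuous probability density, so that
  \<open>step_fun\<close> is a C^1 unit step from which test functions can be assembled.\<close>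

definition step_deriv :: "real \<Rightarrow> real" where
  "step_deriv t = 4 * max 0 t - 8 * max 0 (t - 1/2) + 4 * max 0 (t - 1)"

lemma has_derivative_pos_part_square:
  "((\<lambda>t. (max 0 t)\<^sup>2) has_real_derivative 2 * max 0 t) (at t)" for t :: real
proof -
  consider "t < 0" | "t = 0" | "t > 0" by linarith
  then show ?thesis
  proof cases
    case 1
    have "((\<lambda>t. 0) has_real_derivative 0) (at t)" by simp
    then have "((\<lambda>t. (max 0 t)\<^sup>2) has_real_derivative 0) (at t)"
      by (rule has_field_derivative_transform_within_open[where S="{..<0}"]) (use 1 in auto)
    then show ?thesis using 1 by simp
  next
    case 3
    have "((\<lambda>t. t\<^sup>2) has_real_derivative 2 * t) (at t)" by (auto intro!: derivative_eq_intros)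
    then have "((\<lambda>t. (max 0 t)\<^sup>2) has_real_derivative 2 * t) (at t)"
      by (rule has_field_derivative_transform_within_open[where S="{0<..}"]) (use 3 in auto)
    then show ?thesis using 3 by simp
  next
    case 2
    have "((\<lambda>h. \<bar>h\<bar>) \<longlongrightarrow> 0) (at (0::real))"
      by (intro tendsto_eq_intros | simp)+
    then have "((\<lambda>h. (max 0 h)\<^sup>2 / h) \<longlongrightarrow> 0) (at (0::real))"
    proof (rule Lim_null_comparison[rotated])
      have "norm ((max 0 h)\<^sup>2 / h) \<le> \<bar>h\<bar>" for h :: real
        by (cases "h > 0") (auto simp: power2_eq_square max_def)
      then show "\<forall>\<^sub>F h in at (0::real). norm ((max 0 h)\<^sup>2 / h) \<le> \<bar>h\<bar>" by simp
    qed
    then show ?thesis using 2 by (simp add: DERIV_def)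
  qed
qed

lemma step_fun_deriv: "(step_fun has_real_derivative step_deriv t) (at t)"
  unfolding step_fun_def step_deriv_def
  by (rule derivative_eq_intros DERIV_chain2[OF has_derivative_pos_part_square] refl | simp)+

lemma step_deriv_cont: "continuous_on A step_deriv"
  unfolding step_deriv_def by (intro continuous_intros)

lemma step_fun_le0: "t \<le> 0 \<Longrightarrow> step_fun t = 0" by (simp add: step_fun_def)
lemma step_fun_ge1: "t \<ge> 1 \<Longrightarrow> step_fun t = 1"
  by (simp add: step_fun_def max_def power2_eq_square algebra_simps)
lemma step_fun_bound: "\<bar>step_fun t\<bar> \<le> 8"
proof -
  consider "t \<le> 0" | "t \<ge> 1" | "0 < t" "t < 1" by linarith
  then show ?thesis
  proof cases
    case 3
    have "(max 0 t)\<^sup>2 \<le> 1\<^sup>2" "(max 0 (t-1/2))\<^sup>2 \<le> 1\<^sup>2" by (intro power_mono; use 3 in auto)+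
    moreover have "0 \<le> (max 0 t)\<^sup>2" "0 \<le> (max 0 (t-1/2))\<^sup>2" by auto
    moreover have "max 0 (t-1) = 0" using 3 by auto
    ultimately show ?thesis unfolding step_fun_def abs_le_iff
      by (smt (verit) power_one zero_power2)
  qed (auto simp: step_fun_le0 step_fun_ge1)
qed

lemma step_deriv_out: "t \<le> 0 \<or> 1 \<le> t \<Longrightarrow> step_deriv t = 0"
  by (auto simp: step_deriv_def max_def)

lemma step_deriv_bound: "\<bar>step_deriv t\<bar> \<le> 16"
proof -
  consider "t \<le> 0" | "t \<ge> 1" | "0 < t" "t < 1" by linarith
  then show ?thesis by cases (auto simp: step_deriv_def max_def)
qed

lemma step_deriv_integral:
  "(\<integral>s. step_deriv s \<partial>lborel) = 1" "integrable lborel step_deriv"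
proof -
  have "(\<integral>x. step_deriv x * indicator {0..1} x \<partial>lborel) = step_fun 1 - step_fun 0"
    by (rule integral_FTC_Icc_real)
      (auto intro: step_fun_deriv continuous_on_interior step_deriv_cont[of UNIV, THEN continuous_on_eq_continuous_at[THEN iffD1, rotated], rule_format])
  moreover have ind: "(\<lambda>x. step_deriv x * indicator {0..1} x) = step_deriv"
  proof
    fix x show "step_deriv x * indicator {0..1} x = step_deriv x"
      using step_deriv_out[of x] by (cases "x \<in> {0..1}") auto
  qed
  ultimately show "(\<integral>s. step_deriv s \<partial>lborel) = 1" by (simp add: step_fun_le0 step_fun_ge1)
  have "integrable lborel (\<lambda>x. indicator {0..1} x *\<^sub>R step_deriv x)"
    by (rule borel_integrable_compact) (auto intro: step_deriv_cont)
  moreover have "(\<lambda>x. indicator {0..1} x *\<^sub>R step_deriv x) = step_deriv"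
    using ind by (simp add: mult.commute)
  ultimately show "integrable lborel step_deriv" by simp
qed

text \<open>Substituting x = c + (s - d) / (n + 1) turns the rescaled kernel into the fixed density
  \<open>step_deriv\<close>, and dominated convergence applies. Only 0 < s < 1 counts, so the choice
  d = -1 approaches c from the right and d = 2 from the left.\<close>

lemma tendsto_integral_step_kernel:
  fixes U :: "real \<Rightarrow> real"
  assumes meas: "U \<in> borel_measurable borel" and bd: "\<And>x. \<bar>U x\<bar> \<le> K"
    and lim: "\<And>s. 0 < s \<Longrightarrow> s < 1 \<Longrightarrow> (\<lambda>n. U (c + (s - d) / real (Suc n))) \<longlonglongrightarrow> l"
  shows "(\<lambda>n. \<integral>x. U x * (real (Suc n) * step_deriv (real (Suc n) * (x - c) + d)) \<partial>lborel) \<longlonglongrightarrow> l"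
proof -
  have [measurable]: "step_deriv \<in> borel_measurable borel"
    by (intro borel_measurable_continuous_onI step_deriv_cont)
  note meas[measurable]
  have eq: "(\<integral>x. U x * (real (Suc n) * step_deriv (real (Suc n) * (x - c) + d)) \<partial>lborel)
      = (\<integral>s. U (c + (s - d) / real (Suc n)) * step_deriv s \<partial>lborel)" for n
  proof -
    have "(\<integral>x. U x * (real (Suc n) * step_deriv (real (Suc n) * (x - c) + d)) \<partial>lborel)
      = \<bar>1 / real (Suc n)\<bar> *\<^sub>R (\<integral>s. (\<lambda>x. U x * (real (Suc n) * step_deriv (real (Suc n) * (x - c) + d)))
          ((c - d / real (Suc n)) + (1 / real (Suc n)) * s) \<partial>lborel)"
      by (rule lborel_integral_real_affine) simp
    also have "\<dots> = (\<integral>s. U (c + (s - d) / real (Suc n)) * step_deriv s \<partial>lborel)"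
    proof -
      have *: "real (Suc n) * ((c - d / real (Suc n)) + (1 / real (Suc n)) * s - c) + d = s"
        "(c - d / real (Suc n)) + (1 / real (Suc n)) * s = c + (s - d) / real (Suc n)" for s
        by (simp_all add: field_simps del: of_nat_Suc)
      show ?thesis unfolding * by (simp add: mult.left_commute del: of_nat_Suc)
    qed
    finally show ?thesis .
  qed
  have "(\<lambda>n. \<integral>s. U (c + (s - d) / real (Suc n)) * step_deriv s \<partial>lborel) \<longlonglongrightarrow> (\<integral>s. l * step_deriv s \<partial>lborel)"
  proof (rule integral_dominated_convergence[where w="\<lambda>s. K * \<bar>step_deriv s\<bar>"])
    show "integrable lborel (\<lambda>s. K * \<bar>step_deriv s\<bar>)"
      using step_deriv_integral(2) by simp
    show "AE s in lborel. (\<lambda>n. U (c + (s - d) / real (Suc n)) * step_deriv s) \<longlonglongrightarrow> l * step_deriv s"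
    proof (rule AE_I2)
      fix s :: real
      show "(\<lambda>n. U (c + (s - d) / real (Suc n)) * step_deriv s) \<longlonglongrightarrow> l * step_deriv s"
      proof (cases "0 < s \<and> s < 1")
        case True
        then show ?thesis by (intro tendsto_intros lim) auto
      next
        case False
        then have "step_deriv s = 0" by (intro step_deriv_out) auto
        then show ?thesis by simp
      qed
    qed
  qed (auto simp: abs_mult intro!: mult_right_mono bd simp del: of_nat_Suc)
  then show ?thesis unfolding eq using step_deriv_integral by simp
qed

lemma set_integrable_L2_mult:
  assumes "f \<in> L2_01" "g \<in> L2_01"
  shows "set_integrable lborel {0<..<1} (\<lambda>x. f x * g x)"
proof (rule set_integrable_bound)
  show "set_integrable lborel {0<..<1} (\<lambda>x. (f x)\<^sup>2 + (g x)\<^sup>2)"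
    using assms by (intro set_integral_add(1)) (auto simp: L2_01_def)
  have "(\<lambda>x. (indicator {0<..<1} x *\<^sub>R f x) * (indicator {0<..<1} x *\<^sub>R g x)) \<in> borel_measurable lborel"
    using assms unfolding L2_01_def set_borel_measurable_def by (intro borel_measurable_times) auto
  also have "(\<lambda>x. (indicator {0<..<1} x *\<^sub>R f x) * (indicator {0<..<1} x *\<^sub>R g x))
     = (\<lambda>x. indicator {0<..<1} x *\<^sub>R (f x * g x))" by (auto simp: fun_eq_iff indicator_def)
  finally show "set_borel_measurable lborel {0<..<1} (\<lambda>x. f x * g x)"
    unfolding set_borel_measurable_def .
  have "\<bar>f x * g x\<bar> \<le> (f x)\<^sup>2 + (g x)\<^sup>2" for x
  proof -
    have "0 \<le> (\<bar>f x\<bar> - \<bar>g x\<bar>)\<^sup>2" by simp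
    then have "2 * \<bar>f x * g x\<bar> \<le> (f x)\<^sup>2 + (g x)\<^sup>2" by (simp add: power2_diff abs_mult)
    then show ?thesis by linarith
  qed
  then show "AE x in lborel. x \<in> {0<..<1} \<longrightarrow> norm (f x * g x) \<le> norm ((f x)\<^sup>2 + (g x)\<^sup>2)"
    by (auto intro!: AE_I2 order_trans[OF _ abs_ge_self])
qed

lemma const_L2: "(\<lambda>_. c) \<in> L2_01"
proof -
  have "set_integrable lborel {0<..<1::real} (\<lambda>x. c)" for c :: real
    by (rule set_integrable_subset[OF borel_integrable_atLeastAtMost'[of 0 1]]) auto
  then show ?thesis
    by (auto simp: L2_01_def set_borel_measurable_def)
qed

lemma set_integrable_L2: "f \<in> L2_01 \<Longrightarrow> set_integrable lborel {0<..<1} f"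
  using set_integrable_L2_mult[of f "\<lambda>_. 1"] const_L2 by simp

text \<open>With N = n + 1 this trapezoid rises on [1/N, 2/N] and falls on [b - 2/N, b - 1/N]; N >
  4/b leaves a plateau in between. The shifts by 1/N keep the support inside the open interval even
  for b = 1.\<close>

lemma step_test_function:
  assumes "0 < b" "b \<le> 1" "4 / b < real (Suc n)"
  shows "(\<lambda>x. step_fun (real (Suc n) * (x - 0) + (-1)) - step_fun (real (Suc n) * (x - b) + 2)) \<in> test_functions"
    and "deriv (\<lambda>x. step_fun (real (Suc n) * (x - 0) + (-1)) - step_fun (real (Suc n) * (x - b) + 2)) x
      = real (Suc n) * step_deriv (real (Suc n) * (x - 0) + (-1)) - real (Suc n) * step_deriv (real (Suc n) * (x - b) + 2)"
proof -
  define N where "N = real (Suc n)"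
  let ?f = "\<lambda>x. step_fun (N * (x - 0) + (-1)) - step_fun (N * (x - b) + 2)"
  have N: "N > 0" "N * b > 4" using assms by (auto simp: N_def field_simps)
  have d: "(?f has_real_derivative N * step_deriv (N * (x - 0) + (-1)) - N * step_deriv (N * (x - b) + 2)) (at x)" for x
    by (rule derivative_eq_intros DERIV_chain2[OF step_fun_deriv] refl | simp)+
  show "deriv (\<lambda>x. step_fun (real (Suc n) * (x - 0) + (-1)) - step_fun (real (Suc n) * (x - b) + 2)) x
      = real (Suc n) * step_deriv (real (Suc n) * (x - 0) + (-1)) - real (Suc n) * step_deriv (real (Suc n) * (x - b) + 2)"
    using DERIV_imp_deriv[OF d] unfolding N_def .
  have "?f C1_differentiable_on UNIV"
    unfolding C1_differentiable_on_def
    by (intro exI[of _ "\<lambda>x. N * step_deriv (N * (x - 0) + (-1)) - N * step_deriv (N * (x - b) + 2)"])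
      (auto simp: has_real_derivative_iff_has_vector_derivative[symmetric] intro!: d[simplified]
         continuous_intros continuous_on_compose2[OF step_deriv_cont[of UNIV]])
  have "{x. ?f x \<noteq> 0} \<subseteq> {1/N..b - 1/N}"
  proof
    fix x assume "x \<in> {x. ?f x \<noteq> 0}"
    then have nz: "?f x \<noteq> 0" by simp
    show "x \<in> {1/N..b - 1/N}"
    proof (rule ccontr)
      assume "x \<notin> {1/N..b - 1/N}"
      then have "x < 1/N \<or> x > b - 1/N" by auto
      then consider "N * x - 1 < 0" | "N * x - N * b + 2 > 1"
        using N by (auto simp: field_simps)
      then show False
      proof cases
        case 1
        then have "N * (x - b) + 2 \<le> 0" using N by (simp add: right_diff_distrib)
        with 1 nz show False by (simp add: step_fun_le0)
      next
        case 2
        then have "N * (x - 0) + (-1) \<ge> 1" "N * (x - b) + 2 \<ge> 1" using N by (simp_all add: right_diff_distrib)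
        with nz show False by (simp add: step_fun_ge1)
      qed
    qed
  qed
  then have "closure {x. ?f x \<noteq> 0} \<subseteq> {1/N..b - 1/N}" by (rule closure_minimal) simp
  moreover have "{1/N..b - 1/N} \<subseteq> {0<..<1}"
  proof
    fix x assume x: "x \<in> {1/N..b - 1/N}"
    moreover have "0 < 1/N" using N by simp
    ultimately show "x \<in> {0<..<1}" using assms(2) unfolding atLeastAtMost_iff greaterThanLessThan_iff by linarith
  qed
  ultimately have "closure {x. ?f x \<noteq> 0} \<subseteq> {0<..<1}"
    by blast
  with \<open>?f C1_differentiable_on UNIV\<close>
  show "(\<lambda>x. step_fun (real (Suc n) * (x - 0) + (-1)) - step_fun (real (Suc n) * (x - b) + 2)) \<in> test_functions"
    by (simp add: test_functions_def N_def)
qed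

lemma indicator_continuous_measurable:
  "continuous_on {0..1} u \<Longrightarrow> (\<lambda>x. indicator {0<..<1::real} x * (u x :: real)) \<in> borel_measurable borel"
  using borel_measurable_continuous_on_indicator[of "{0<..<1}" u] continuous_on_subset[of "{0..1}" u "{0<..<1}"]
  by (auto simp: subset_eq)

lemma continuous_bounded_01:
  assumes "continuous_on {0..1} (u :: real \<Rightarrow> real)"
  obtains K where "\<And>x. x \<in> {0..1} \<Longrightarrow> \<bar>u x\<bar> \<le> K"
  using compact_continuous_image[OF assms compact_Icc, THEN compact_imp_bounded]
  unfolding bounded_iff by fastforce

text \<open>The weak derivative is tested with the trapezoids. Their ramps have slopes that
  concentrate at 0 from the right and at b from the left and so pick out the values of u there,
  while the trapezoids themselves tend to the indicator of (0,b).\<close>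

lemma H1_deriv_FTC:
  assumes H: "H1_deriv u v" and cu: "continuous_on {0..1} u" and b: "0 < b" "b \<le> 1"
  shows "u b - u 0 = (\<integral>x. indicator {0<..<b} x * v x \<partial>lborel)"
proof -
  define U where "U x = indicator {0<..<1} x * u x" for x :: real
  define V where "V x = indicator {0<..<1} x * v x" for x :: real
  have V: "integrable lborel V"
    using set_integrable_L2[of v] H unfolding V_def H1_deriv_def set_integrable_def by simp
  have Um[measurable]: "U \<in> borel_measurable borel"
    using H unfolding H1_deriv_def L2_01_def set_borel_measurable_def U_def[abs_def] by auto
  have Vm[measurable]: "V \<in> borel_measurable borel"
    using V by auto
  obtain K where K: "\<And>x. x \<in> {0..1} \<Longrightarrow> \<bar>u x\<bar> \<le> K"
    using continuous_bounded_01[OF cu] by blast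
  have K0: "0 \<le> K" using K[of 0] by auto
  have UK: "\<bar>U x\<bar> \<le> K" for x using K[of x] K0 by (auto simp: U_def indicator_def)
  have lim: "(\<lambda>n. U (c + (s - d) / real (Suc n))) \<longlonglongrightarrow> u c"
    if s: "0 < s" "s < 1" and c: "c = 0 \<and> d = -1 \<or> c = b \<and> d = 2" for c d s
  proof -
    have l0: "(\<lambda>n. c + (s - d) / real (Suc n)) \<longlonglongrightarrow> c"
      by (rule tendsto_eq_intros lim_const_over_n LIMSEQ_Suc[OF lim_const_over_n] refl | simp)+
    have cs: "0 < (s - d) \<and> c < 1 \<or> s - d < 0 \<and> 0 < c" using c s b by auto
    \<comment> \<open>The points approach 0 from the right and b from the left, hence finally lie
      where \<open>U\<close> and u agree, also when b = 1.\<close>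
    have inn: "\<forall>\<^sub>F n in sequentially. c + (s - d) / real (Suc n) \<in> {0<..<1}"
    proof (cases "s - d > 0")
      case True
      then have c0: "0 \<le> c" "c < 1" using c s b by auto
      from order_tendstoD(2)[OF l0 c0(2)] show ?thesis
        by eventually_elim (use True c0 in \<open>auto intro!: add_nonneg_pos\<close>)
    next
      case False
      then have c0: "0 < c" "c \<le> 1" "s - d < 0" using c s b by auto
      from order_tendstoD(1)[OF l0 c0(1)] show ?thesis
      proof eventually_elim
        case (elim n)
        have "(s - d) / real (Suc n) < 0" using c0 by (simp add: divide_neg_pos)
        with elim c0 show ?case by auto
      qed
    qed
    have cin: "c \<in> {0..1}" using c b by auto
    have "continuous (at c within {0..1}) u" using cu cin by (auto simp: continuous_on_eq_continuous_within)
    then have "(\<lambda>n. u (c + (s - d) / real (Suc n))) \<longlonglongrightarrow> u c"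
      by (rule continuous_within_tendsto_compose[OF _ _ l0])
        (use inn in \<open>auto elim!: eventually_mono\<close>)
    then show ?thesis
      by (rule Lim_transform_eventually) (use inn in \<open>auto elim!: eventually_mono simp: U_def\<close>)
  qed
  let ?n = "\<lambda>n. real (Suc n)"
  let ?k1 = "\<lambda>n x. ?n n * step_deriv (?n n * (x - 0) + (-1))"
  let ?k2 = "\<lambda>n x. ?n n * step_deriv (?n n * (x - b) + 2)"
  let ?f = "\<lambda>n x. step_fun (?n n * (x - 0) + (-1)) - step_fun (?n n * (x - b) + 2)"
  have [measurable]: "step_deriv \<in> borel_measurable borel" "step_fun \<in> borel_measurable borel"
    by (intro borel_measurable_continuous_onI step_deriv_cont,
      intro borel_measurable_continuous_onI continuous_at_imp_continuous_on ballI DERIV_isCont[OF step_fun_deriv])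
  have l1: "(\<lambda>n. \<integral>x. U x * ?k1 n x \<partial>lborel) \<longlonglongrightarrow> u 0"
    by (rule tendsto_integral_step_kernel[OF Um UK]) (rule lim, auto)
  have l2: "(\<lambda>n. \<integral>x. U x * ?k2 n x \<partial>lborel) \<longlonglongrightarrow> u b"
    by (rule tendsto_integral_step_kernel[OF Um UK]) (rule lim, auto)
  have int: "integrable lborel (\<lambda>x. U x * (?n n * step_deriv (?n n * (x - c) + d)))" for n c d
  proof (rule Bochner_Integration.integrable_bound[where f="\<lambda>x. indicator {0..1} x * (K * (?n n * 16))"])
    show "AE x in lborel. norm (U x * (?n n * step_deriv (?n n * (x - c) + d))) \<le> norm (indicator {0..1} x * (K * (?n n * 16)))"
      using K0 by (auto intro!: AE_I2 mult_mono K step_deriv_bound simp: U_def indicator_def abs_mult simp del: of_nat_Suc)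
  qed auto
  have "4 / b < real (Suc n)" if "n > nat \<lceil>4/b\<rceil>" for n using that by linarith
  then have ev: "\<forall>\<^sub>F n in sequentially. 4 / b < ?n n"
    by (auto simp: eventually_sequentially intro!: exI[of _ "Suc (nat \<lceil>4/b\<rceil>)"])
  have w: "\<forall>\<^sub>F n in sequentially. (\<integral>x. V x * ?f n x \<partial>lborel) = (\<integral>x. U x * ?k2 n x \<partial>lborel) - (\<integral>x. U x * ?k1 n x \<partial>lborel)"
    using ev
  proof eventually_elim
    case (elim n)
    have "(LBINT x:{0<..<1}. u x * deriv (?f n) x) = - (LBINT x:{0<..<1}. v x * ?f n x)"
      using H step_test_function(1)[OF b elim] unfolding H1_deriv_def weak_deriv_01_def by blast
    then have "(\<integral>x. V x * ?f n x \<partial>lborel) = - (\<integral>x. U x * (?k1 n x - ?k2 n x) \<partial>lborel)"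
      unfolding step_test_function(2)[OF b elim]
      by (simp add: set_lebesgue_integral_def U_def V_def mult.assoc del: of_nat_Suc)
    also have "\<dots> = - ((\<integral>x. U x * ?k1 n x \<partial>lborel) - (\<integral>x. U x * ?k2 n x \<partial>lborel))"
      unfolding right_diff_distrib[of "U _"]
      by (subst Bochner_Integration.integral_diff[OF int int]) simp
    finally show ?case by simp
  qed
  have "(\<lambda>n. \<integral>x. V x * ?f n x \<partial>lborel) \<longlonglongrightarrow> u b - u 0"
    by (rule Lim_transform_eventually[OF tendsto_diff[OF l2 l1]]) (use w in \<open>auto elim!: eventually_mono\<close>)
  moreover have "(\<lambda>n. \<integral>x. V x * ?f n x \<partial>lborel) \<longlonglongrightarrow> (\<integral>x. V x * indicator {0<..<b} x \<partial>lborel)"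
  proof (rule integral_dominated_convergence[where w="\<lambda>x. \<bar>V x\<bar> * 16"])
    show "AE x in lborel. (\<lambda>n. V x * ?f n x) \<longlonglongrightarrow> V x * indicator {0<..<b} x"
    proof (rule AE_I2)
      fix x
      show "(\<lambda>n. V x * ?f n x) \<longlonglongrightarrow> V x * indicator {0<..<b} x"
      proof (cases "0 < x")
        case False
        then show ?thesis by (simp add: V_def)
      next
        case True
        have big: "\<forall>\<^sub>F n in sequentially. B < ?n n * r" if "r > 0" for B r
        proof -
          have "\<forall>\<^sub>F n in sequentially. nat \<lceil>B / r\<rceil> < n" by (rule eventually_gt_at_top)
          then show ?thesis
          proof eventually_elim
            case (elim n)
            then have "B / r < ?n n" by linarith
            then show ?case using that by (simp add: field_simps)
          qed
        qed
        have "\<forall>\<^sub>F n in sequentially. ?f n x = indicator {0<..<b} x"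
        proof (cases "x < b")
          case xb: True
          then have "b - x > 0" by simp
          from big[OF True, of 2] big[OF this, of 2] show ?thesis
          proof eventually_elim
            case (elim n)
            have "?n n * (x - b) + 2 \<le> 0" using elim by (simp add: right_diff_distrib del: of_nat_Suc)
            then show ?case using elim xb True by (simp add: step_fun_ge1 step_fun_le0 del: of_nat_Suc)
          qed
        next
          case xb: False
          from big[OF True, of 2] show ?thesis
          proof eventually_elim
            case (elim n)
            have "0 \<le> ?n n * (x - b)" using xb by (intro mult_nonneg_nonneg) auto
            then show ?case using elim xb by (simp add: step_fun_ge1 del: of_nat_Suc)
          qed
        qed
        then have "\<forall>\<^sub>F n in sequentially. V x * indicator {0<..<b} x = V x * ?f n x"
          by (rule eventually_mono) metis
        then show ?thesis by (rule Lim_transform_eventually[OF tendsto_const])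
      qed
    qed
    show "AE x in lborel. norm (V x * ?f n x) \<le> \<bar>V x\<bar> * 16" for n
    proof (rule AE_I2)
      fix x
      have "\<bar>?f n x\<bar> \<le> 16"
        using step_fun_bound[of "?n n * (x - 0) + (-1)"] step_fun_bound[of "?n n * (x - b) + 2"] by linarith
      then show "norm (V x * ?f n x) \<le> \<bar>V x\<bar> * 16" by (auto simp: abs_mult intro!: mult_left_mono)
    qed
  qed (use V in auto)
  ultimately have "u b - u 0 = (\<integral>x. V x * indicator {0<..<b} x \<partial>lborel)"
    by (rule LIMSEQ_unique)
  also have "(\<lambda>x. V x * indicator {0<..<b} x) = (\<lambda>x. indicator {0<..<b} x * v x)"
    using b by (auto simp: V_def indicator_def fun_eq_iff)
  finally show ?thesis .
qed

text \<open>Fubini: the two terms on the left are the integrals of f x * g t over the half-planes t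
  < x and x < t, which together miss only the diagonal, a null set.\<close>

lemma integral_by_parts_indefinite:
  fixes f g :: "real \<Rightarrow> real"
  assumes f: "integrable lborel f" and g: "integrable lborel g"
  shows "(\<integral>x. f x * (\<integral>t. indicator {..<x} t * g t \<partial>lborel) \<partial>lborel)
       + (\<integral>x. (\<integral>t. indicator {..<x} t * f t \<partial>lborel) * g x \<partial>lborel)
       = (\<integral>x. f x \<partial>lborel) * (\<integral>x. g x \<partial>lborel)"
proof -
  have [measurable]: "f \<in> borel_measurable borel" "g \<in> borel_measurable borel" using f g by auto
  have m1[measurable]: "{p :: real \<times> real. snd p < fst p} \<in> sets (lborel \<Otimes>\<^sub>M lborel)"
    "{p :: real \<times> real. fst p < snd p} \<in> sets (lborel \<Otimes>\<^sub>M lborel)"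
    unfolding lborel_prod sets_lborel
    by (auto intro!: borel_open open_Collect_less continuous_intros)
  have i0: "integrable (lborel \<Otimes>\<^sub>M lborel) (\<lambda>(x, t). f x * g t)"
  proof (rule lborel_pair.Fubini_integrable)
    show "integrable lborel (\<lambda>x. \<integral>t. norm (case (x, t) of (x, t) \<Rightarrow> f x * g t) \<partial>lborel)"
      using f by (simp add: abs_mult)
    show "AE x in lborel. integrable lborel (\<lambda>t. case (x, t) of (x, t) \<Rightarrow> f x * g t)"
      using g by simp
  qed measurable
  define h1 where "h1 p = indicator {p :: real \<times> real. snd p < fst p} p * (f (fst p) * g (snd p))" for p
  define h2 where "h2 p = indicator {p :: real \<times> real. fst p < snd p} p * (f (fst p) * g (snd p))" for p
  have i1: "integrable (lborel \<Otimes>\<^sub>M lborel) h1" "integrable (lborel \<Otimes>\<^sub>M lborel) h2"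
    unfolding h1_def h2_def using integrable_mult_indicator[OF m1(1) i0] integrable_mult_indicator[OF m1(2) i0]
    by (simp_all add: case_prod_beta)
  have s1: "(\<integral>x. f x * (\<integral>t. indicator {..<x} t * g t \<partial>lborel) \<partial>lborel) = (\<integral>p. h1 p \<partial>(lborel \<Otimes>\<^sub>M lborel))"
  proof (subst lborel_pair.integral_fst'[OF i1(1), symmetric], rule Bochner_Integration.integral_cong[OF refl])
    fix x :: real
    show "f x * (\<integral>t. indicator {..<x} t * g t \<partial>lborel) = (\<integral>y. h1 (x, y) \<partial>lborel)"
      by (subst integral_mult_right_zero[symmetric], rule Bochner_Integration.integral_cong)
        (auto simp: h1_def indicator_def)
  qed
  have s2: "(\<integral>x. (\<integral>t. indicator {..<x} t * f t \<partial>lborel) * g x \<partial>lborel) = (\<integral>p. h2 p \<partial>(lborel \<Otimes>\<^sub>M lborel))"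
  proof -
    have "(\<integral>x. (\<integral>t. indicator {..<x} t * f t \<partial>lborel) * g x \<partial>lborel) = (\<integral>y. \<integral>x. (case (x, y) of (x, y) \<Rightarrow> h2 (x, y)) \<partial>lborel \<partial>lborel)"
      by (rule Bochner_Integration.integral_cong[OF refl], subst integral_mult_left_zero[symmetric],
          rule Bochner_Integration.integral_cong) (auto simp: h2_def indicator_def)
    also have "\<dots> = (\<integral>p. h2 p \<partial>(lborel \<Otimes>\<^sub>M lborel))"
      using lborel_pair.integral_snd[of "\<lambda>x y. h2 (x, y)"] i1(2) by simp
    finally show ?thesis .
  qed
  have "AE p in lborel \<Otimes>\<^sub>M lborel. h1 p + h2 p = (case p of (x, t) \<Rightarrow> f x * g t)"
  proof (rule lborel_pair.AE_pair_measure)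
    show "{x \<in> space (lborel \<Otimes>\<^sub>M lborel). h1 x + h2 x = (case x of (x, t) \<Rightarrow> f x * g t)} \<in> sets (lborel \<Otimes>\<^sub>M lborel)"
      unfolding h1_def h2_def by measurable
    show "AE x in lborel. AE y in lborel. h1 (x, y) + h2 (x, y) = (case (x, y) of (x, t) \<Rightarrow> f x * g t)"
    proof (rule AE_I2)
      fix x :: real
      show "AE y in lborel. h1 (x, y) + h2 (x, y) = (case (x, y) of (x, t) \<Rightarrow> f x * g t)"
        using AE_lborel_singleton[of x]
        by eventually_elim (auto simp: h1_def h2_def indicator_def)
    qed
  qed
  then have "(\<integral>p. h1 p + h2 p \<partial>(lborel \<Otimes>\<^sub>M lborel)) = (\<integral>p. (case p of (x, t) \<Rightarrow> f x * g t) \<partial>(lborel \<Otimes>\<^sub>M lborel))"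
    using i0 i1 by (intro integral_cong_AE) auto
  also have "\<dots> = (\<integral>x. f x \<partial>lborel) * (\<integral>x. g x \<partial>lborel)"
    by (subst lborel_pair.integral_fst'[OF i0, symmetric]) simp
  finally show ?thesis unfolding s1 s2 using i1 by simp
qed

text \<open>This integrates the derivative of u^2 g. Since u is only the primitive of an L^2
  function, the product rule comes from \<open>integral_by_parts_indefinite\<close>: once with v
  against itself to form u^2, once more to multiply by g.\<close>

lemma H1_deriv_square_FTC:
  assumes H: "H1_deriv u v" and cu: "continuous_on {0..1} u"
    and dg: "\<And>x. x \<in> {0..1} \<Longrightarrow> (g has_real_derivative g' x) (at x within {0..1})"
    and cg: "continuous_on {0..1} g'"
  shows "(LBINT x:{0<..<1}. 2 * u x * v x * g x + (u x)\<^sup>2 * g' x) = (u 1)\<^sup>2 * g 1 - (u 0)\<^sup>2 * g 0"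
proof -
  define I :: "real \<Rightarrow> real" where "I = indicator {0<..<1}"
  define U where "U x = I x * u x" for x
  define V where "V x = I x * v x" for x
  define G' where "G' x = I x * g' x" for x
  have I01: "I x = 0 \<or> I x = 1" for x by (auto simp: I_def indicator_def)
  have [simp]: "I x * I x = I x" for x using I01[of x] by auto
  have V: "integrable lborel V"
    using set_integrable_L2[of v] H unfolding V_def H1_deriv_def set_integrable_def I_def by simp
  have Um[measurable]: "U \<in> borel_measurable borel"
    using H unfolding H1_deriv_def L2_01_def set_borel_measurable_def U_def[abs_def] I_def by auto
  have Vm[measurable]: "V \<in> borel_measurable borel" using V by auto
  have "set_integrable lborel {0..1} g'" by (rule borel_integrable_atLeastAtMost'[OF cg])
  then have "set_integrable lborel {0<..<1} g'" by (rule set_integrable_subset) auto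
  then have G': "integrable lborel G'" unfolding G'_def I_def set_integrable_def by simp
  obtain K where K: "\<And>x. x \<in> {0..1} \<Longrightarrow> \<bar>u x\<bar> \<le> K"
    using continuous_bounded_01[OF cu] by blast
  have K0: "0 \<le> K" using K[of 0] by auto
  have UK: "\<bar>U x\<bar> \<le> K" for x using K[of x] K0 by (auto simp: U_def I_def indicator_def)
  have UV: "integrable lborel (\<lambda>x. 2 * V x * U x)"
  proof (rule Bochner_Integration.integrable_bound[where f="\<lambda>x. 2 * \<bar>V x\<bar> * K"])
    show "integrable lborel (\<lambda>x. 2 * \<bar>V x\<bar> * K)" using V by simp
    show "AE x in lborel. norm (2 * V x * U x) \<le> norm (2 * \<bar>V x\<bar> * K)"
      using UK K0 by (auto simp: abs_mult intro!: AE_I2 mult_left_mono)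
  qed simp
  have FV: "(\<integral>t. indicator {..<x} t * V t \<partial>lborel) = u x - u 0" if "0 < x" "x \<le> 1" for x
  proof -
    have "indicator {..<x} t * V t = indicator {0<..<x} t * v t" for t
      using that by (auto simp: V_def I_def indicator_def)
    then show ?thesis using H1_deriv_FTC[OF H cu that] by simp
  qed
  have FUV: "(\<integral>t. indicator {..<x} t * (2 * V t * U t) \<partial>lborel) = (u x)\<^sup>2 - (u 0)\<^sup>2" if x: "0 < x" "x \<le> 1" for x
  proof -
    \<comment> \<open>Cutting v off at x makes the formula on the whole line deliver u^2 at the
      point x.\<close>
    define Vx where "Vx t = indicator {..<x} t * V t" for t
    have Vx: "integrable lborel Vx"
      using integrable_mult_indicator[of "{..<x}" lborel V] V by (simp add: Vx_def[abs_def])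
    have "(\<integral>t. Vx t * (\<integral>s. indicator {..<t} s * Vx s \<partial>lborel) \<partial>lborel)
        = (\<integral>t. Vx t * (U t - u 0) \<partial>lborel)"
    proof (rule Bochner_Integration.integral_cong[OF refl])
      fix t
      show "Vx t * (\<integral>s. indicator {..<t} s * Vx s \<partial>lborel) = Vx t * (U t - u 0)"
      proof (cases "0 < t \<and> t < x")
        case True
        then have "(\<lambda>s. indicator {..<t} s * Vx s) = (\<lambda>s. indicator {..<t} s * V s)"
          by (auto simp: Vx_def indicator_def)
        then show ?thesis using FV[of t] True x by (simp add: U_def I_def)
      next
        case False
        then have "Vx t = 0" using x by (auto simp: Vx_def V_def I_def indicator_def)
        then show ?thesis by simp
      qed
    qed
    moreover have "(\<integral>t. (\<integral>s. indicator {..<t} s * Vx s \<partial>lborel) * Vx t \<partial>lborel)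
        = (\<integral>t. Vx t * (\<integral>s. indicator {..<t} s * Vx s \<partial>lborel) \<partial>lborel)"
      by (simp add: mult.commute)
    moreover have "(\<integral>t. Vx t \<partial>lborel) = u x - u 0" using FV[OF x] by (simp add: Vx_def)
    ultimately have e: "2 * (\<integral>t. Vx t * (U t - u 0) \<partial>lborel) = (u x - u 0)\<^sup>2"
      using integral_by_parts_indefinite[OF Vx Vx] by (simp add: power2_eq_square)
    have iVU: "integrable lborel (\<lambda>t. Vx t * U t)"
      using integrable_mult_right[OF integrable_mult_indicator[of "{..<x}" lborel, OF _ UV], of "1/2"]
      by (simp add: Vx_def[abs_def] mult_ac)
    have "(\<integral>t. Vx t * (U t - u 0) \<partial>lborel) = (\<integral>t. Vx t * U t \<partial>lborel) - (u x - u 0) * u 0"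
      unfolding right_diff_distrib using iVU Vx \<open>(\<integral>t. Vx t \<partial>lborel) = u x - u 0\<close> by simp
    moreover have "(\<integral>t. indicator {..<x} t * (2 * V t * U t) \<partial>lborel) = 2 * (\<integral>t. Vx t * U t \<partial>lborel)"
      by (subst integral_mult_right_zero[symmetric], rule Bochner_Integration.integral_cong)
        (auto simp: Vx_def)
    ultimately show ?thesis using e by (simp add: power2_eq_square algebra_simps)
  qed
  have FG: "(\<integral>t. indicator {..<x} t * G' t \<partial>lborel) = g x - g 0" if x: "0 < x" "x \<le> 1" for x
  proof -
    have "(\<integral>t. indicator {0..x} t *\<^sub>R g' t \<partial>lborel) = g x - g 0"
    proof (rule integral_FTC_atLeastAtMost)
      show "(g has_vector_derivative g' t) (at t within {0..x})" if "0 \<le> t" "t \<le> x" for t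
        using dg[of t] that x unfolding has_real_derivative_iff_has_vector_derivative[symmetric]
        by (auto intro: has_field_derivative_subset)
      show "continuous_on {0..x} g'" using cg x by (auto intro: continuous_on_subset)
    qed (use x in auto)
    moreover have "(\<integral>t. indicator {0..x} t *\<^sub>R g' t \<partial>lborel) = (\<integral>t. indicator {..<x} t * G' t \<partial>lborel)"
    proof (rule integral_cong_AE)
      have "integrable lborel (\<lambda>t. indicator {0..x} t *\<^sub>R g' t)"
        using borel_integrable_atLeastAtMost'[of 0 x g'] continuous_on_subset[OF cg, of "{0..x}"] x
        by (simp add: set_integrable_def)
      then show "(\<lambda>t. indicator {0..x} t *\<^sub>R g' t) \<in> borel_measurable lborel" by auto
      show "AE t in lborel. indicator {0..x} t *\<^sub>R g' t = indicator {..<x} t * G' t"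
        using AE_lborel_singleton[of x] AE_lborel_singleton[of "0::real"]
        by eventually_elim (use x in \<open>auto simp: G'_def I_def indicator_def\<close>)
    qed (use G' in measurable)
    ultimately show ?thesis by simp
  qed
  have cg0: "continuous_on {0..1} g" using dg by (rule DERIV_continuous_on)
  have outside: "I x = 0" if "\<not> (0 < x \<and> x < 1)" for x using that by (auto simp: I_def)
  have "(\<integral>x. 2 * V x * U x * (\<integral>t. indicator {..<x} t * G' t \<partial>lborel) \<partial>lborel)
      + (\<integral>x. (\<integral>t. indicator {..<x} t * (2 * V t * U t) \<partial>lborel) * G' x \<partial>lborel)
      = (\<integral>x. 2 * V x * U x \<partial>lborel) * (\<integral>x. G' x \<partial>lborel)"
    by (rule integral_by_parts_indefinite[OF UV G'])
  moreover have "(\<integral>x. 2 * V x * U x * (\<integral>t. indicator {..<x} t * G' t \<partial>lborel) \<partial>lborel)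
      = (\<integral>x. I x * (2 * u x * v x * g x) - g 0 * (2 * V x * U x) \<partial>lborel)"
  proof (rule Bochner_Integration.integral_cong[OF refl])
    fix x
    show "2 * V x * U x * (\<integral>t. indicator {..<x} t * G' t \<partial>lborel) = I x * (2 * u x * v x * g x) - g 0 * (2 * V x * U x)"
    proof (cases "0 < x \<and> x < 1")
      case True
      then have "(\<integral>t. indicator {..<x} t * G' t \<partial>lborel) = g x - g 0" "I x = 1" by (auto intro!: FG simp: I_def)
      then show ?thesis by (simp only: V_def U_def) (simp add: algebra_simps)
    next
      case False
      then show ?thesis by (simp add: V_def outside)
    qed
  qed
  moreover have "(\<integral>x. (\<integral>t. indicator {..<x} t * (2 * V t * U t) \<partial>lborel) * G' x \<partial>lborel)
      = (\<integral>x. I x * ((u x)\<^sup>2 * g' x) - (u 0)\<^sup>2 * G' x \<partial>lborel)"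
  proof (rule Bochner_Integration.integral_cong[OF refl])
    fix x
    show "(\<integral>t. indicator {..<x} t * (2 * V t * U t) \<partial>lborel) * G' x = I x * ((u x)\<^sup>2 * g' x) - (u 0)\<^sup>2 * G' x"
    proof (cases "0 < x \<and> x < 1")
      case True
      then have "(\<integral>t. indicator {..<x} t * (2 * V t * U t) \<partial>lborel) = (u x)\<^sup>2 - (u 0)\<^sup>2" by (intro FUV) auto
      then show ?thesis by (simp only: G'_def) (simp add: algebra_simps)
    next
      case False
      then show ?thesis by (simp add: G'_def outside)
    qed
  qed
  moreover have "(\<integral>x. 2 * V x * U x \<partial>lborel) = (u 1)\<^sup>2 - (u 0)\<^sup>2"
  proof -
    have "(\<lambda>t. indicator {..<1} t * (2 * V t * U t)) = (\<lambda>t. 2 * V t * U t)"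
      by (auto simp: V_def I_def indicator_def fun_eq_iff)
    then show ?thesis using FUV[of 1] by simp
  qed
  moreover have iG: "(\<integral>x. G' x \<partial>lborel) = g 1 - g 0"
  proof -
    have "(\<lambda>t. indicator {..<1} t * G' t) = G'" by (auto simp: G'_def I_def indicator_def fun_eq_iff)
    then show ?thesis using FG[of 1] by simp
  qed
  moreover have i1: "integrable lborel (\<lambda>x. I x * (2 * u x * v x * g x))"
  proof -
    obtain C where C: "\<And>x. x \<in> {0..1} \<Longrightarrow> \<bar>g x\<bar> \<le> C"
      using continuous_bounded_01[OF cg0] by blast
    have [measurable]: "(\<lambda>x. I x * g x) \<in> borel_measurable borel"
      unfolding I_def by (rule indicator_continuous_measurable[OF cg0])
    have "integrable lborel (\<lambda>x. (2 * V x * U x) * (I x * g x))"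
    proof (rule Bochner_Integration.integrable_bound[where f="\<lambda>x. (2 * V x * U x) * C"])
      show "AE x in lborel. norm ((2 * V x * U x) * (I x * g x)) \<le> norm ((2 * V x * U x) * C)"
      proof (rule AE_I2)
        fix x
        have "\<bar>I x * g x\<bar> \<le> \<bar>C\<bar>" using C[of x] C[of 0] by (auto simp: I_def indicator_def)
        then show "norm ((2 * V x * U x) * (I x * g x)) \<le> norm ((2 * V x * U x) * C)"
          unfolding norm_mult by (intro mult_left_mono) auto
      qed
    qed (use UV in auto)
    moreover have "(2 * V x * U x) * (I x * g x) = I x * (2 * u x * v x * g x)" for x
      using I01[of x] by (auto simp: V_def U_def)
    ultimately show ?thesis by simp
  qed
  moreover have i2: "integrable lborel (\<lambda>x. I x * ((u x)\<^sup>2 * g' x))"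
  proof -
    have "integrable lborel (\<lambda>x. (U x)\<^sup>2 * G' x)"
    proof (rule Bochner_Integration.integrable_bound[where f="\<lambda>x. K\<^sup>2 * G' x"])
      show "AE x in lborel. norm ((U x)\<^sup>2 * G' x) \<le> norm (K\<^sup>2 * G' x)"
      proof (rule AE_I2)
        fix x
        have "(U x)\<^sup>2 \<le> K\<^sup>2" using UK[of x] K0 by (simp add: abs_le_square_iff[symmetric])
        then show "norm ((U x)\<^sup>2 * G' x) \<le> norm (K\<^sup>2 * G' x)"
          unfolding norm_mult by (intro mult_right_mono) auto
      qed
    qed (use G' in auto)
    moreover have "(U x)\<^sup>2 * G' x = I x * ((u x)\<^sup>2 * g' x)" for x
      using I01[of x] by (auto simp: G'_def U_def)
    ultimately show ?thesis by simp
  qed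
  ultimately have "(\<integral>x. I x * (2 * u x * v x * g x) \<partial>lborel) - g 0 * ((u 1)\<^sup>2 - (u 0)\<^sup>2)
      + ((\<integral>x. I x * ((u x)\<^sup>2 * g' x) \<partial>lborel) - (u 0)\<^sup>2 * (g 1 - g 0)) = ((u 1)\<^sup>2 - (u 0)\<^sup>2) * (g 1 - g 0)"
    using UV G' by simp
  then show ?thesis
    using i1 i2 unfolding set_lebesgue_integral_def I_def[symmetric]
    by (simp add: distrib_left algebra_simps)
qed

section \<open>Piecewise C^1 functions as elements of H^1\<close>

lemma set_integral_FTC_finite:
  fixes F f :: "real \<Rightarrow> real"
  assumes S: "finite S" and c: "continuous_on {0..1} F"
    and d: "\<And>x. 0 < x \<Longrightarrow> x < 1 \<Longrightarrow> x \<notin> S \<Longrightarrow> (F has_real_derivative f x) (at x)"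
    and i: "set_integrable lborel {0<..<1} f"
  shows "(LBINT x:{0<..<1}. f x) = F 1 - F 0"
proof -
  have "(f has_integral (F 1 - F 0)) {0..1}"
    by (rule fundamental_theorem_of_calculus_interior_strong[OF S])
      (use c d in \<open>auto simp: has_real_derivative_iff_has_vector_derivative[symmetric]\<close>)
  then have "(f has_integral (F 1 - F 0)) {0<..<1}"
    by (simp add: has_integral_Icc_iff_Ioo)
  with set_borel_integral_eq_integral[OF i] show ?thesis by (simp add: integral_unique)
qed

text \<open>The class from which all explicit competitors and directions are taken. The finite
  exceptional set admits the corner of a solution truncated at its first zero.\<close>

definition pw_C1 :: "(real \<Rightarrow> real) \<Rightarrow> (real \<Rightarrow> real) \<Rightarrow> bool" where
  "pw_C1 u v \<longleftrightarrow> continuous_on {0..1} u \<and> (\<lambda>x. indicator {0<..<1} x * v x) \<in> borel_measurable borel \<and>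
     (\<exists>K. \<forall>x\<in>{0<..<1}. \<bar>v x\<bar> \<le> K) \<and>
     (\<exists>S. finite S \<and> (\<forall>x\<in>{0<..<1} - S. (u has_real_derivative v x) (at x)))"

lemma set_integrable_bounded:
  assumes "(\<lambda>x. indicator {0<..<1} x * f x) \<in> borel_measurable borel"
    and "\<And>x. x \<in> {0<..<1::real} \<Longrightarrow> \<bar>f x\<bar> \<le> (K::real)"
  shows "set_integrable lborel {0<..<1} f"
proof (rule set_integrable_bound)
  show "set_integrable lborel {0<..<1::real} (\<lambda>x. K)"
    by (rule set_integrable_subset[OF borel_integrable_atLeastAtMost'[of 0 1]]) auto
  show "set_borel_measurable lborel {0<..<1} f" using assms(1) by (simp add: set_borel_measurable_def)
  show "AE x in lborel. x \<in> {0<..<1} \<longrightarrow> norm (f x) \<le> norm K"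
    using assms(2) by (auto intro!: AE_I2 order_trans[OF _ abs_ge_self])
qed

lemma bounded_L2:
  assumes m: "(\<lambda>x. indicator {0<..<1} x * f x) \<in> borel_measurable borel"
    and K: "\<And>x. x \<in> {0<..<1::real} \<Longrightarrow> \<bar>f x\<bar> \<le> (K::real)"
  shows "f \<in> L2_01"
proof -
  have "(\<lambda>x. (indicator {0<..<1} x * f x)\<^sup>2) \<in> borel_measurable borel" using m by measurable
  moreover have "(\<lambda>x. (indicator {0<..<1} x * f x)\<^sup>2) = (\<lambda>x. indicator {0<..<1} x * (f x)\<^sup>2)"
    by (auto simp: indicator_def fun_eq_iff)
  moreover have "\<bar>(f x)\<^sup>2\<bar> \<le> K\<^sup>2" if "x \<in> {0<..<1}" for x
    using K[OF that] abs_le_square_iff[of "f x" K] by simp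
  ultimately have "set_integrable lborel {0<..<1} (\<lambda>x. (f x)\<^sup>2)"
    by (intro set_integrable_bounded) auto
  with m show ?thesis by (simp add: L2_01_def set_borel_measurable_def)
qed

lemma continuous_L2:
  assumes "continuous_on {0..1} (f :: real \<Rightarrow> real)"
  shows "f \<in> L2_01"
proof -
  obtain K where "\<And>x. x \<in> {0..1} \<Longrightarrow> \<bar>f x\<bar> \<le> K" using continuous_bounded_01[OF assms] by blast
  then show ?thesis
    using indicator_continuous_measurable[OF assms] by (intro bounded_L2[where K=K]) auto
qed

text \<open>The derivative of u times a test function integrates to boundary terms, which vanish;
  continuity of u makes the finitely many corners harmless.\<close>

lemma pw_C1_H1_deriv:
  assumes "pw_C1 u v"
  shows "H1_deriv u v"
proof -
  obtain K S where cu: "continuous_on {0..1} u"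
    and vm: "(\<lambda>x. indicator {0<..<1} x * v x) \<in> borel_measurable borel"
    and K: "\<And>x. x \<in> {0<..<1} \<Longrightarrow> \<bar>v x\<bar> \<le> K" and S: "finite S"
    and du: "\<And>x. x \<in> {0<..<1} - S \<Longrightarrow> (u has_real_derivative v x) (at x)"
    using assms unfolding pw_C1_def by blast
  have vL: "v \<in> L2_01" using vm K by (rule bounded_L2)
  have uL: "u \<in> L2_01" using cu by (rule continuous_L2)
  have "weak_deriv_01 u v"
    unfolding weak_deriv_01_def
  proof
    fix \<phi> assume "\<phi> \<in> test_functions"
    then have C1: "\<phi> C1_differentiable_on UNIV" and cl: "closure {x. \<phi> x \<noteq> 0} \<subseteq> {0<..<1}"
      by (auto simp: test_functions_def)
    then obtain D where D: "\<And>x. (\<phi> has_real_derivative D x) (at x)" "continuous_on UNIV D"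
      unfolding C1_differentiable_on_def has_real_derivative_iff_has_vector_derivative by auto
    then have dD: "deriv \<phi> = D" by (auto intro!: DERIV_imp_deriv)
    have "\<phi> x = 0" if "x \<notin> {0<..<1}" for x
      using cl closure_subset[of "{x. \<phi> x \<noteq> 0}"] that by blast
    then have z: "\<phi> 0 = 0" "\<phi> 1 = 0" by auto
    have cphi: "continuous_on {0..1} \<phi>"
      by (intro continuous_at_imp_continuous_on ballI DERIV_isCont[OF D(1)])
    have cD: "continuous_on {0..1} D" using D(2) by (rule continuous_on_subset) simp
    have phiL: "\<phi> \<in> L2_01"
      by (rule continuous_L2[OF cphi])
    have DL: "D \<in> L2_01"
      by (rule continuous_L2[OF cD])
    have i: "set_integrable lborel {0<..<1} (\<lambda>x. u x * D x)" "set_integrable lborel {0<..<1} (\<lambda>x. v x * \<phi> x)"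
      using set_integrable_L2_mult uL vL phiL DL by auto
    have "(LBINT x:{0<..<1}. u x * D x + v x * \<phi> x) = u 1 * \<phi> 1 - u 0 * \<phi> 0"
    proof (rule set_integral_FTC_finite[OF S])
      show "continuous_on {0..1} (\<lambda>x. u x * \<phi> x)" by (intro continuous_intros cu cphi)
      show "((\<lambda>x. u x * \<phi> x) has_real_derivative u x * D x + v x * \<phi> x) (at x)"
        if "0 < x" "x < 1" "x \<notin> S" for x
        using DERIV_mult[OF du[of x] D(1)[of x]] that by (simp add: algebra_simps)
    qed (use i in \<open>rule set_integral_add(1)\<close>)
    then show "(LBINT x:{0<..<1}. u x * deriv \<phi> x) = - (LBINT x:{0<..<1}. v x * \<phi> x)"
      unfolding dD set_integral_add(2)[OF i] z by simp
  qed
  with uL vL show ?thesis by (simp add: H1_deriv_def)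
qed

section \<open>The energy functional and lower bounds\<close>

text \<open>The analytic continuation of p + \<beta> p_x from (0,1) to the line. It does not share
  the jumps of p_x at the integers, so fluxes have values at both endpoints.\<close>

definition wt :: "real \<Rightarrow> real \<Rightarrow> real" where
  "wt \<beta> x = (cosh (x - 1/2) + \<beta> * sinh (x - 1/2)) / (2 * sinh (1/2))"

lemma wt_cont: "continuous_on A (wt \<beta>)"
  unfolding wt_def by (intro continuous_intros) auto

lemma wt_eq: "wt \<beta> x = wt 0 x + \<beta> * (wt 1 x - wt 0 x)"
  by (simp add: wt_def field_simps)

lemma wt_reflect: "wt (- \<beta>) x = wt \<beta> (1 - x)"
proof -
  have "1 - x - 1/2 = - (x - 1/2)" by simp
  then show ?thesis unfolding wt_def by (simp only: cosh_minus sinh_minus) simp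
qed

lemma pker_eq: "0 < x \<Longrightarrow> x < 1 \<Longrightarrow> pker x = cosh (x - 1/2) / (2 * sinh (1/2))"
proof -
  assume "0 < x" "x < 1"
  then have "\<lfloor>x\<rfloor> = 0" by (simp add: floor_eq_iff)
  then show ?thesis by (simp add: pker_def)
qed

lemma pker_weight: "0 < x \<Longrightarrow> x < 1 \<Longrightarrow> pker x + \<beta> * deriv pker x = wt \<beta> x"
proof -
  assume x: "0 < x" "x < 1"
  have "((\<lambda>x. cosh (x - 1/2) / (2 * sinh (1/2))) has_real_derivative sinh (x - 1/2) / (2 * sinh (1/2))) (at x)"
    by (rule derivative_eq_intros refl | simp)+
  then have "(pker has_real_derivative sinh (x - 1/2) / (2 * sinh (1/2))) (at x)"
    by (rule has_field_derivative_transform_within_open[where S="{0<..<1}"]) (use x pker_eq in auto)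
  then have "deriv pker x = sinh (x - 1/2) / (2 * sinh (1/2))" by (rule DERIV_imp_deriv)
  then show ?thesis using pker_eq[OF x] by (simp add: wt_def field_simps)
qed

lemma energy_wt:
  "energy \<alpha> \<beta> u v = (LBINT x:{0<..<1}. wt \<beta> x * (\<alpha> * (u x)\<^sup>2 + (v x)\<^sup>2))"
  unfolding energy_def set_lebesgue_integral_def
  by (rule Bochner_Integration.integral_cong[OF refl]) (auto simp: indicator_def pker_weight)

lemma set_integrable_cont_mult:
  assumes c: "continuous_on {0..1} (w :: real \<Rightarrow> real)" and f: "set_integrable lborel {0<..<1} f"
  shows "set_integrable lborel {0<..<1} (\<lambda>x. w x * f x)"
proof -
  obtain K where K: "\<And>x. x \<in> {0..1} \<Longrightarrow> \<bar>w x\<bar> \<le> K" using continuous_bounded_01[OF c] by blast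
  show ?thesis
  proof (rule set_integrable_bound)
    show "set_integrable lborel {0<..<1} (\<lambda>x. K * f x)" using f by simp
    have "(\<lambda>x. (indicator {0<..<1} x * w x) * (indicator {0<..<1} x * f x)) \<in> borel_measurable borel"
      using indicator_continuous_measurable[OF c] borel_measurable_integrable[OF f[unfolded set_integrable_def]]
      by simp
    moreover have "(\<lambda>x. (indicator {0<..<1} x * w x) * (indicator {0<..<1} x * f x)) = (\<lambda>x. indicator {0<..<1} x * (w x * f x))"
      by (auto simp: fun_eq_iff indicator_def)
    ultimately show "set_borel_measurable lborel {0<..<1} (\<lambda>x. w x * f x)"
      by (simp add: set_borel_measurable_def)
    have "\<bar>w x\<bar> \<le> \<bar>K\<bar>" if "x \<in> {0<..<1}" for x using K[of x] that by auto
    then show "AE x in lborel. x \<in> {0<..<1} \<longrightarrow> norm (w x * f x) \<le> norm (K * f x)"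
      by (auto simp: abs_mult intro!: AE_I2 mult_right_mono)
  qed
qed

lemma wt_L2_integrable:
  "f \<in> L2_01 \<Longrightarrow> g \<in> L2_01 \<Longrightarrow> set_integrable lborel {0<..<1} (\<lambda>x. wt \<beta> x * (f x * g x))"
  by (intro set_integrable_cont_mult wt_cont set_integrable_L2_mult)

lemma energy_eq:
  assumes "u \<in> L2_01" "v \<in> L2_01"
  shows "energy \<alpha> \<beta> u v = \<alpha> * (LBINT x:{0<..<1}. wt \<beta> x * (u x * u x)) + (LBINT x:{0<..<1}. wt \<beta> x * (v x * v x))"
proof -
  have "energy \<alpha> \<beta> u v = (LBINT x:{0<..<1}. \<alpha> * (wt \<beta> x * (u x * u x)) + wt \<beta> x * (v x * v x))"
    unfolding energy_wt by (simp add: algebra_simps power2_eq_square)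
  also have "\<dots> = \<alpha> * (LBINT x:{0<..<1}. wt \<beta> x * (u x * u x)) + (LBINT x:{0<..<1}. wt \<beta> x * (v x * v x))"
    by (subst set_integral_add(2)) (auto intro!: set_integrable_mult_right wt_L2_integrable assms)
  finally show ?thesis .
qed

lemma wt_integral_affine:
  assumes "f \<in> L2_01" "g \<in> L2_01"
  shows "(LBINT x:{0<..<1}. wt \<beta> x * (f x * g x)) = (LBINT x:{0<..<1}. wt 0 x * (f x * g x)) +
     \<beta> * ((LBINT x:{0<..<1}. wt 1 x * (f x * g x)) - (LBINT x:{0<..<1}. wt 0 x * (f x * g x)))"
proof -
  note i = wt_L2_integrable[OF assms]
  have "(LBINT x:{0<..<1}. wt \<beta> x * (f x * g x))
     = (LBINT x:{0<..<1}. wt 0 x * (f x * g x) + \<beta> * (wt 1 x * (f x * g x) - wt 0 x * (f x * g x)))"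
    by (subst wt_eq) (simp add: algebra_simps)
  also have "\<dots> = (LBINT x:{0<..<1}. wt 0 x * (f x * g x)) +
     \<beta> * ((LBINT x:{0<..<1}. wt 1 x * (f x * g x)) - (LBINT x:{0<..<1}. wt 0 x * (f x * g x)))"
    using i by (subst set_integral_add(2)) (auto intro!: set_integrable_mult_right set_integral_diff(1) simp: set_integral_diff(2))
  finally show ?thesis .
qed

lemma energy_bilinear:
  assumes "H1_deriv u v"
  obtains U0 U1 V0 V1 where "\<And>\<alpha> \<beta>. energy \<alpha> \<beta> u v = \<alpha> * (U0 + \<beta> * U1) + (V0 + \<beta> * V1)"
proof -
  have L: "u \<in> L2_01" "v \<in> L2_01" using assms by (auto simp: H1_deriv_def)
  show thesis
    by (rule that) (subst energy_eq[OF L], subst wt_integral_affine[OF L(1) L(1)],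
        subst wt_integral_affine[OF L(2) L(2)], rule refl)
qed

lemma energy_convex_alpha:
  assumes "H1_deriv u v"
  shows "energy ((1 - t) * a + t * b) \<beta> u v = (1 - t) * energy a \<beta> u v + t * energy b \<beta> u v"
proof -
  from energy_bilinear[OF assms] obtain U0 U1 V0 V1
    where "\<And>\<alpha> \<beta>. energy \<alpha> \<beta> u v = \<alpha> * (U0 + \<beta> * U1) + (V0 + \<beta> * V1)" by blast
  then show ?thesis by (simp add: algebra_simps)
qed

lemma energy_convex_beta:
  assumes "H1_deriv u v"
  shows "energy \<alpha> ((1 - t) * a + t * b) u v = (1 - t) * energy \<alpha> a u v + t * energy \<alpha> b u v"
proof -
  from energy_bilinear[OF assms] obtain U0 U1 V0 V1
    where "\<And>\<alpha> \<beta>. energy \<alpha> \<beta> u v = \<alpha> * (U0 + \<beta> * U1) + (V0 + \<beta> * V1)" by blast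
  then show ?thesis by (simp add: algebra_simps)
qed

definition competitor :: "(real \<Rightarrow> real) \<Rightarrow> (real \<Rightarrow> real) \<Rightarrow> bool" where
  "competitor u v \<longleftrightarrow> H1_deriv u v \<and> continuous_on {0..1} u \<and> u 0 = 1 \<and> u 1 = 1"

text \<open>Since \<alpha> and \<beta>^2 are finite they can be moved across, also when the infimum
  is minus infinity. From here on the infimum is replaced by a bound for every competitor.\<close>

lemma admissible_iff:
  "admissible \<alpha> \<beta> \<longleftrightarrow> (\<forall>u v. competitor u v \<longrightarrow> \<alpha> - \<beta>\<^sup>2 \<le> energy \<alpha> \<beta> u v)"
proof -
  have "admissible \<alpha> \<beta> \<longleftrightarrow> ereal (\<alpha> - \<beta>\<^sup>2) \<le> I_inf \<alpha> \<beta>"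
    unfolding admissible_def by (cases "I_inf \<alpha> \<beta>") auto
  also have "\<dots> \<longleftrightarrow> (\<forall>u v. competitor u v \<longrightarrow> \<alpha> - \<beta>\<^sup>2 \<le> energy \<alpha> \<beta> u v)"
    unfolding I_inf_def le_Inf_iff competitor_def by (auto simp del: ereal_less_eq simp flip: ereal_less_eq(3)) 
  finally show ?thesis .
qed

lemma beta_crit_le: "0 \<le> \<beta> \<Longrightarrow> admissible ((3 - \<gamma>) / \<gamma>) \<beta> \<Longrightarrow> beta_crit \<gamma> \<le> ereal \<beta>"
  unfolding beta_crit_def by (rule Inf_lower) auto

lemma pw_C1_const: "pw_C1 (\<lambda>x. c) (\<lambda>x. 0)"
  unfolding pw_C1_def by (auto intro!: exI[of _ 0] exI[of _ "{}"])

lemma pw_C1_add: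
  assumes "pw_C1 u v" "pw_C1 f g"
  shows "pw_C1 (\<lambda>x. u x + f x) (\<lambda>x. v x + g x)"
proof -
  obtain K S where 1: "continuous_on {0..1} u"
    "(\<lambda>x. indicator {0<..<1} x * v x) \<in> borel_measurable borel"
    "\<forall>x\<in>{0<..<1}. \<bar>v x\<bar> \<le> K" "finite S"
    "\<forall>x\<in>{0<..<1} - S. (u has_real_derivative v x) (at x)"
    using assms(1) unfolding pw_C1_def by blast
  obtain L T where 2: "continuous_on {0..1} f"
    "(\<lambda>x. indicator {0<..<1} x * g x) \<in> borel_measurable borel"
    "\<forall>x\<in>{0<..<1}. \<bar>g x\<bar> \<le> L" "finite T"
    "\<forall>x\<in>{0<..<1} - T. (f has_real_derivative g x) (at x)"
    using assms(2) unfolding pw_C1_def by blast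
  have "(\<lambda>x. indicator {0<..<1} x * (v x + g x)) \<in> borel_measurable borel"
    unfolding distrib_left using 1(2) 2(2) by measurable
  moreover have "\<bar>v x + g x\<bar> \<le> K + L" if "x \<in> {0<..<1}" for x
    using 1(3) 2(3) that by (intro order_trans[OF abs_triangle_ineq] add_mono) auto
  moreover have "\<forall>x\<in>{0<..<1} - (S \<union> T). ((\<lambda>x. u x + f x) has_real_derivative v x + g x) (at x)"
    using 1(5) 2(5) by (auto intro!: DERIV_add)
  moreover have "continuous_on {0..1} (\<lambda>x. u x + f x)" using 1 2 by (intro continuous_intros)
  ultimately show ?thesis unfolding pw_C1_def using 1(4) 2(4) by (meson finite_UnI)
qed

lemma pw_C1_scale:
  assumes "pw_C1 u v"
  shows "pw_C1 (\<lambda>x. c * u x) (\<lambda>x. c * v x)"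
proof -
  obtain K S where 1: "continuous_on {0..1} u"
    "(\<lambda>x. indicator {0<..<1} x * v x) \<in> borel_measurable borel"
    "\<forall>x\<in>{0<..<1}. \<bar>v x\<bar> \<le> K" "finite S"
    "\<forall>x\<in>{0<..<1} - S. (u has_real_derivative v x) (at x)"
    using assms(1) unfolding pw_C1_def by blast
  have "(\<lambda>x. c * (indicator {0<..<1} x * v x)) \<in> borel_measurable borel"
    using 1(2) by measurable
  then have "(\<lambda>x. indicator {0<..<1} x * (c * v x)) \<in> borel_measurable borel" by (simp add: mult.left_commute)
  moreover have "\<bar>c * v x\<bar> \<le> \<bar>c\<bar> * K" if "x \<in> {0<..<1}" for x
    using 1(3) that by (auto simp: abs_mult intro!: mult_left_mono)
  moreover have "\<forall>x\<in>{0<..<1} - S. ((\<lambda>x. c * u x) has_real_derivative c * v x) (at x)"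
    using 1(5) by (auto intro!: DERIV_cmult)
  moreover have "continuous_on {0..1} (\<lambda>x. c * u x)" using 1 by (intro continuous_intros)
  ultimately show ?thesis unfolding pw_C1_def using 1(4) by (meson)
qed

lemma pw_C1_smooth:
  assumes "\<And>x. x \<in> {0..1} \<Longrightarrow> (u has_real_derivative v x) (at x)" "continuous_on {0..1} v"
  shows "pw_C1 u v"
proof -
  obtain K where "\<And>x. x \<in> {0..1} \<Longrightarrow> \<bar>v x\<bar> \<le> K" using continuous_bounded_01[OF assms(2)] by blast
  moreover have "continuous_on {0..1} u"
    by (intro continuous_at_imp_continuous_on ballI DERIV_isCont[OF assms(1)])
  ultimately show ?thesis
    unfolding pw_C1_def using assms indicator_continuous_measurable[OF assms(2)]
    by (auto intro!: exI[of _ "{}"] exI[of _ K])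
qed

lemma pw_C1_L2: "pw_C1 u v \<Longrightarrow> u \<in> L2_01 \<and> v \<in> L2_01"
  using pw_C1_H1_deriv[of u v] by (simp add: H1_deriv_def)

lemma pw_C1_competitor: "pw_C1 u v \<Longrightarrow> u 0 = 1 \<Longrightarrow> u 1 = 1 \<Longrightarrow> competitor u v"
  using pw_C1_H1_deriv[of u v] by (auto simp: competitor_def pw_C1_def)

text \<open>The weight has mass 1 for every \<beta>: p integrates to 1 over a period, and p has the
  same value at both ends, so p_x integrates to 0.\<close>

lemma energy_one: "energy \<alpha> \<beta> (\<lambda>x. 1) (\<lambda>x. 0) = \<alpha>"
proof -
  have L: "(\<lambda>x. 1) \<in> L2_01" "(\<lambda>x. 0) \<in> L2_01" by (rule const_L2)+
  have i: "set_integrable lborel {0<..<1} (wt \<beta>)"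
    using wt_L2_integrable[OF L(1) L(1), of \<beta>] by simp
  have "(LBINT x:{0<..<1}. wt \<beta> x) =
      (sinh (1 - 1/2) + \<beta> * cosh (1 - 1/2)) / (2 * sinh (1/2)) - (sinh (0 - 1/2) + \<beta> * cosh (0 - 1/2)) / (2 * sinh (1/2))"
    by (rule set_integral_FTC_finite[where S="{}", OF _ _ _ i])
      (auto intro!: continuous_intros derivative_eq_intros simp: wt_def field_simps)
  also have "\<dots> = 1" by (simp add: field_simps)
  finally show ?thesis by (simp add: energy_eq[OF L])
qed

lemma competitor_one: "competitor (\<lambda>x. 1) (\<lambda>x. 0)"
  by (rule pw_C1_competitor[OF pw_C1_const]) auto

lemma energy_expand:
  assumes uv: "u \<in> L2_01" "v \<in> L2_01" and fg: "f \<in> L2_01" "g \<in> L2_01"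
  shows "energy \<alpha> \<beta> (\<lambda>x. u x + t * f x) (\<lambda>x. v x + t * g x)
    = energy \<alpha> \<beta> u v + 2 * t * (LBINT x:{0<..<1}. wt \<beta> x * (\<alpha> * u x * f x + v x * g x)) + t\<^sup>2 * energy \<alpha> \<beta> f g"
proof -
  let ?J = "\<lambda>a b. LBINT x:{0<..<1}. wt \<beta> x * (a x * b x)"
  note i = wt_L2_integrable[of _ _ \<beta>]
  have e: "energy \<alpha> \<beta> (\<lambda>x. u x + t * f x) (\<lambda>x. v x + t * g x) =
    (LBINT x:{0<..<1}. (\<alpha> * (wt \<beta> x * (u x * u x)) + wt \<beta> x * (v x * v x)) +
      (2 * t * (wt \<beta> x * (\<alpha> * u x * f x + v x * g x)) + t\<^sup>2 * (\<alpha> * (wt \<beta> x * (f x * f x)) + wt \<beta> x * (g x * g x))))"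
    unfolding energy_wt by (simp add: algebra_simps power2_eq_square)
  have m: "(\<lambda>x. wt \<beta> x * (\<alpha> * u x * f x + v x * g x)) = (\<lambda>x. \<alpha> * (wt \<beta> x * (u x * f x)) + wt \<beta> x * (v x * g x))"
    by (simp add: algebra_simps)
  have im: "set_integrable lborel {0<..<1} (\<lambda>x. wt \<beta> x * (\<alpha> * u x * f x + v x * g x))"
    unfolding m by (intro set_integral_add(1) set_integrable_mult_right i uv fg)
  have i1: "set_integrable lborel {0<..<1} (\<lambda>x. \<alpha> * (wt \<beta> x * (u x * u x)) + wt \<beta> x * (v x * v x))"
    by (intro set_integral_add(1) set_integrable_mult_right i uv fg)
  have i2: "set_integrable lborel {0<..<1} (\<lambda>x. \<alpha> * (wt \<beta> x * (f x * f x)) + wt \<beta> x * (g x * g x))"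
    by (intro set_integral_add(1) set_integrable_mult_right i uv fg)
  have "(LBINT x:{0<..<1}. \<alpha> * (wt \<beta> x * (u x * u x)) + wt \<beta> x * (v x * v x)) = energy \<alpha> \<beta> u v"
    "(LBINT x:{0<..<1}. \<alpha> * (wt \<beta> x * (f x * f x)) + wt \<beta> x * (g x * g x)) = energy \<alpha> \<beta> f g"
    unfolding energy_wt by (simp_all add: algebra_simps power2_eq_square)
  then show ?thesis unfolding e using im i1 i2
    by (simp add: set_integral_add)
qed

text \<open>Completing the square with the Riccati function \<open>g = k / y\<close>.\<close>

lemma energy_lower_Riccati:
  assumes uv: "competitor u v"
    and w: "\<And>x. 0 < x \<Longrightarrow> x < 1 \<Longrightarrow> 0 < wt \<beta> x"
    and dg: "\<And>x. x \<in> {0..1} \<Longrightarrow> (g has_real_derivative g' x) (at x)"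
    and cg: "continuous_on {0..1} g'"
    and ric: "\<And>x. 0 < x \<Longrightarrow> x < 1 \<Longrightarrow> wt \<beta> x * g' x \<le> \<alpha> * (wt \<beta> x)\<^sup>2 - (g x)\<^sup>2"
  shows "g 1 - g 0 \<le> energy \<alpha> \<beta> u v"
proof -
  have H: "H1_deriv u v" and cu: "continuous_on {0..1} u" and u01: "u 0 = 1" "u 1 = 1"
    using uv by (auto simp: competitor_def)
  have L: "u \<in> L2_01" "v \<in> L2_01" using H by (auto simp: H1_deriv_def)
  have cg0: "continuous_on {0..1} g"
    by (intro continuous_at_imp_continuous_on ballI DERIV_isCont[OF dg])
  have "g 1 - g 0 = (LBINT x:{0<..<1}. 2 * u x * v x * g x + (u x)\<^sup>2 * g' x)"
    using H1_deriv_square_FTC[OF H cu has_field_derivative_at_within[OF dg] cg] u01 by simp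
  also have "\<dots> \<le> energy \<alpha> \<beta> u v"
    unfolding energy_wt
  proof (rule set_integral_mono)
    have "set_integrable lborel {0<..<1} (\<lambda>x. 2 * (g x * (u x * v x)) + g' x * (u x * u x))"
      by (intro set_integral_add(1) set_integrable_mult_right set_integrable_cont_mult
          set_integrable_L2_mult L cg cg0)
    then show "set_integrable lborel {0<..<1} (\<lambda>x. 2 * u x * v x * g x + (u x)\<^sup>2 * g' x)"
      by (simp add: algebra_simps power2_eq_square)
    have "set_integrable lborel {0<..<1} (\<lambda>x. \<alpha> * (wt \<beta> x * (u x * u x)) + wt \<beta> x * (v x * v x))"
      by (intro set_integral_add(1) set_integrable_mult_right wt_L2_integrable L)
    then show "set_integrable lborel {0<..<1} (\<lambda>x. wt \<beta> x * (\<alpha> * (u x)\<^sup>2 + (v x)\<^sup>2))"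
      by (simp add: algebra_simps power2_eq_square)
    fix x :: real assume "x \<in> {0<..<1}"
    then have wx: "0 < wt \<beta> x" and r: "wt \<beta> x * g' x \<le> \<alpha> * (wt \<beta> x)\<^sup>2 - (g x)\<^sup>2" using w ric by auto
    have "wt \<beta> x * (2 * u x * v x * g x + (u x)\<^sup>2 * g' x) = 2 * wt \<beta> x * u x * v x * g x + (u x)\<^sup>2 * (wt \<beta> x * g' x)"
      by (simp add: algebra_simps)
    also have "\<dots> \<le> 2 * wt \<beta> x * u x * v x * g x + (u x)\<^sup>2 * (\<alpha> * (wt \<beta> x)\<^sup>2 - (g x)\<^sup>2)"
      using r by (intro add_left_mono mult_left_mono) auto
    also have "\<dots> \<le> 2 * wt \<beta> x * u x * v x * g x + (u x)\<^sup>2 * (\<alpha> * (wt \<beta> x)\<^sup>2 - (g x)\<^sup>2) + (wt \<beta> x * v x - g x * u x)\<^sup>2"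
      by simp
    also have "\<dots> = wt \<beta> x * (wt \<beta> x * (\<alpha> * (u x)\<^sup>2 + (v x)\<^sup>2))"
      by (simp add: algebra_simps power2_eq_square)
    finally show "2 * u x * v x * g x + (u x)\<^sup>2 * g' x \<le> wt \<beta> x * (\<alpha> * (u x)\<^sup>2 + (v x)\<^sup>2)"
      using wx by simp
  qed
  finally show ?thesis .
qed

text \<open>The Riccati function is g = w y' / y. The hypothesis constrains the flux w y' instead of
  y'', which admits a weight vanishing at an endpoint. Reflection yields the same bound at -\<beta>,
  and affinity in \<beta> extends it to everything in between.\<close>

lemma energy_lower_supersolution:
  assumes uv: "competitor u v" and b: "\<bar>\<beta>'\<bar> \<le> \<beta>"
    and w: "\<And>x. 0 < x \<Longrightarrow> x < 1 \<Longrightarrow> 0 < wt \<beta> x"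
    and y: "\<And>x. x \<in> {0..1} \<Longrightarrow> 0 < y x"
    and dy: "\<And>x. x \<in> {0..1} \<Longrightarrow> (y has_real_derivative y' x) (at x)"
    and cy: "continuous_on {0..1} y'"
    and dk: "\<And>x. x \<in> {0..1} \<Longrightarrow> ((\<lambda>x. wt \<beta> x * y' x) has_real_derivative k' x) (at x)"
    and ck: "continuous_on {0..1} k'"
    and super: "\<And>x. 0 < x \<Longrightarrow> x < 1 \<Longrightarrow> k' x \<le> \<alpha> * wt \<beta> x * y x"
  shows "wt \<beta> 1 * y' 1 / y 1 - wt \<beta> 0 * y' 0 / y 0 \<le> energy \<alpha> \<beta>' u v"
proof -
  define g where "g x = wt \<beta> x * y' x / y x" for x
  define g' where "g' x = (k' x * y x - (wt \<beta> x * y' x) * y' x) / (y x * y x)" for x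
  have dg: "(g has_real_derivative g' x) (at x)" if "x \<in> {0..1}" for x
    unfolding g_def g'_def using y[OF that] by (intro DERIV_divide dk dy that) auto
  have cy0: "continuous_on {0..1} y"
    by (intro continuous_at_imp_continuous_on ballI DERIV_isCont[OF dy])
  have cg': "continuous_on {0..1} g'"
    unfolding g'_def using y by (intro continuous_intros cy ck cy0 wt_cont) force
  have ric: "wt \<beta> x * g' x \<le> \<alpha> * (wt \<beta> x)\<^sup>2 - (g x)\<^sup>2" if x: "0 < x" "x < 1" for x
  proof -
    have yx: "0 < y x" using y x by auto
    have "wt \<beta> x * g' x = wt \<beta> x * k' x / y x - (g x)\<^sup>2"
      unfolding g'_def g_def using yx by (simp add: field_simps power2_eq_square)
    moreover have "wt \<beta> x * k' x / y x \<le> wt \<beta> x * (\<alpha> * wt \<beta> x * y x) / y x"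
      using super[OF x] w[OF x] yx by (intro divide_right_mono mult_left_mono) auto
    ultimately show ?thesis using yx by (simp add: power2_eq_square mult_ac)
  qed
  have e1: "g 1 - g 0 \<le> energy \<alpha> \<beta> u v"
    by (rule energy_lower_Riccati[OF uv w dg cg' ric])
  \<comment> \<open>The map x -> 1 - x turns w y' / y into its negative; the flux difference does
    not change.\<close>
  have e2: "- g (1 - 1) - - g (1 - 0) \<le> energy \<alpha> (- \<beta>) u v"
  proof (rule energy_lower_Riccati[OF uv, where g="\<lambda>x. - g (1 - x)" and g'="\<lambda>x. g' (1 - x)"])
    show "0 < wt (- \<beta>) x" if "0 < x" "x < 1" for x
      unfolding wt_reflect using that by (intro w) auto
    show "((\<lambda>x. - g (1 - x)) has_real_derivative g' (1 - x)) (at x)" if "x \<in> {0..1}" for x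
    proof -
      have "(g has_real_derivative g' (1 - x)) (at (1 - x))" using that by (intro dg) auto
      then have "((\<lambda>x. g (1 - x)) has_real_derivative g' (1 - x) * (- 1)) (at x)"
        by (rule DERIV_chain2[where f=g]) (auto intro!: derivative_eq_intros)
      from DERIV_minus[OF this] show ?thesis by simp
    qed
    show "continuous_on {0..1} (\<lambda>x. g' (1 - x))"
      by (rule continuous_on_compose2[OF cg']) (auto intro!: continuous_intros)
    show "wt (- \<beta>) x * g' (1 - x) \<le> \<alpha> * (wt (- \<beta>) x)\<^sup>2 - (- g (1 - x))\<^sup>2" if "0 < x" "x < 1" for x
      unfolding wt_reflect using ric[of "1 - x"] that by simp
  qed
  have H: "H1_deriv u v" using uv by (auto simp: competitor_def)
  have "g 1 - g 0 \<le> energy \<alpha> \<beta>' u v"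
  proof (cases "\<beta> = 0")
    case True then show ?thesis using e1 b by simp
  next
    case False
    define t where "t = (1 + \<beta>' / \<beta>) / 2"
    have bp: "\<beta> > 0" using False b by auto
    have t: "0 \<le> t" "t \<le> 1" using b bp by (auto simp: t_def field_simps abs_le_iff)
    have bt: "\<beta>' = (1 - t) * (- \<beta>) + t * \<beta>" using bp by (simp add: t_def field_simps)
    have "g 1 - g 0 = (1 - t) * (g 1 - g 0) + t * (g 1 - g 0)" by (simp add: algebra_simps)
    also have "\<dots> \<le> (1 - t) * energy \<alpha> (- \<beta>) u v + t * energy \<alpha> \<beta> u v"
      using e1 e2 t by (intro add_mono mult_left_mono) auto
    also have "\<dots> = energy \<alpha> \<beta>' u v" unfolding bt using energy_convex_beta[OF H, of \<alpha> t "-\<beta>" \<beta>] by simp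
    finally show ?thesis .
  qed
  then show ?thesis by (simp add: g_def)
qed

section \<open>Admissible parameters\<close>

text \<open>Strict positivity is asked only near 0, to cover functions truncated at their first
  zero.\<close>

lemma set_integral_pos:
  fixes f :: "real \<Rightarrow> real"
  assumes i: "set_integrable lborel {0<..<1} f" and c: "0 < c" "c \<le> 1"
    and nn: "\<And>x. 0 < x \<Longrightarrow> x < 1 \<Longrightarrow> 0 \<le> f x" and pos: "\<And>x. 0 < x \<Longrightarrow> x < c \<Longrightarrow> 0 < f x"
  shows "0 < (LBINT x:{0<..<1}. f x)"
proof -
  have i': "integrable lborel (\<lambda>x. indicator {0<..<1} x * f x)" using i by (simp add: set_integrable_def)
  have nn': "AE x in lborel. 0 \<le> indicator {0<..<1} x * f x"
    using nn by (auto intro!: AE_I2 simp: indicator_def)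
  have "0 \<le> (\<integral>x. indicator {0<..<1} x * f x \<partial>lborel)" using nn' by (rule integral_nonneg_AE)
  moreover have "(\<integral>x. indicator {0<..<1} x * f x \<partial>lborel) \<noteq> 0"
  proof
    assume "(\<integral>x. indicator {0<..<1} x * f x \<partial>lborel) = 0"
    then have "AE x in lborel. indicator {0<..<1} x * f x = 0"
      using integral_nonneg_eq_0_iff_AE[OF i' nn'] by simp
    then have "AE x in lborel. x \<notin> {0<..<c}"
    proof eventually_elim
      case (elim x)
      then show ?case using c pos[of x] by (auto simp: indicator_def split: if_splits)
    qed
    then have "emeasure lborel {0<..<c} = 0"
      by (subst (asm) AE_iff_measurable[where N="{0<..<c}"]) auto
    then show False using c by simp
  qed
  ultimately show ?thesis by (simp add: set_lebesgue_integral_def)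
qed

text \<open>This is coth (1/2), the largest \<beta> for which the weight stays nonnegative on (0,1);
  there it vanishes at 0.\<close>

definition coth_half :: real where "coth_half = (exp 1 + 1) / (exp 1 - 1)"

lemma exp_half_square: "exp 1 = (exp (1/2::real))\<^sup>2"
  by (simp add: power2_eq_square flip: exp_add)

lemma two_sinh_half: "2 * sinh (1/2::real) = (exp 1 - 1) / exp (1/2)"
  "2 * cosh (1/2::real) = (exp 1 + 1) / exp (1/2)"
  by (simp_all add: sinh_def cosh_def exp_half_square exp_minus field_simps power2_eq_square)

lemma coth_half_eq: "coth_half = cosh (1/2) / sinh (1/2)"
proof -
  have "cosh (1/2) / sinh (1/2::real) = (2 * cosh (1/2)) / (2 * sinh (1/2))" by simp
  also have "\<dots> = coth_half" unfolding two_sinh_half coth_half_def by simp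
  finally show ?thesis by simp
qed

lemma coth_half_gt_1: "coth_half > 1"
proof -
  have "sinh (1/2::real) < cosh (1/2)" by (simp add: sinh_less_cosh_real)
  then show ?thesis by (simp add: coth_half_eq)
qed

lemma wt_coth_half: "wt coth_half x = sinh x / (2 * (sinh (1/2))\<^sup>2)"
proof -
  have "sinh x = sinh ((x - 1/2) + 1/2)" by simp
  also have "\<dots> = sinh (x - 1/2) * cosh (1/2) + cosh (x - 1/2) * sinh (1/2)" by (rule sinh_add)
  finally show ?thesis by (simp add: wt_def coth_half_eq field_simps power2_eq_square)
qed

lemma wt_one: "wt 1 x = exp x / (exp 1 - 1)"
proof -
  have "wt 1 x = exp (x - 1/2) / (2 * sinh (1/2))"
    by (simp add: wt_def cosh_plus_sinh)
  also have "\<dots> = exp (x - 1/2) * exp (1/2) / (exp 1 - 1)" unfolding two_sinh_half by simp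
  also have "exp (x - 1/2) * exp (1/2) = exp x" by (simp flip: exp_add)
  finally show ?thesis .
qed

lemma wt_pos:
  assumes "\<bar>\<beta>\<bar> \<le> coth_half" "0 < x" "x < 1"
  shows "0 < wt \<beta> x"
proof -
  have p: "0 < wt coth_half z" if "0 < z" for z
    using that by (simp add: wt_coth_half)
  have c: "coth_half > 0" using coth_half_gt_1 by simp
  define t where "t = (1 + \<beta> / coth_half) / 2"
  have t: "0 \<le> t" "t \<le> 1" using assms(1) c by (auto simp: t_def field_simps abs_le_iff)
  have bt: "\<beta> = (1 - t) * (- coth_half) + t * coth_half" using c by (simp add: t_def field_simps)
  have "wt \<beta> x = (1 - t) * wt (- coth_half) x + t * wt coth_half x"
    by (subst bt) (simp add: wt_def field_simps)
  moreover have "0 < (1 - t) * wt (- coth_half) x + t * wt coth_half x"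
    using t p[of x] p[of "1 - x"] assms unfolding wt_reflect
    by (cases "t = 0") (auto intro!: add_nonneg_pos)
  ultimately show ?thesis by simp
qed

lemma cosh_1_bounds: "1 < cosh (1::real)" "cosh (1::real) \<le> 1.56"
proof -
  show "1 < cosh (1::real)" using cosh_real_nonneg_less_iff[of 0 "1::real"] by simp
  have e: "exp 1 \<le> (2.72::real)" using e_less_272 by simp
  have "exp (1::real) \<ge> 2.6" using e_approx_32 by (simp only: abs_le_iff) simp
  then have "exp (- 1::real) \<le> 1 / 2.6" by (simp add: exp_minus field_simps)
  with e show "cosh (1::real) \<le> 1.56" by (simp add: cosh_def)
qed

lemma two_sinh_half_square: "2 * (sinh (1/2::real))\<^sup>2 = cosh 1 - 1"
  using cosh_double[of "1/2::real"] sinh_square_eq[of "1/2::real"] by simp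

lemma wt_coth_half_1: "wt coth_half 1 * sinh 1 = cosh 1 + 1"
proof -
  have "sinh 1 * sinh 1 = (cosh 1 - 1) * (cosh 1 + 1::real)"
    using sinh_square_eq[of "1::real"] by (simp add: power2_eq_square algebra_simps)
  then show ?thesis using cosh_1_bounds by (simp add: wt_coth_half two_sinh_half_square)
qed

text \<open>The supersolution 1 - a (cosh x - 1) with a = 21/40 = -\<alpha>/2 is the Legendre series
  in cosh x cut after its linear term. The resulting bound lies above -21/20 - 1, so \<alpha> =
  -21/20 is admissible as soon as 1 \<le> \<beta> \<le> coth (1/2).\<close>

lemma energy_lower_below:
  assumes "competitor u v" "\<bar>\<beta>\<bar> \<le> coth_half"
  shows "- 39/20 \<le> energy (- 21/20) \<beta> u v"
proof -
  define a :: real where "a = 21/40"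
  define s where "s = 2 * (sinh (1/2::real))\<^sup>2"
  have s: "s > 0" by (simp add: s_def)
  note c = cosh_1_bounds
  have cx: "1 \<le> cosh x" "cosh x \<le> cosh 1" if "x \<in> {0..1}" for x :: real
    using that cosh_real_ge_1[of x] cosh_real_nonneg_le_iff[of x 1] by auto
  have yp: "0 < 1 - a * (cosh x - 1)" if "x \<in> {0..1}" for x
    using cx[OF that] c by (simp add: a_def)
  have "wt coth_half 1 * (- a * sinh 1) / (1 - a * (cosh 1 - 1)) - wt coth_half 0 * (- a * sinh 0) / (1 - a * (cosh 0 - 1))
      \<le> energy (- 21/20) \<beta> u v"
  proof (rule energy_lower_supersolution[OF assms wt_pos yp])
    show "((\<lambda>x. 1 - a * (cosh x - 1)) has_real_derivative - a * sinh x) (at x)" for x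
      by (auto intro!: derivative_eq_intros)
    show "continuous_on {0..1} (\<lambda>x. - a * sinh x)" by (intro continuous_intros)
    show "((\<lambda>x. wt coth_half x * (- a * sinh x)) has_real_derivative - a * 2 * sinh x * cosh x / s) (at x)" for x
      unfolding wt_coth_half s_def[symmetric] using s by (auto intro!: derivative_eq_intros simp: field_simps)
    show "continuous_on {0..1} (\<lambda>x. - a * 2 * sinh x * cosh x / s)" using s by (intro continuous_intros) auto
    \<comment> \<open>The left side is -21/20 times the weight times cosh x, and the supersolution
      is at most 1, hence at most cosh x.\<close>
    show "- a * 2 * sinh x * cosh x / s \<le> - 21/20 * wt coth_half x * (1 - a * (cosh x - 1))" if "0 < x" "x < 1" for x
    proof -
      have "0 \<le> a * (cosh x - 1)" "1 \<le> cosh x" using cx[of x] that by (auto simp: a_def)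
      then have "21/20 * sinh x * (1 - a * (cosh x - 1)) \<le> 21/20 * sinh x * cosh x"
        using that by (intro mult_left_mono) auto
      then show ?thesis using s unfolding wt_coth_half s_def[symmetric]
        by (simp add: a_def field_simps)
    qed
  qed (use coth_half_gt_1 in auto)
  moreover have "wt coth_half 1 * (- a * sinh 1) = - (a * (cosh 1 + 1))"
    unfolding wt_coth_half_1[symmetric] by simp
  ultimately have "- (a * (cosh 1 + 1)) / (1 - a * (cosh 1 - 1)) \<le> energy (- 21/20) \<beta> u v"
    by (simp only: sinh_0 mult_zero_right mult_zero_left div_0 diff_0_right)
  moreover have "- 39/20 \<le> - (a * (cosh 1 + 1)) / (1 - a * (cosh 1 - 1))"
    using c yp[of 1] by (simp add: field_simps a_def)
  ultimately show ?thesis by linarith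
qed

lemma energy_nonneg:
  assumes "\<bar>\<beta>\<bar> \<le> coth_half" "0 \<le> \<alpha>"
  shows "0 \<le> energy \<alpha> \<beta> u v"
  unfolding energy_wt set_lebesgue_integral_def
  by (rule integral_nonneg_AE) (use assms wt_pos in \<open>auto intro!: AE_I2 simp: indicator_def less_imp_le\<close>)

lemma alpha_bounds_unique:
  assumes "alpha_bounds \<beta> a b"
  shows "alpha_minus \<beta> = a" "alpha_plus \<beta> = b"
proof -
  have u: "a' = a \<and> b' = b" if "alpha_bounds \<beta> a' b'" for a' b'
  proof -
    from assms that have "x \<in> {a..b} \<longleftrightarrow> x \<in> {a'..b'}" for x unfolding alpha_bounds_def by auto
    then have "{a..b} = {a'..b'}" by (intro set_eqI)
    moreover have "a \<le> b" using assms by (simp add: alpha_bounds_def)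
    ultimately show ?thesis by (simp add: Icc_eq_Icc)
  qed
  show "alpha_minus \<beta> = a" unfolding alpha_minus_def using u assms by (intro the_equality) blast+
  show "alpha_plus \<beta> = b" unfolding alpha_plus_def using u assms by (intro the_equality) blast+
qed

lemma bump_pw_C1: "pw_C1 (\<lambda>x. x * (1 - x)) (\<lambda>x. 1 - 2 * x)"
  by (rule pw_C1_smooth) (auto intro!: derivative_eq_intros continuous_intros)

text \<open>Each competitor imposes one affine inequality on \<alpha>, so the admissible set is
  closed and convex. It contains -21/20 and \<beta>^2, hence points on both sides of 0, and two
  explicit competitors bound it.\<close>

lemma alpha_bounds_ex:
  assumes b: "1 \<le> \<beta>" "\<beta> \<le> coth_half"
  shows "alpha_bounds \<beta> (alpha_minus \<beta>) (alpha_plus \<beta>)" "alpha_minus \<beta> < -1"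
proof -
  define A where "A = {\<alpha>. admissible \<alpha> \<beta>}"
  have bb: "\<bar>\<beta>\<bar> \<le> coth_half" "\<beta>\<^sup>2 \<ge> 1" using b by auto
  have low: "- 21/20 \<in> A"
    unfolding A_def mem_Collect_eq admissible_iff
  proof (intro allI impI)
    fix u v assume "competitor u v"
    from energy_lower_below[OF this bb(1)] bb(2) show "- 21/20 - \<beta>\<^sup>2 \<le> energy (- 21/20) \<beta> u v" by linarith
  qed
  have high: "\<beta>\<^sup>2 \<in> A" using energy_nonneg[OF bb(1), of "\<beta>\<^sup>2"] by (simp add: A_def admissible_iff)
  have half: "convex {\<alpha>. \<alpha> - \<beta>\<^sup>2 \<le> energy \<alpha> \<beta> u v} \<and> closed {\<alpha>. \<alpha> - \<beta>\<^sup>2 \<le> energy \<alpha> \<beta> u v}"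
    if "competitor u v" for u v
  proof -
    have "H1_deriv u v" using that by (simp add: competitor_def)
    from energy_bilinear[OF this] obtain U0 U1 V0 V1
      where e: "\<And>\<alpha> \<beta>. energy \<alpha> \<beta> u v = \<alpha> * (U0 + \<beta> * U1) + (V0 + \<beta> * V1)" by blast
    have "{\<alpha>. \<alpha> - \<beta>\<^sup>2 \<le> energy \<alpha> \<beta> u v} = {\<alpha>. (1 - (U0 + \<beta> * U1)) \<bullet> \<alpha> \<le> \<beta>\<^sup>2 + (V0 + \<beta> * V1)}"
      unfolding e by (auto simp: algebra_simps)
    then show ?thesis by (simp only: convex_halfspace_le closed_halfspace_le simp_thms)
  qed
  have AI: "A = (\<Inter>(u,v)\<in>{(u,v). competitor u v}. {\<alpha>. \<alpha> - \<beta>\<^sup>2 \<le> energy \<alpha> \<beta> u v})"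
    unfolding A_def admissible_iff by auto
  have cA: "convex A" "closed A"
    unfolding AI using half by (auto intro!: convex_INT closed_INT)
  \<comment> \<open>With the competitor 1 + e x (1 - x) admissibility reads \<alpha> - \<beta>^2
    \<le> \<alpha> B + V. For e = 1 the competitor is larger than 1, so B > 1 and \<alpha> is
    bounded below; for e = -1 it is smaller, so B < 1 and \<alpha> is bounded above.\<close>
  define B where "B e = (LBINT x:{0<..<1}. wt \<beta> x * ((1 + e * (x * (1 - x))) * (1 + e * (x * (1 - x)))))" for e
  define V where "V e = (LBINT x:{0<..<1}. wt \<beta> x * ((e * (1 - 2 * x)) * (e * (1 - 2 * x))))" for e
  have pw: "pw_C1 (\<lambda>x. 1 + e * (x * (1 - x))) (\<lambda>x. 0 + e * (1 - 2 * x))" for e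
    by (intro pw_C1_add pw_C1_scale pw_C1_const bump_pw_C1)
  have adm: "\<alpha> - \<beta>\<^sup>2 \<le> \<alpha> * B e + V e" if "\<alpha> \<in> A" for \<alpha> e
  proof -
    have "\<alpha> - \<beta>\<^sup>2 \<le> energy \<alpha> \<beta> (\<lambda>x. 1 + e * (x * (1 - x))) (\<lambda>x. 0 + e * (1 - 2 * x))"
      using that pw_C1_competitor[OF pw[of e]] unfolding A_def admissible_iff by auto
    also have "\<dots> = \<alpha> * B e + V e"
      using pw_C1_L2[OF pw[of e]] by (subst energy_eq) (auto simp: B_def V_def)
    finally show ?thesis .
  qed
  have one: "(LBINT x:{0<..<1}. wt \<beta> x) = 1"
    using energy_one[of 1 \<beta>] by (simp add: energy_wt)
  have i1: "set_integrable lborel {0<..<1} (wt \<beta>)"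
    using wt_L2_integrable[OF const_L2[of 1] const_L2[of 1]] by simp
  have iB: "set_integrable lborel {0<..<1} (\<lambda>x. wt \<beta> x * ((1 + e * (x * (1 - x))) * (1 + e * (x * (1 - x)))))" for e
    using pw_C1_L2[OF pw[of e]] by (intro wt_L2_integrable) auto
  have B1: "B e - 1 = (LBINT x:{0<..<1}. wt \<beta> x * ((1 + e * (x * (1 - x))) * (1 + e * (x * (1 - x)))) - wt \<beta> x)" for e
    unfolding B_def by (subst set_integral_diff(2)[OF iB i1]) (simp add: one)
  have Bpos: "0 < B 1 - 1"
    unfolding B1
  proof (rule set_integral_pos[OF set_integral_diff(1)[OF iB i1], of 1])
    fix x :: real assume x: "0 < x" "x < 1"
    then have "0 < wt \<beta> x * (2 * (x * (1 - x)) + (x * (1 - x)) * (x * (1 - x)))"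
      by (intro mult_pos_pos add_pos_pos wt_pos bb) auto
    then show "0 < wt \<beta> x * ((1 + 1 * (x * (1 - x))) * (1 + 1 * (x * (1 - x)))) - wt \<beta> x"
      by (simp add: algebra_simps)
    then show "0 \<le> wt \<beta> x * ((1 + 1 * (x * (1 - x))) * (1 + 1 * (x * (1 - x)))) - wt \<beta> x" by simp
  qed auto
  have Bneg: "0 < 1 - B (-1)"
  proof -
    have "1 - B (-1) = (LBINT x:{0<..<1}. wt \<beta> x - wt \<beta> x * ((1 + (-1) * (x * (1 - x))) * (1 + (-1) * (x * (1 - x)))))"
      unfolding B_def by (subst set_integral_diff(2)[OF i1 iB]) (simp add: one)
    also have "\<dots> > 0"
    proof (rule set_integral_pos[OF set_integral_diff(1)[OF i1 iB], of 1])
      fix x :: real assume x: "0 < x" "x < 1"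
      then have xx: "0 < x * (1 - x)" "x * (1 - x) < 1"
        using mult_strict_mono[of x 1 "1 - x" 1] by auto
      then have "0 < wt \<beta> x * ((x * (1 - x)) * (2 - x * (1 - x)))"
        using x by (intro mult_pos_pos wt_pos bb) (auto)
      then show "0 < wt \<beta> x - wt \<beta> x * ((1 + (-1) * (x * (1 - x))) * (1 + (-1) * (x * (1 - x))))"
        by (simp add: algebra_simps)
      then show "0 \<le> wt \<beta> x - wt \<beta> x * ((1 + (-1) * (x * (1 - x))) * (1 + (-1) * (x * (1 - x))))" by simp
    qed auto
    finally show ?thesis .
  qed
  have "A \<subseteq> {- (\<beta>\<^sup>2 + V 1) / (B 1 - 1) .. (\<beta>\<^sup>2 + V (-1)) / (1 - B (-1))}"
  proof
    fix \<alpha> assume a: "\<alpha> \<in> A"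
    have "- (\<beta>\<^sup>2 + V 1) \<le> \<alpha> * (B 1 - 1)" "\<alpha> * (1 - B (-1)) \<le> \<beta>\<^sup>2 + V (-1)"
      using adm[OF a, of 1] adm[OF a, of "-1"] by (simp_all add: algebra_simps)
    then show "\<alpha> \<in> {- (\<beta>\<^sup>2 + V 1) / (B 1 - 1) .. (\<beta>\<^sup>2 + V (-1)) / (1 - B (-1))}"
      using Bpos Bneg by (simp add: pos_divide_le_eq pos_le_divide_eq)
  qed
  then have "bounded A" by (rule bounded_subset[OF bounded_closed_interval])
  then have "connected A \<and> compact A" using cA by (auto simp: convex_connected compact_eq_bounded_closed)
  then obtain a c where ac: "A = {a..c}" using connected_compact_interval_1[of A] by auto
  have "alpha_bounds \<beta> a c" using low high ac bb unfolding alpha_bounds_def A_def set_eq_iff by auto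
  moreover have "a < -1" using low ac by auto
  ultimately show "alpha_bounds \<beta> (alpha_minus \<beta>) (alpha_plus \<beta>)" "alpha_minus \<beta> < -1"
    by (simp_all add: alpha_bounds_unique[of \<beta> a c])
qed

text \<open>For small t the slack c at \<open>\<alpha>0\<close> outweighs the finite loss incurred
  at \<open>\<alpha>1\<close>. The loss is at most M, and t (c + M) \<le> c is the break-even
  condition.\<close>

lemma admissible_nearby:
  assumes c: "0 < c" and E0: "\<And>u v. competitor u v \<Longrightarrow> \<alpha>0 - \<beta>\<^sup>2 + c \<le> energy \<alpha>0 \<beta> u v"
    and E1: "\<And>u v. competitor u v \<Longrightarrow> K \<le> energy \<alpha>1 \<beta> u v"
  obtains d where "0 < d" "\<And>t. 0 \<le> t \<Longrightarrow> t \<le> d \<Longrightarrow> admissible ((1 - t) * \<alpha>0 + t * \<alpha>1) \<beta>"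
proof -
  define M where "M = \<bar>K\<bar> + \<bar>\<alpha>1\<bar> + \<beta>\<^sup>2"
  have M: "0 \<le> M" by (simp add: M_def)
  show thesis
  proof (rule that[of "c / (c + M)"])
    show "0 < c / (c + M)" using c M by simp
    fix t assume t: "0 \<le> t" "t \<le> c / (c + M)"
    have "c / (c + M) \<le> 1" using c M by simp
    then have t1: "t \<le> 1" using t(2) by simp
    have tc: "t * (c + M) \<le> c" using t c M by (simp add: pos_le_divide_eq)
    show "admissible ((1 - t) * \<alpha>0 + t * \<alpha>1) \<beta>"
      unfolding admissible_iff
    proof (intro allI impI)
      fix u v assume uv: "competitor u v"
      have "t * (- K + \<alpha>1 - \<beta>\<^sup>2) \<le> t * M"
        using t zero_le_power2[of \<beta>] unfolding M_def by (intro mult_left_mono) linarith+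
      then have "(1 - t) * \<alpha>0 + t * \<alpha>1 - \<beta>\<^sup>2 \<le> (1 - t) * (\<alpha>0 - \<beta>\<^sup>2 + c) + t * K"
        using tc by (simp add: algebra_simps)
      also have "\<dots> \<le> (1 - t) * energy \<alpha>0 \<beta> u v + t * energy \<alpha>1 \<beta> u v"
        using t t1 E0[OF uv] E1[OF uv] by (intro add_mono mult_left_mono) auto
      also have "\<dots> = energy ((1 - t) * \<alpha>0 + t * \<alpha>1) \<beta> u v"
        using uv by (simp add: energy_convex_alpha competitor_def)
      finally show "(1 - t) * \<alpha>0 + t * \<alpha>1 - \<beta>\<^sup>2 \<le> energy ((1 - t) * \<alpha>0 + t * \<alpha>1) \<beta> u v" .
    qed
  qed
qed

section \<open>The weight for \<open>\<beta> = 1\<close>\<close>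

text \<open>With \<mu>^2 = D, these are sinh (\<mu> x) / \<mu> and cosh (\<mu> x), the basis of h''
  = D h normalised at 0. Both are even in \<mu> and therefore real functions of D.\<close>

definition S_fn :: "real \<Rightarrow> real \<Rightarrow> real" where
  "S_fn D x = (if D > 0 then sinh (sqrt D * x) / sqrt D else if D = 0 then x else sin (sqrt (- D) * x) / sqrt (- D))"

definition C_fn :: "real \<Rightarrow> real \<Rightarrow> real" where
  "C_fn D x = (if D > 0 then cosh (sqrt D * x) else if D = 0 then 1 else cos (sqrt (- D) * x))"

lemma S_fn_square:
  assumes "r > 0"
  shows "S_fn (r\<^sup>2) = (\<lambda>x. sinh (r * x) / r)" "C_fn (r\<^sup>2) = (\<lambda>x. cosh (r * x))"
    "S_fn (- (r\<^sup>2)) = (\<lambda>x. sin (r * x) / r)" "C_fn (- (r\<^sup>2)) = (\<lambda>x. cos (r * x))"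
  using assms by (auto simp: S_fn_def C_fn_def fun_eq_iff)

lemma real_sign_cases:
  fixes D :: real
  obtains (pos) r where "r > 0" "D = r\<^sup>2" | (zero) "D = 0" | (neg) r where "r > 0" "D = - (r\<^sup>2)"
proof -
  consider "D > 0" | "D = 0" | "D < 0" by linarith
  then show thesis
  proof cases
    case 1 then show thesis by (intro pos[of "sqrt D"]) auto
  next
    case 3 then show thesis by (intro neg[of "sqrt (- D)"]) auto
  qed (use zero in auto)
qed

lemma S_fn_deriv: "(S_fn D has_real_derivative C_fn D x) (at x)"
  by (cases D rule: real_sign_cases)
    (auto simp: S_fn_square S_fn_def[of 0, abs_def] C_fn_def[of 0] intro!: derivative_eq_intros)

lemma C_fn_deriv: "(C_fn D has_real_derivative D * S_fn D x) (at x)"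
proof (cases D rule: real_sign_cases)
  case (pos r)
  then show ?thesis
    by (auto simp: S_fn_square intro!: derivative_eq_intros) (simp add: power2_eq_square)
next
  case (neg r)
  then show ?thesis
    by (auto simp: S_fn_square intro!: derivative_eq_intros) (simp add: power2_eq_square)
qed (auto simp: C_fn_def[of 0, abs_def])

lemma S_fn_0 [simp]: "S_fn D 0 = 0" and C_fn_0 [simp]: "C_fn D 0 = 1"
  by (auto simp: S_fn_def C_fn_def)

text \<open>For D < 0 the first positive zero is pi / sqrt (-D), which lies beyond 1 exactly when D
  > - pi^2.\<close>

lemma S_fn_pos:
  assumes "- (pi\<^sup>2) < D" "0 < x" "x \<le> 1"
  shows "0 < S_fn D x"
proof -
  consider "D > 0" | "D = 0" | "D < 0" by linarith
  then show ?thesis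
  proof cases
    case 3
    have "sqrt (- D) < sqrt (pi\<^sup>2)" using assms by (intro real_sqrt_less_mono) simp
    then have "sqrt (- D) < pi" by simp
    moreover have "sqrt (- D) * x \<le> sqrt (- D)" using assms 3 by (intro mult_left_le) auto
    ultimately have "sqrt (- D) * x < pi" by linarith
    then have "0 < sin (sqrt (- D) * x)" using assms 3 by (intro sin_gt_zero) auto
    then show ?thesis using 3 by (simp add: S_fn_def)
  qed (use assms in \<open>auto simp: S_fn_def\<close>)
qed

definition A_real :: "real \<Rightarrow> real" where
  "A_real \<alpha> = (cosh (1/2) * C_fn (1/4 + \<alpha>) 1 - 1) / (sinh (1/2) * S_fn (1/4 + \<alpha>) 1) - 1/2"

lemma cosh_complex_of_real: "cosh (complex_of_real x) = of_real (cosh x)"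
  by (simp add: cosh_field_def exp_of_real flip: of_real_minus)

lemma sinh_complex_of_real: "sinh (complex_of_real x) = of_real (sinh x)"
  by (simp add: sinh_field_def exp_of_real flip: of_real_minus)

lemma M_const_minus: "M_const (- \<mu>) = M_const \<mu>"
  by (simp add: M_const_def div_sinh_def)

text \<open>Since \<open>M_const\<close> is even in \<mu>, either square root may be exchanged for a
  nonnegative real or a positive imaginary one, where the complex hyperbolic functions reduce to
  \<open>S_fn\<close> and \<open>C_fn\<close>.\<close>

lemma M_const_real:
  assumes "\<mu>\<^sup>2 = of_real (1/4 + \<alpha>)"
  shows "M_const \<mu> = of_real (A_real \<alpha> + 1/2)"
proof -
  define D where "D = 1/4 + \<alpha>"
  have h: "cosh (1/2) = complex_of_real (cosh (1/2))" "sinh (1/2) = complex_of_real (sinh (1/2))"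
    using cosh_complex_of_real[of "1/2"] sinh_complex_of_real[of "1/2"] by simp_all
  have eq: "A_real \<alpha> + 1/2 = (cosh (1/2) * C_fn D 1 - 1) / (sinh (1/2) * S_fn D 1)"
    by (simp add: A_real_def D_def)
  consider "D > 0" | "D = 0" | "D < 0" by linarith
  then show ?thesis
  proof cases
    case 1
    then have "\<mu>\<^sup>2 = (of_real (sqrt D))\<^sup>2" using assms by (simp add: D_def flip: of_real_power)
    then have "M_const \<mu> = M_const (of_real (sqrt D))"
      using M_const_minus by (auto simp: power2_eq_iff)
    also have "\<dots> = of_real (A_real \<alpha> + 1/2)"
      unfolding eq using 1 by (simp add: M_const_def div_sinh_def h S_fn_def C_fn_def cosh_complex_of_real sinh_complex_of_real mult_ac)
    finally show ?thesis .
  next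
    case 2
    then have "\<mu> = 0" using assms by (simp add: D_def)
    then show ?thesis unfolding eq using 2 by (simp add: M_const_def div_sinh_def h S_fn_def C_fn_def)
  next
    case 3
    then have "\<mu>\<^sup>2 = (\<i> * of_real (sqrt (- D)))\<^sup>2" using assms
      by (simp add: D_def power_mult_distrib flip: of_real_power)
    then have "M_const \<mu> = M_const (\<i> * of_real (sqrt (- D)))"
      using M_const_minus by (auto simp: power2_eq_iff)
    also have "\<dots> = of_real (A_real \<alpha> + 1/2)"
    proof -
      have "cosh (\<i> * complex_of_real x) = of_real (cos x)" "sinh (\<i> * complex_of_real x) = \<i> * of_real (sin x)" for x
        by (simp_all add: cosh_conv_cos sinh_conv_sin cos_of_real sin_of_real flip: mult.assoc)
      then show ?thesis
        unfolding eq using 3 by (simp add: M_const_def div_sinh_def h S_fn_def C_fn_def mult_ac)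
    qed
    finally show ?thesis .
  qed
qed

section \<open>The explicit minimizer for the exponential weight\<close>

context
  fixes \<alpha> D :: real
  assumes D_def: "D = 1/4 + \<alpha>" and D_gt: "- (pi\<^sup>2) < D"
begin

text \<open>Writing y = exp (-x/2) h removes the first-order term from y'' + y' = \<alpha> y and
  leaves h'' = (1/4 + \<alpha>) h. The boundary values 1 and exp (1/2) of h make y equal to 1 at
  both ends.\<close>

definition "min_h x = (S_fn D (1 - x) + exp (1/2) * S_fn D x) / S_fn D 1"
definition "min_h' x = (- C_fn D (1 - x) + exp (1/2) * C_fn D x) / S_fn D 1"
definition "min_y x = exp (- x / 2) * min_h x"
definition "min_y' x = exp (- x / 2) * (min_h' x - min_h x / 2)"

lemma S_fn_1_pos: "0 < S_fn D 1" using S_fn_pos[OF D_gt] by simp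

lemma min_h_deriv: "(min_h has_real_derivative min_h' x) (at x)"
  unfolding min_h_def[abs_def] min_h'_def using S_fn_1_pos
  by (auto intro!: derivative_eq_intros DERIV_chain2[OF S_fn_deriv])

lemma min_h'_deriv: "(min_h' has_real_derivative D * min_h x) (at x)"
  unfolding min_h'_def[abs_def] min_h_def using S_fn_1_pos
  by (auto intro!: derivative_eq_intros DERIV_chain2[OF C_fn_deriv] simp: field_simps)

lemma min_y_deriv: "(min_y has_real_derivative min_y' x) (at x)"
  unfolding min_y_def[abs_def] min_y'_def
  by (auto intro!: derivative_eq_intros min_h_deriv simp: field_simps)

lemma wt_min_y': "wt 1 x * min_y' x = exp (x / 2) * (min_h' x - min_h x / 2) / (exp 1 - 1)"
proof -
  have "exp x * exp (- x / 2) = exp (x / 2)" by (simp flip: exp_add)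
  then show ?thesis unfolding wt_one min_y'_def by (metis (no_types, lifting) mult.assoc times_divide_eq_left)
qed

lemma min_flux_deriv:
  "((\<lambda>x. wt 1 x * min_y' x) has_real_derivative \<alpha> * wt 1 x * min_y x) (at x)"
proof -
  have e: "exp x * exp (- x / 2) = exp (x / 2)" by (simp flip: exp_add)
  have "((\<lambda>x. exp (x / 2) * (min_h' x - min_h x / 2)) has_real_derivative
      exp (x / 2) * (D - 1/4) * min_h x) (at x)"
    by (auto intro!: derivative_eq_intros min_h_deriv min_h'_deriv simp: field_simps)
  then have "((\<lambda>x. exp (x / 2) * (min_h' x - min_h x / 2) / (exp 1 - 1)) has_real_derivative
      exp (x / 2) * (D - 1/4) * min_h x / (exp 1 - 1)) (at x)"
    by (rule DERIV_cdivide)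
  moreover have "exp (x / 2) * (D - 1/4) * min_h x / (exp 1 - 1) = \<alpha> * wt 1 x * min_y x"
    unfolding wt_one min_y_def e[symmetric] by (simp add: D_def)
  ultimately show ?thesis unfolding wt_min_y' by simp
qed

lemma min_y_pos: "x \<in> {0..1} \<Longrightarrow> 0 < min_y x"
proof -
  assume x: "x \<in> {0..1}"
  have "0 < S_fn D (1 - x) + exp (1/2) * S_fn D x"
  proof (cases "x = 0")
    case False
    have "0 \<le> S_fn D (1 - x)" using S_fn_pos[OF D_gt, of "1 - x"] x by (cases "x = 1") auto
    moreover have "0 < S_fn D x" using S_fn_pos[OF D_gt, of x] x False by auto
    ultimately show ?thesis by (simp add: add_nonneg_pos)
  qed (use S_fn_1_pos in auto)
  then show "0 < min_y x" using S_fn_1_pos by (simp add: min_y_def min_h_def)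
qed

lemma min_y_01: "min_y 0 = 1" "min_y 1 = 1"
  using S_fn_1_pos by (simp_all add: min_y_def min_h_def flip: exp_add)

lemma min_flux_diff: "wt 1 1 * min_y' 1 - wt 1 0 * min_y' 0 = A_real \<alpha>"
proof -
  \<comment> \<open>In terms of exp (1/2), \<open>S\<close> and \<open>C\<close> both sides are
    rational expressions.\<close>
  define E where "E = exp (1/2::real)"
  define S where "S = S_fn D 1"
  define C where "C = C_fn D 1"
  have E: "E > 1" and E2: "exp 1 = E\<^sup>2" by (simp_all add: E_def exp_half_square)
  then have E2': "E\<^sup>2 > 1" by simp
  have S: "S > 0" using S_fn_1_pos by (simp add: S_def)
  have h: "min_h 0 = 1" "min_h 1 = E" "min_h' 0 = (- C + E) / S" "min_h' 1 = (- 1 + E * C) / S"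
    using S_fn_1_pos by (simp_all add: min_h_def min_h'_def S_def C_def E_def)
  have a: "wt 1 1 * min_y' 1 - wt 1 0 * min_y' 0
    = (E * ((- 1 + E * C) / S - E / 2) - ((- C + E) / S - 1 / 2)) / (E\<^sup>2 - 1)"
    unfolding wt_min_y' h E2 by (simp add: diff_divide_distrib flip: E_def)
  have c: "cosh (1/2) = (E\<^sup>2 + 1) / (2 * E)" "sinh (1/2) = (E\<^sup>2 - 1) / (2 * E)"
    using two_sinh_half unfolding E2 E_def[symmetric] by (simp_all add: field_simps)
  have "A_real \<alpha> = ((E\<^sup>2 + 1) / (2 * E) * C - 1) / ((E\<^sup>2 - 1) / (2 * E) * S) - 1/2"
    unfolding A_real_def c D_def[symmetric] S_def C_def ..
  also have "\<dots> = (E * ((- 1 + E * C) / S - E / 2) - ((- C + E) / S - 1 / 2)) / (E\<^sup>2 - 1)"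
    using E E2' S by (simp add: field_simps power2_eq_square) 
  finally show ?thesis using a by simp
qed

lemma min_y'_cont: "continuous_on A min_y'"
proof -
  have "min_y' = (\<lambda>x. exp (- x / 2) * (min_h' x - min_h x / 2))" by (simp add: min_y'_def fun_eq_iff)
  moreover have "isCont (\<lambda>x. exp (- x / 2) * (min_h' x - min_h x / 2)) x" for x
    by (intro continuous_intros DERIV_isCont[OF min_h_deriv] DERIV_isCont[OF min_h'_deriv]) auto
  ultimately show ?thesis by (auto intro: continuous_at_imp_continuous_on)
qed

lemma energy_ge_A:
  assumes "competitor u v" "\<bar>\<beta>\<bar> \<le> 1"
  shows "A_real \<alpha> \<le> energy \<alpha> \<beta> u v"
proof -
  have "wt 1 1 * min_y' 1 / min_y 1 - wt 1 0 * min_y' 0 / min_y 0 \<le> energy \<alpha> \<beta> u v"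
  proof (rule energy_lower_supersolution[OF assms wt_pos min_y_pos min_y_deriv min_y'_cont min_flux_deriv])
    show "continuous_on {0..1} (\<lambda>x. \<alpha> * wt 1 x * min_y x)"
      by (intro continuous_intros wt_cont continuous_at_imp_continuous_on ballI DERIV_isCont[OF min_y_deriv])
  qed (use coth_half_gt_1 in auto)
  then show ?thesis using min_flux_diff by (simp add: min_y_01)
qed

text \<open>On a solution the energy density is the derivative of w y' y, so the energy is the flux
  difference because y = 1 at both ends.\<close>

lemma energy_A_attained: "\<exists>u v. competitor u v \<and> energy \<alpha> 1 u v = A_real \<alpha>"
proof (intro exI conjI)
  have pw: "pw_C1 min_y min_y'" by (rule pw_C1_smooth[OF min_y_deriv min_y'_cont])
  then show "competitor min_y min_y'" using min_y_01 by (intro pw_C1_competitor)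
  note L = pw_C1_L2[OF pw]
  have "energy \<alpha> 1 min_y min_y' = (LBINT x:{0<..<1}. wt 1 x * (\<alpha> * (min_y x)\<^sup>2 + (min_y' x)\<^sup>2))" by (rule energy_wt)
  also have "\<dots> = wt 1 1 * min_y' 1 * min_y 1 - wt 1 0 * min_y' 0 * min_y 0"
  proof (rule set_integral_FTC_finite[where S="{}" and F="\<lambda>x. wt 1 x * min_y' x * min_y x"])
    have d: "((\<lambda>x. wt 1 x * min_y' x * min_y x) has_real_derivative wt 1 x * (\<alpha> * (min_y x)\<^sup>2 + (min_y' x)\<^sup>2)) (at x)" for x
      using DERIV_mult[OF min_flux_deriv[of x] min_y_deriv[of x]] by (simp add: algebra_simps power2_eq_square)
    show "((\<lambda>x. wt 1 x * min_y' x * min_y x) has_real_derivative wt 1 x * (\<alpha> * (min_y x)\<^sup>2 + (min_y' x)\<^sup>2)) (at x)" for x by (rule d)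
    show "continuous_on {0..1} (\<lambda>x. wt 1 x * min_y' x * min_y x)"
      by (intro continuous_at_imp_continuous_on ballI DERIV_isCont[OF d])
    have "set_integrable lborel {0<..<1} (\<lambda>x. \<alpha> * (wt 1 x * (min_y x * min_y x)) + wt 1 x * (min_y' x * min_y' x))"
      using L by (intro set_integral_add(1) set_integrable_mult_right wt_L2_integrable) auto
    then show "set_integrable lborel {0<..<1} (\<lambda>x. wt 1 x * (\<alpha> * (min_y x)\<^sup>2 + (min_y' x)\<^sup>2))"
      by (simp add: algebra_simps power2_eq_square)
  qed auto
  finally show "energy \<alpha> 1 min_y min_y' = A_real \<alpha>" using min_flux_diff by (simp add: min_y_01)
qed

end

text \<open>At 1/4 + \<alpha> = - pi^2 the function exp (-x/2) sin (pi x) solves the equation with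
  zero boundary values, and for smaller \<alpha> its energy is still nonpositive. Its cross term
  with the constant 1 is \<alpha> m with m > 0, so the energy of 1 + t f is unbounded below, in the
  resonant case too.\<close>

lemma D_gt_of_energy_bounded_below:
  assumes K: "\<And>u v. competitor u v \<Longrightarrow> K \<le> energy \<alpha> 1 u v"
  shows "- (pi\<^sup>2) < 1/4 + \<alpha>"
proof (rule ccontr)
  assume "\<not> - (pi\<^sup>2) < 1/4 + \<alpha>"
  then have al: "\<alpha> \<le> - 1/4 - pi\<^sup>2" by simp
  then have al0: "\<alpha> < 0" using zero_less_power2[of pi] pi_neq_zero by linarith
  define f where "f x = exp (- x / 2) * sin (pi * x)" for x
  define g where "g x = exp (- x / 2) * (pi * cos (pi * x) - sin (pi * x) / 2)" for x
  have pwf: "pw_C1 f g"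
    unfolding f_def[abs_def] g_def[abs_def]
    by (rule pw_C1_smooth) (auto intro!: derivative_eq_intros continuous_intros simp: algebra_simps)
  note L = pw_C1_L2[OF pwf]
  have L1: "(\<lambda>x. 1) \<in> L2_01" "(\<lambda>x. 0) \<in> L2_01" by (rule const_L2)+
  have ex: "exp x * (exp (- x / 2))\<^sup>2 = 1" for x :: real
    by (simp add: power2_eq_square flip: exp_add)
  have e1: "exp 1 - (1::real) > 0" by simp
  have iq: "set_integrable lborel {0<..<1} (\<lambda>x. wt 1 x * (\<alpha>' * (f x)\<^sup>2 + (g x)\<^sup>2))" for \<alpha>'
  proof -
    have "set_integrable lborel {0<..<1} (\<lambda>x. \<alpha>' * (wt 1 x * (f x * f x)) + wt 1 x * (g x * g x))"
      using L by (intro set_integral_add(1) set_integrable_mult_right wt_L2_integrable) auto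
    then show ?thesis by (simp add: algebra_simps power2_eq_square)
  qed
  have "energy \<alpha> 1 f g \<le> (LBINT x:{0<..<1}. wt 1 x * ((- 1/4 - pi\<^sup>2) * (f x)\<^sup>2 + (g x)\<^sup>2))"
    unfolding energy_wt
  proof (rule set_integral_mono[OF iq iq])
    fix x :: real assume "x \<in> {0<..<1}"
    then have "0 \<le> wt 1 x" using wt_pos[of 1 x] coth_half_gt_1 by simp
    moreover have "\<alpha> * (f x)\<^sup>2 \<le> (- 1/4 - pi\<^sup>2) * (f x)\<^sup>2" using al by (intro mult_right_mono) auto
    ultimately show "wt 1 x * (\<alpha> * (f x)\<^sup>2 + (g x)\<^sup>2) \<le> wt 1 x * ((- 1/4 - pi\<^sup>2) * (f x)\<^sup>2 + (g x)\<^sup>2)"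
      by (intro mult_left_mono) auto
  qed
  \<comment> \<open>The exponentials cancel, and what remains is the derivative of w f' f, which
    vanishes at both ends with the sine.\<close>
  also have "\<dots> = (pi * sin (pi * 1) * cos (pi * 1) - (sin (pi * 1))\<^sup>2 / 2) / (exp 1 - 1)
      - (pi * sin (pi * 0) * cos (pi * 0) - (sin (pi * 0))\<^sup>2 / 2) / (exp 1 - 1)"
  proof (rule set_integral_FTC_finite[where S="{}", OF _ _ _ iq])
    show "((\<lambda>x. (pi * sin (pi * x) * cos (pi * x) - (sin (pi * x))\<^sup>2 / 2) / (exp 1 - 1))
       has_real_derivative wt 1 x * ((- 1/4 - pi\<^sup>2) * (f x)\<^sup>2 + (g x)\<^sup>2)) (at x)" for x
    proof -
      have "wt 1 x * ((- 1/4 - pi\<^sup>2) * (f x)\<^sup>2 + (g x)\<^sup>2) =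
        (exp x * (exp (- x / 2))\<^sup>2) * ((- 1/4 - pi\<^sup>2) * (sin (pi * x))\<^sup>2 + (pi * cos (pi * x) - sin (pi * x) / 2)\<^sup>2) / (exp 1 - 1)"
      proof -
        have "w / k * (a * (e * s) + e * c) = (w * e) * (a * s + c) / k" for w k a e s c :: real
          by (simp add: algebra_simps add_divide_distrib)
        then show ?thesis unfolding wt_one f_def g_def power_mult_distrib .
      qed
      also have "\<dots> = (pi\<^sup>2 * (cos (pi * x))\<^sup>2 - pi\<^sup>2 * (sin (pi * x))\<^sup>2 - pi * sin (pi * x) * cos (pi * x)) / (exp 1 - 1)"
        unfolding ex by (simp add: algebra_simps power2_eq_square)
      finally have w: "wt 1 x * ((- 1/4 - pi\<^sup>2) * (f x)\<^sup>2 + (g x)\<^sup>2) = \<dots>" .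
      show ?thesis unfolding w
        by (rule DERIV_cdivide) (auto intro!: derivative_eq_intros simp: algebra_simps power2_eq_square)
    qed
  qed (use e1 in \<open>auto intro!: continuous_intros\<close>)
  finally have Q: "energy \<alpha> 1 f g \<le> 0" by simp
  define m where "m = (LBINT x:{0<..<1}. wt 1 x * f x)"
  have "set_integrable lborel {0<..<1} (\<lambda>x. wt 1 x * f x)"
    using wt_L2_integrable[OF conjunct1[OF L] L1(1), of 1] by simp
  then have m: "0 < m"
    unfolding m_def
    by (rule set_integral_pos[of _ 1])
      (use wt_pos[of 1] coth_half_gt_1 in \<open>auto simp: f_def intro!: mult_pos_pos sin_gt_zero less_imp_le\<close>)
  have "K \<le> \<alpha> + 2 * t * (\<alpha> * m)" for t
  proof -
    have "pw_C1 (\<lambda>x. 1 + t * f x) (\<lambda>x. 0 + t * g x)" by (intro pw_C1_add pw_C1_scale pw_C1_const pwf)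
    then have "competitor (\<lambda>x. 1 + t * f x) (\<lambda>x. 0 + t * g x)"
      by (rule pw_C1_competitor) (auto simp: f_def)
    then have "K \<le> energy \<alpha> 1 (\<lambda>x. 1 + t * f x) (\<lambda>x. 0 + t * g x)" by (rule K)
    also have "\<dots> = energy \<alpha> 1 (\<lambda>x. 1) (\<lambda>x. 0) + 2 * t * (LBINT x:{0<..<1}. wt 1 x * (\<alpha> * 1 * f x + 0 * g x)) + t\<^sup>2 * energy \<alpha> 1 f g"
      using L L1 by (intro energy_expand) auto
    also have "(LBINT x:{0<..<1}. wt 1 x * (\<alpha> * 1 * f x + 0 * g x)) = \<alpha> * m"
      unfolding m_def by (subst set_integral_mult_right[symmetric]) (simp add: mult_ac)
    also have "energy \<alpha> 1 (\<lambda>x. 1) (\<lambda>x. 0) + 2 * t * (\<alpha> * m) + t\<^sup>2 * energy \<alpha> 1 f g \<le> \<alpha> + 2 * t * (\<alpha> * m)"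
      using mult_nonneg_nonpos[OF zero_le_power2[of t] Q] energy_one by simp
    finally show ?thesis .
  qed
  moreover have "\<alpha> * m \<noteq> 0" using al0 m by simp
  \<comment> \<open>For this t the upper bound of the energy is K - 1.\<close>
  then have "2 * ((K - \<alpha> - 1) / (2 * (\<alpha> * m))) * (\<alpha> * m) = K - \<alpha> - 1" by simp
  ultimately have "K \<le> \<alpha> + (K - \<alpha> - 1)" by metis
  then show False by simp
qed

lemma admissible_one_iff:
  assumes "- (pi\<^sup>2) < 1/4 + \<alpha>"
  shows "admissible \<alpha> 1 \<longleftrightarrow> \<alpha> - 1 \<le> A_real \<alpha>"
  using energy_A_attained[OF refl assms] energy_ge_A[OF refl assms, of _ _ 1] unfolding admissible_iff by force

lemma A_real_le:
  assumes "- (pi\<^sup>2) < 1/4 + \<alpha>"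
  shows "A_real \<alpha> \<le> \<alpha>"
  using energy_ge_A[OF refl assms competitor_one, of 1] by (simp add: energy_one)

lemma admissible_one_D: "admissible \<alpha> 1 \<Longrightarrow> - (pi\<^sup>2) < 1/4 + \<alpha>"
  by (rule D_gt_of_energy_bounded_below[of "\<alpha> - 1"]) (auto simp: admissible_iff)

text \<open>The square root solves \<beta>^2 + A - \<alpha> = 0. Admissibility at 1 places it in
  [0,1], where A still bounds the energy from below; testing with the constant 1 shows that the
  radicand is nonnegative.\<close>

lemma admissible_sqrt:
  assumes "admissible \<alpha> 1"
  shows "0 \<le> \<alpha> - A_real \<alpha>" "admissible \<alpha> (sqrt (\<alpha> - A_real \<alpha>))"
proof -
  note D = admissible_one_D[OF assms]
  show nn: "0 \<le> \<alpha> - A_real \<alpha>" using A_real_le[OF D] by simp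
  have "\<alpha> - A_real \<alpha> \<le> 1" using admissible_one_iff[OF D] assms by simp
  then have "sqrt (\<alpha> - A_real \<alpha>) \<le> 1" by simp
  then show "admissible \<alpha> (sqrt (\<alpha> - A_real \<alpha>))"
    using energy_ge_A[OF refl D, of _ _ "sqrt (\<alpha> - A_real \<alpha>)"] nn unfolding admissible_iff by auto
qed

text \<open>The slack allows a move of \<alpha> in both directions. Half the distance to the
  threshold - pi^2 is taken as r, so that \<alpha> - r still has a finite lower bound.\<close>

lemma admissible_one_nearby:
  assumes D: "- (pi\<^sup>2) < 1/4 + \<alpha>" and gt: "\<alpha> - 1 < A_real \<alpha>"
  obtains d where "0 < d" "\<And>\<alpha>'. \<bar>\<alpha>' - \<alpha>\<bar> \<le> d \<Longrightarrow> admissible \<alpha>' 1"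
proof -
  define r where "r = (1/4 + \<alpha> + pi\<^sup>2) / 2"
  have r: "r > 0" using D by (simp add: r_def)
  have ex: "\<exists>d>0. \<forall>t. 0 \<le> t \<and> t \<le> d \<longrightarrow> admissible (\<alpha> + t * r') 1" if "- (pi\<^sup>2) < 1/4 + (\<alpha> + r')" for r'
  proof -
    have E0: "\<alpha> - 1\<^sup>2 + (A_real \<alpha> - (\<alpha> - 1)) \<le> energy \<alpha> 1 u v" if "competitor u v" for u v
      using energy_ge_A[OF refl D that, of 1] by simp
    have E1: "A_real (\<alpha> + r') \<le> energy (\<alpha> + r') 1 u v" if "competitor u v" for u v
      using energy_ge_A[OF refl _ that, of "\<alpha> + r'" 1] \<open>- (pi\<^sup>2) < 1/4 + (\<alpha> + r')\<close> by simp
    obtain d where "0 < d" "\<And>t. 0 \<le> t \<Longrightarrow> t \<le> d \<Longrightarrow> admissible ((1 - t) * \<alpha> + t * (\<alpha> + r')) 1"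
      by (rule admissible_nearby[OF _ E0 E1]) (use gt in auto)
    moreover have "(1 - t) * \<alpha> + t * (\<alpha> + r') = \<alpha> + t * r'" for t by (simp add: algebra_simps)
    ultimately show ?thesis by auto
  qed
  obtain d1 where d1: "d1 > 0" "\<And>t. 0 \<le> t \<Longrightarrow> t \<le> d1 \<Longrightarrow> admissible (\<alpha> + t * r) 1"
    using ex[of r] D r by auto
  obtain d2 where d2: "d2 > 0" "\<And>t. 0 \<le> t \<Longrightarrow> t \<le> d2 \<Longrightarrow> admissible (\<alpha> + t * (- r)) 1"
    using ex[of "- r"] D unfolding r_def by (auto simp: field_simps)
  show thesis
  proof (rule that[of "min d1 d2 * r"])
    show "0 < min d1 d2 * r" using d1 d2 r by simp
    fix \<alpha>' assume a: "\<bar>\<alpha>' - \<alpha>\<bar> \<le> min d1 d2 * r"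
    define t where "t = \<bar>\<alpha>' - \<alpha>\<bar> / r"
    have t: "0 \<le> t" "t \<le> min d1 d2" using a r by (simp_all add: t_def pos_divide_le_eq del: min.bounded_iff)
    have "\<alpha>' = \<alpha> + t * r \<or> \<alpha>' = \<alpha> + t * (- r)" using r by (auto simp: t_def abs_if)
    then show "admissible \<alpha>' 1" using d1(2)[of t] d2(2)[of t] t by auto
  qed
qed

section \<open>Logarithmic cutoffs at the degenerate endpoint\<close>

lemma wt_coth_half_le:
  assumes "x \<in> {0..1}"
  shows "0 \<le> wt coth_half x" "wt coth_half x \<le> cosh 1 / (cosh 1 - 1) * x"
proof -
  have c: "cosh 1 - 1 > (0::real)" using cosh_1_bounds by simp
  show "0 \<le> wt coth_half x" using assms c by (simp add: wt_coth_half)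
  have "sinh x \<le> x * cosh 1"
  proof (cases "x = 0")
    case False
    have "\<exists>z>0. z < x \<and> sinh x - sinh 0 = (x - 0) * cosh z"
      using False assms by (intro MVT2) (auto intro!: derivative_eq_intros)
    then obtain z where z: "0 < z" "z < x" "sinh x - sinh 0 = (x - 0) * cosh z" by blast
    then have "cosh z \<le> cosh 1" using assms by (simp add: cosh_real_nonneg_le_iff)
    then show ?thesis using z assms by (simp add: mult_left_mono)
  qed simp
  then show "wt coth_half x \<le> cosh 1 / (cosh 1 - 1) * x"
    unfolding wt_coth_half two_sinh_half_square times_divide_eq_left using c
    by (intro divide_right_mono) (simp_all add: mult.commute)
qed

context
  fixes \<Lambda> \<epsilon> :: real
  assumes Lam: "1 \<le> \<Lambda>" and eps: "\<epsilon> = 1 / (exp \<Lambda> - 1)"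
begin

text \<open>It has constant flux for the weight x + \<epsilon>. The value of \<epsilon> is fixed by
  (1 + \<epsilon>) / \<epsilon> = exp \<Lambda>, which makes the boundary values exactly 1 and
  0.\<close>

definition "cutoff x = (ln (1 + \<epsilon>) - ln (x + \<epsilon>)) / \<Lambda>"
definition "cutoff' x = - 1 / ((x + \<epsilon>) * \<Lambda>)"

lemma eps_bounds: "0 < \<epsilon>" "\<epsilon> \<le> 1"
proof -
  have "exp \<Lambda> \<ge> 1 + \<Lambda>" by (rule exp_ge_add_one_self)
  then have "exp \<Lambda> - 1 \<ge> 1" using Lam by linarith
  moreover have "0 < 1 / E \<and> 1 / E \<le> 1" if "1 \<le> E" for E :: real using that by simp
  ultimately show "0 < \<epsilon>" "\<epsilon> \<le> 1" unfolding eps by blast+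
qed

lemma ln_eps: "ln (1 + \<epsilon>) - ln \<epsilon> = \<Lambda>"
proof -
  have e: "exp \<Lambda> > 1" using Lam by simp
  have "ln (1 + \<epsilon>) - ln \<epsilon> = ln ((1 + \<epsilon>) / \<epsilon>)" using eps_bounds by (simp add: ln_div)
  also have "(1 + \<epsilon>) / \<epsilon> = exp \<Lambda>" unfolding eps using e by (simp add: field_simps)
  finally show ?thesis by simp
qed

lemma cutoff_01: "cutoff 0 = 1" "cutoff 1 = 0"
  using ln_eps Lam by (auto simp: cutoff_def)

lemma cutoff_deriv: "x \<in> {0..1} \<Longrightarrow> (cutoff has_real_derivative cutoff' x) (at x)"
  unfolding cutoff_def[abs_def] cutoff'_def using eps_bounds Lam
  by (auto intro!: derivative_eq_intros)

lemma cutoff'_cont: "continuous_on {0..1} cutoff'"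
  unfolding cutoff'_def[abs_def] using eps_bounds Lam
  by (intro continuous_intros) (auto simp: add_nonneg_eq_0_iff)

lemma cutoff_pw_C1: "pw_C1 cutoff cutoff'"
  by (rule pw_C1_smooth[OF cutoff_deriv cutoff'_cont])

lemma cutoff_bounds:
  assumes "x \<in> {0..1}"
  shows "0 \<le> cutoff x" "cutoff x \<le> 1" "x * cutoff x \<le> 2 / \<Lambda>" "x * \<bar>cutoff' x\<bar> \<le> 1 / \<Lambda>"
    "x * (cutoff' x)\<^sup>2 \<le> 1 / (x + \<epsilon>) / \<Lambda>\<^sup>2"
proof -
  note e = eps_bounds
  have xe: "0 < x + \<epsilon>" "x + \<epsilon> \<le> 1 + \<epsilon>" "\<epsilon> \<le> x + \<epsilon>" using assms e by auto
  have l1: "ln (x + \<epsilon>) \<le> ln (1 + \<epsilon>)" using xe by (subst ln_le_cancel_iff) auto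
  have l2: "ln \<epsilon> \<le> ln (x + \<epsilon>)" using xe e by (subst ln_le_cancel_iff) auto
  show c0: "0 \<le> cutoff x" using l1 Lam by (simp add: cutoff_def)
  show "cutoff x \<le> 1" using l2 ln_eps Lam by (simp add: cutoff_def field_simps)
  \<comment> \<open>The inequality ln r \<le> r - 1 controls x ln (1/x) uniformly in
    \<epsilon>.\<close>
  have "ln ((1 + \<epsilon>) / (x + \<epsilon>)) \<le> (1 + \<epsilon>) / (x + \<epsilon>) - 1" using xe e by (intro ln_le_minus_one) auto
  then have "ln (1 + \<epsilon>) - ln (x + \<epsilon>) \<le> (1 + \<epsilon>) / (x + \<epsilon>)" using xe e by (simp add: ln_div)
  then have "(x + \<epsilon>) * (ln (1 + \<epsilon>) - ln (x + \<epsilon>)) \<le> 1 + \<epsilon>" using xe by (simp add: field_simps)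
  moreover have "x * (ln (1 + \<epsilon>) - ln (x + \<epsilon>)) \<le> (x + \<epsilon>) * (ln (1 + \<epsilon>) - ln (x + \<epsilon>))"
    using l1 e by (intro mult_right_mono) auto
  ultimately have "x * (ln (1 + \<epsilon>) - ln (x + \<epsilon>)) \<le> 2" using e by linarith
  then show "x * cutoff x \<le> 2 / \<Lambda>" using Lam by (simp add: cutoff_def divide_right_mono)
  have xx: "x / (x + \<epsilon>) \<le> 1" using xe assms e by simp
  have a: "\<bar>cutoff' x\<bar> = 1 / (x + \<epsilon>) / \<Lambda>" using xe Lam by (simp add: cutoff'_def abs_mult)
  have "x * \<bar>cutoff' x\<bar> = x / (x + \<epsilon>) / \<Lambda>" unfolding a by simp
  also have "\<dots> \<le> 1 / \<Lambda>" using xx Lam by (intro divide_right_mono) auto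
  finally show "x * \<bar>cutoff' x\<bar> \<le> 1 / \<Lambda>" .
  have "x * (cutoff' x)\<^sup>2 = x / (x + \<epsilon>) * (1 / (x + \<epsilon>) / \<Lambda>\<^sup>2)"
    unfolding cutoff'_def by (simp add: power2_eq_square field_simps)
  also have "\<dots> \<le> 1 * (1 / (x + \<epsilon>) / \<Lambda>\<^sup>2)" using xx xe by (intro mult_right_mono) auto
  finally show "x * (cutoff' x)\<^sup>2 \<le> 1 / (x + \<epsilon>) / \<Lambda>\<^sup>2" by simp
qed

lemma const_integral_01: "(LBINT x:{0<..<1::real}. (c::real)) = c"
  by (simp add: set_lebesgue_integral_def)

text \<open>As the weight is at most C x, the derivative part is at most C / \<Lambda>^2 times the
  integral of 1 / (x + \<epsilon>), and this integral equals \<Lambda>. The other part is small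
  because x times \<open>cutoff\<close> is.\<close>

lemma energy_cutoff:
  defines "C \<equiv> cosh 1 / (cosh 1 - 1 :: real)"
  shows "energy \<alpha> coth_half cutoff cutoff' \<le> (2 * \<bar>\<alpha>\<bar> * C + C) / \<Lambda>"
proof -
  have C: "0 < C" using cosh_1_bounds by (simp add: C_def)
  note L = pw_C1_L2[OF cutoff_pw_C1]
  have cl: "continuous_on {0..1} (\<lambda>x. C / \<Lambda>\<^sup>2 * (1 / (x + \<epsilon>)))"
    using eps_bounds by (intro continuous_intros) auto
  have i2: "set_integrable lborel {0<..<1} (\<lambda>x. C / \<Lambda>\<^sup>2 * (1 / (x + \<epsilon>)))"
    by (rule set_integrable_L2[OF continuous_L2[OF cl]])
  have i1: "set_integrable lborel {0<..<1::real} (\<lambda>x. \<bar>\<alpha>\<bar> * (C * (2 / \<Lambda>)))"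
    by (rule set_integrable_L2, rule const_L2)
  have "set_integrable lborel {0<..<1} (\<lambda>x. \<alpha> * (wt coth_half x * (cutoff x * cutoff x)) + wt coth_half x * (cutoff' x * cutoff' x))"
    using L by (intro set_integral_add(1) set_integrable_mult_right wt_L2_integrable) auto
  then have i0: "set_integrable lborel {0<..<1} (\<lambda>x. wt coth_half x * (\<alpha> * (cutoff x)\<^sup>2 + (cutoff' x)\<^sup>2))"
    by (simp add: algebra_simps power2_eq_square)
  have "energy \<alpha> coth_half cutoff cutoff' \<le> (LBINT x:{0<..<1}. \<bar>\<alpha>\<bar> * (C * (2 / \<Lambda>)) + C / \<Lambda>\<^sup>2 * (1 / (x + \<epsilon>)))"
    unfolding energy_wt
  proof (rule set_integral_mono[OF i0 set_integral_add(1)[OF i1 i2]])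
    fix x :: real assume "x \<in> {0<..<1}"
    then have x: "x \<in> {0..1}" by auto
    note b = cutoff_bounds[OF x]
    have w: "0 \<le> wt coth_half x" "wt coth_half x \<le> C * x" using wt_coth_half_le[OF x] by (simp_all add: C_def)
    have "(cutoff x)\<^sup>2 \<le> cutoff x" using b by (simp add: power2_eq_square mult_left_le)
    then have "wt coth_half x * (cutoff x)\<^sup>2 \<le> (C * x) * cutoff x" using w b by (intro mult_mono) auto
    also have "\<dots> \<le> C * (2 / \<Lambda>)" unfolding mult.assoc using b C by (intro mult_left_mono) auto
    finally have 1: "wt coth_half x * (cutoff x)\<^sup>2 \<le> C * (2 / \<Lambda>)" .
    have "\<alpha> * (wt coth_half x * (cutoff x)\<^sup>2) \<le> \<bar>\<alpha>\<bar> * (wt coth_half x * (cutoff x)\<^sup>2)"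
      using w by (intro mult_right_mono) auto
    also have "\<dots> \<le> \<bar>\<alpha>\<bar> * (C * (2 / \<Lambda>))" using 1 by (intro mult_left_mono) auto
    finally have A: "\<alpha> * (wt coth_half x * (cutoff x)\<^sup>2) \<le> \<bar>\<alpha>\<bar> * (C * (2 / \<Lambda>))" .
    have "wt coth_half x * (cutoff' x)\<^sup>2 \<le> (C * x) * (cutoff' x)\<^sup>2" using w by (intro mult_right_mono) auto
    also have "\<dots> \<le> C * (1 / (x + \<epsilon>) / \<Lambda>\<^sup>2)" unfolding mult.assoc using b C by (intro mult_left_mono) auto
    finally have B: "wt coth_half x * (cutoff' x)\<^sup>2 \<le> C / \<Lambda>\<^sup>2 * (1 / (x + \<epsilon>))" by (simp add: field_simps)
    show "wt coth_half x * (\<alpha> * (cutoff x)\<^sup>2 + (cutoff' x)\<^sup>2) \<le> \<bar>\<alpha>\<bar> * (C * (2 / \<Lambda>)) + C / \<Lambda>\<^sup>2 * (1 / (x + \<epsilon>))"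
      using A B by (simp add: algebra_simps)
  qed
  also have "\<dots> = \<bar>\<alpha>\<bar> * (C * (2 / \<Lambda>)) + (LBINT x:{0<..<1}. C / \<Lambda>\<^sup>2 * (1 / (x + \<epsilon>)))"
    unfolding set_integral_add(2)[OF i1 i2] const_integral_01 ..
  also have "(LBINT x:{0<..<1}. C / \<Lambda>\<^sup>2 * (1 / (x + \<epsilon>))) = C / \<Lambda>\<^sup>2 * ln (1 + \<epsilon>) - C / \<Lambda>\<^sup>2 * ln (0 + \<epsilon>)"
  proof (rule set_integral_FTC_finite[where S="{}", OF _ _ _ i2])
    have d: "((\<lambda>x. C / \<Lambda>\<^sup>2 * ln (x + \<epsilon>)) has_real_derivative C / \<Lambda>\<^sup>2 * (1 / (x + \<epsilon>))) (at x)" if "0 \<le> x" for x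
      by (rule DERIV_cmult) (use that eps_bounds in \<open>auto intro!: derivative_eq_intros\<close>)
    then show "((\<lambda>x. C / \<Lambda>\<^sup>2 * ln (x + \<epsilon>)) has_real_derivative C / \<Lambda>\<^sup>2 * (1 / (x + \<epsilon>))) (at x)" if "0 < x" for x
      using that by simp
    show "continuous_on {0..1} (\<lambda>x. C / \<Lambda>\<^sup>2 * ln (x + \<epsilon>))"
      by (intro continuous_at_imp_continuous_on ballI DERIV_isCont[OF d]) simp
  qed auto
  also have "\<dots> = C / \<Lambda>\<^sup>2 * (ln (1 + \<epsilon>) - ln \<epsilon>)" by (simp add: right_diff_distrib)
  also have "\<dots> = C / \<Lambda>\<^sup>2 * \<Lambda>" by (simp only: ln_eps)
  also have "\<dots> = C / \<Lambda>" using Lam by (simp add: power2_eq_square)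
  finally show ?thesis by (simp add: add_divide_distrib mult_ac)
qed

text \<open>Both products, of the weight with \<open>cutoff\<close> and with its derivative, are
  O(1/\<Lambda>) pointwise, so bounded f and g suffice.\<close>

lemma cross_cutoff:
  defines "C \<equiv> cosh 1 / (cosh 1 - 1 :: real)"
  assumes fg: "f \<in> L2_01" "g \<in> L2_01" and F: "\<And>x. x \<in> {0<..<1} \<Longrightarrow> \<bar>f x\<bar> \<le> F"
    and G: "\<And>x. x \<in> {0<..<1} \<Longrightarrow> \<bar>g x\<bar> \<le> G"
  shows "\<bar>LBINT x:{0<..<1}. wt coth_half x * (\<alpha> * f x * cutoff x + g x * cutoff' x)\<bar> \<le> (2 * \<bar>\<alpha>\<bar> * F * C + G * C) / \<Lambda>"
proof -
  have C: "0 < C" using cosh_1_bounds by (simp add: C_def)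
  have FG: "0 \<le> F" "0 \<le> G" using F[of "1/2"] G[of "1/2"] by auto
  note L = pw_C1_L2[OF cutoff_pw_C1]
  have "set_integrable lborel {0<..<1} (\<lambda>x. \<alpha> * (wt coth_half x * (f x * cutoff x)) + wt coth_half x * (g x * cutoff' x))"
    using L fg by (intro set_integral_add(1) set_integrable_mult_right wt_L2_integrable) auto
  then have i: "set_integrable lborel {0<..<1} (\<lambda>x. wt coth_half x * (\<alpha> * f x * cutoff x + g x * cutoff' x))"
    by (simp add: algebra_simps)
  have "\<bar>LBINT x:{0<..<1}. wt coth_half x * (\<alpha> * f x * cutoff x + g x * cutoff' x)\<bar> 
      \<le> (LBINT x:{0<..<1}. \<bar>wt coth_half x * (\<alpha> * f x * cutoff x + g x * cutoff' x)\<bar>)"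
    using set_integral_norm_bound[OF i] by simp
  also have "\<dots> \<le> (LBINT x:{0<..<1::real}. (2 * \<bar>\<alpha>\<bar> * F * C + G * C) / \<Lambda>)"
  proof (rule set_integral_mono)
    show "set_integrable lborel {0<..<1} (\<lambda>x. \<bar>wt coth_half x * (\<alpha> * f x * cutoff x + g x * cutoff' x)\<bar>)"
      using i by (rule set_integrable_abs)
    show "set_integrable lborel {0<..<1::real} (\<lambda>x. (2 * \<bar>\<alpha>\<bar> * F * C + G * C) / \<Lambda>)"
      by (rule set_integrable_L2, rule const_L2)
    fix x :: real assume x01: "x \<in> {0<..<1}"
    then have x: "x \<in> {0..1}" by auto
    note b = cutoff_bounds[OF x]
    have w: "0 \<le> wt coth_half x" "wt coth_half x \<le> C * x" using wt_coth_half_le[OF x] by (simp_all add: C_def)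
    have "wt coth_half x * cutoff x \<le> (C * x) * cutoff x" using w b by (intro mult_right_mono) auto
    also have "\<dots> \<le> C * (2 / \<Lambda>)" unfolding mult.assoc using b C by (intro mult_left_mono) auto
    finally have 1: "wt coth_half x * cutoff x \<le> C * (2 / \<Lambda>)" .
    have "wt coth_half x * \<bar>cutoff' x\<bar> \<le> (C * x) * \<bar>cutoff' x\<bar>" using w by (intro mult_right_mono) auto
    also have "\<dots> \<le> C * (1 / \<Lambda>)" unfolding mult.assoc using b C by (intro mult_left_mono) auto
    finally have 2: "wt coth_half x * \<bar>cutoff' x\<bar> \<le> C * (1 / \<Lambda>)" .
    have "\<bar>wt coth_half x * (\<alpha> * f x * cutoff x + g x * cutoff' x)\<bar>
        \<le> \<bar>\<alpha>\<bar> * \<bar>f x\<bar> * (wt coth_half x * cutoff x) + \<bar>g x\<bar> * (wt coth_half x * \<bar>cutoff' x\<bar>)"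
    proof -
      have "\<bar>wt coth_half x * (\<alpha> * f x * cutoff x + g x * cutoff' x)\<bar> =
        \<bar>\<alpha> * f x * (wt coth_half x * cutoff x) + g x * (wt coth_half x * cutoff' x)\<bar>" by (simp add: algebra_simps)
      also have "\<dots> \<le> \<bar>\<alpha> * f x * (wt coth_half x * cutoff x)\<bar> + \<bar>g x * (wt coth_half x * cutoff' x)\<bar>"
        by (rule abs_triangle_ineq)
      finally show ?thesis using w b by (simp add: abs_mult)
    qed
    also have "\<dots> \<le> \<bar>\<alpha>\<bar> * F * (C * (2 / \<Lambda>)) + G * (C * (1 / \<Lambda>))"
    proof -
      have "\<bar>\<alpha>\<bar> * \<bar>f x\<bar> * (wt coth_half x * cutoff x) \<le> \<bar>\<alpha>\<bar> * F * (C * (2 / \<Lambda>))"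
        by (rule mult_mono[OF mult_left_mono[OF F[OF x01]] 1]) (use FG w b in auto)
      moreover have "\<bar>g x\<bar> * (wt coth_half x * \<bar>cutoff' x\<bar>) \<le> G * (C * (1 / \<Lambda>))"
        by (rule mult_mono[OF G[OF x01] 2]) (use FG w b in auto)
      ultimately show ?thesis by (rule add_mono)
    qed
    also have "\<dots> = (2 * \<bar>\<alpha>\<bar> * F * C + G * C) / \<Lambda>" by (simp add: add_divide_distrib mult_ac)
    finally show "\<bar>wt coth_half x * (\<alpha> * f x * cutoff x + g x * cutoff' x)\<bar> \<le> (2 * \<bar>\<alpha>\<bar> * F * C + G * C) / \<Lambda>" .
  qed
  also have "\<dots> = (2 * \<bar>\<alpha>\<bar> * F * C + G * C) / \<Lambda>" by (rule const_integral_01)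
  finally show ?thesis .
qed

end

text \<open>The degenerate endpoint \<open>0\<close> has zero capacity, so the boundary condition there is invisible
  to the infimum; \<open>cutoff\<close> is a logarithmic capacity potential.\<close>

lemma energy_degenerate_endpoint:
  assumes fg: "pw_C1 f g" and f1: "f 1 = 1"
    and K: "\<And>u v. competitor u v \<Longrightarrow> K \<le> energy \<alpha> coth_half u v"
  shows "K \<le> energy \<alpha> coth_half f g"
proof -
  define C where "C = cosh 1 / (cosh 1 - 1 :: real)"
  note L = pw_C1_L2[OF fg]
  have "continuous_on {0..1} f" using fg by (simp add: pw_C1_def)
  then obtain F where F: "\<And>x. x \<in> {0..1} \<Longrightarrow> \<bar>f x\<bar> \<le> F" using continuous_bounded_01 by blast
  obtain G where G: "\<And>x. x \<in> {0<..<1} \<Longrightarrow> \<bar>g x\<bar> \<le> G" using fg unfolding pw_C1_def by blast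
  \<comment> \<open>The defect of the boundary value at 0, repaired by adding this multiple of a
    cutoff; the total cost M / \<Lambda> tends to 0.\<close>
  define \<kappa> where "\<kappa> = 1 - f 0"
  define M where "M = 2 * \<bar>\<kappa>\<bar> * (2 * \<bar>\<alpha>\<bar> * F * C + G * C) + \<kappa>\<^sup>2 * (2 * \<bar>\<alpha>\<bar> * C + C)"
  have key: "K \<le> energy \<alpha> coth_half f g + M / \<Lambda>" if Lam: "1 \<le> \<Lambda>" for \<Lambda>
  proof -
    let ?c = "cutoff \<Lambda> (1 / (exp \<Lambda> - 1))" and ?d = "cutoff' \<Lambda> (1 / (exp \<Lambda> - 1))"
    have pw: "pw_C1 ?c ?d" by (rule cutoff_pw_C1[OF Lam refl])
    note Lc = pw_C1_L2[OF pw]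
    have "pw_C1 (\<lambda>x. f x + \<kappa> * ?c x) (\<lambda>x. g x + \<kappa> * ?d x)"
      by (intro pw_C1_add pw_C1_scale fg pw)
    then have "competitor (\<lambda>x. f x + \<kappa> * ?c x) (\<lambda>x. g x + \<kappa> * ?d x)"
      by (rule pw_C1_competitor) (use cutoff_01[OF Lam refl] f1 in \<open>auto simp: \<kappa>_def\<close>)
    then have "K \<le> energy \<alpha> coth_half (\<lambda>x. f x + \<kappa> * ?c x) (\<lambda>x. g x + \<kappa> * ?d x)" by (rule K)
    also have "\<dots> = energy \<alpha> coth_half f g + 2 * \<kappa> * (LBINT x:{0<..<1}. wt coth_half x * (\<alpha> * f x * ?c x + g x * ?d x))
        + \<kappa>\<^sup>2 * energy \<alpha> coth_half ?c ?d"
      using L Lc by (intro energy_expand) auto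
    also have "\<dots> \<le> energy \<alpha> coth_half f g + 2 * \<bar>\<kappa>\<bar> * ((2 * \<bar>\<alpha>\<bar> * F * C + G * C) / \<Lambda>) + \<kappa>\<^sup>2 * ((2 * \<bar>\<alpha>\<bar> * C + C) / \<Lambda>)"
    proof (intro add_mono order_refl mult_left_mono)
      have "2 * \<kappa> * (LBINT x:{0<..<1}. wt coth_half x * (\<alpha> * f x * ?c x + g x * ?d x))
         \<le> 2 * \<bar>\<kappa>\<bar> * \<bar>LBINT x:{0<..<1}. wt coth_half x * (\<alpha> * f x * ?c x + g x * ?d x)\<bar>"
        using abs_ge_self[of "2 * \<kappa> * (LBINT x:{0<..<1}. wt coth_half x * (\<alpha> * f x * ?c x + g x * ?d x))"]
        by (simp add: abs_mult)
      also have "\<dots> \<le> 2 * \<bar>\<kappa>\<bar> * ((2 * \<bar>\<alpha>\<bar> * F * C + G * C) / \<Lambda>)"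
        unfolding C_def using L F G by (intro mult_left_mono cross_cutoff[OF Lam refl]) auto
      finally show "2 * \<kappa> * (LBINT x:{0<..<1}. wt coth_half x * (\<alpha> * f x * ?c x + g x * ?d x))
        \<le> 2 * \<bar>\<kappa>\<bar> * ((2 * \<bar>\<alpha>\<bar> * F * C + G * C) / \<Lambda>)" .
      show "energy \<alpha> coth_half ?c ?d \<le> (2 * \<bar>\<alpha>\<bar> * C + C) / \<Lambda>"
        unfolding C_def by (rule energy_cutoff[OF Lam refl])
    qed simp
    also have "\<dots> = energy \<alpha> coth_half f g + M / \<Lambda>"
      unfolding M_def by (simp add: add_divide_distrib ring_distribs)
    finally show ?thesis .
  qed
  have "((\<lambda>\<Lambda>. energy \<alpha> coth_half f g + M / \<Lambda>) \<longlongrightarrow> energy \<alpha> coth_half f g + 0) at_top"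
    by (intro tendsto_intros tendsto_divide_0[OF tendsto_const] filterlim_at_top_imp_at_infinity filterlim_ident)
  then have "K \<le> energy \<alpha> coth_half f g + 0"
    by (rule tendsto_lowerbound) (use key in \<open>auto intro: eventually_mono[OF eventually_ge_at_top[of 1]]\<close>)
  then show ?thesis by simp
qed

section \<open>The Legendre power series and its differential equation\<close>

definition legendre_fps :: "'a::field_char_0 \<Rightarrow> 'a fps" where
  "legendre_fps a = Abs_fps (\<lambda>k. (\<Prod>j<k. of_nat (j * (j + 1)) - a) / (fact k)\<^sup>2)"

text \<open>The coefficients depend on the degree \<nu> only through a = \<nu> (\<nu> + 1), that is
  on \<alpha>, so they are real even for complex \<nu>. This recurrence is the Legendre equation in
  coefficients.\<close>

lemma legendre_fps_Suc:
  "fps_nth (legendre_fps a) (Suc k) * (of_nat (Suc k))\<^sup>2 = (of_nat (k * (k + 1)) - a) * fps_nth (legendre_fps a) k"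
proof -
  have "of_nat (Suc k) \<noteq> (0::'a)" by (rule of_nat_neq_0)
  then show ?thesis by (simp add: legendre_fps_def power_mult_distrib divide_simps del: of_nat_Suc)
qed

text \<open>From the index 2 |a| on the coefficients grow at most by the factor 3/2, so at radius
  1/2 the ratio is 3/4. The disc contains (1 - cosh x) / 2 for all x in [0,1].\<close>

lemma legendre_fps_conv_radius: "ereal (1/2) \<le> fps_conv_radius (legendre_fps (a :: real))"
proof -
  have "summable (\<lambda>n. fps_nth (legendre_fps a) n * (1/2) ^ n)"
  proof (rule summable_ratio_test[where c="3/4" and N="nat \<lceil>2 * \<bar>a\<bar>\<rceil>"])
    fix n assume n: "nat \<lceil>2 * \<bar>a\<bar>\<rceil> \<le> n"
    then have an: "2 * \<bar>a\<bar> \<le> real n" by linarith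
    let ?c = "\<lambda>n. fps_nth (legendre_fps a) n"
    have "\<bar>of_nat (n * (n + 1)) - a\<bar> \<le> real (n * (n + 1)) + \<bar>a\<bar>" by linarith
    also have "\<dots> \<le> 3/2 * (real (Suc n))\<^sup>2"
    proof -
      have "2 * \<bar>a\<bar> \<le> (real (Suc n))\<^sup>2" 
      proof -
        have "(real (Suc n))\<^sup>2 = real n * real n + 2 * real n + 1" by (simp add: power2_eq_square algebra_simps)
        moreover have "0 \<le> real n * real n" by simp
        ultimately show ?thesis using an by linarith
      qed
      then show ?thesis by (simp add: power2_eq_square algebra_simps)
    qed
    finally have "\<bar>(of_nat (n * (n + 1)) - a) * ?c n\<bar> \<le> 3/2 * (real (Suc n))\<^sup>2 * \<bar>?c n\<bar>"
      unfolding abs_mult by (intro mult_right_mono) auto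
    then have "\<bar>?c (Suc n)\<bar> * (real (Suc n))\<^sup>2 \<le> 3/2 * \<bar>?c n\<bar> * (real (Suc n))\<^sup>2"
      unfolding legendre_fps_Suc[symmetric] abs_mult by (simp add: mult_ac del: of_nat_Suc)
    then have "\<bar>?c (Suc n)\<bar> \<le> 3/2 * \<bar>?c n\<bar>"
      by (rule mult_right_le_imp_le) simp
    then show "norm (?c (Suc n) * (1/2) ^ Suc n) \<le> 3/4 * norm (?c n * (1/2) ^ n)"
      by (simp add: abs_mult field_simps)
  qed simp
  then have "conv_radius (fps_nth (legendre_fps a)) \<ge> norm (1/2 :: real)"
    by (rule conv_radius_geI)
  then show ?thesis by (simp add: fps_conv_radius_def)
qed

definition leg :: "real \<Rightarrow> real \<Rightarrow> real" where "leg \<alpha> = eval_fps (legendre_fps \<alpha>)"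
definition leg' :: "real \<Rightarrow> real \<Rightarrow> real" where "leg' \<alpha> = eval_fps (fps_deriv (legendre_fps \<alpha>))"

lemma in_legendre_disc:
  assumes "\<bar>z\<bar> < 1/2"
  shows "ereal (norm (z::real)) < fps_conv_radius (legendre_fps (a :: real))"
proof -
  have "ereal (norm z) < ereal (1/2)" using assms by simp
  also have "\<dots> \<le> fps_conv_radius (legendre_fps a)" by (rule legendre_fps_conv_radius)
  finally show ?thesis .
qed

lemma leg_deriv: "\<bar>z\<bar> < 1/2 \<Longrightarrow> (leg \<alpha> has_real_derivative leg' \<alpha> z) (at z)"
  unfolding leg_def leg'_def
  by (rule has_field_derivative_eval_fps) (use in_legendre_disc[of z \<alpha>] in auto)

lemma legendre_fps_ode:
  "fps_deriv ((fps_X - fps_X * fps_X) * fps_deriv (legendre_fps a)) = - (fps_const a * legendre_fps (a::real))"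
proof (rule fps_ext)
  fix n
  let ?c = "fps_nth (legendre_fps a)"
  have "fps_nth (fps_deriv ((fps_X - fps_X * fps_X) * fps_deriv (legendre_fps a))) n
     = of_nat (Suc n) * (of_nat (Suc n) * ?c (Suc n) - of_nat n * ?c n)"
    by (cases n) (simp_all add: left_diff_distrib mult.assoc, simp add: algebra_simps)
  also have "\<dots> = ?c (Suc n) * (of_nat (Suc n))\<^sup>2 - of_nat (n * (n + 1)) * ?c n"
    by (simp add: algebra_simps power2_eq_square)
  also have "\<dots> = - (a * ?c n)" unfolding legendre_fps_Suc by (simp add: algebra_simps)
  finally show "fps_nth (fps_deriv ((fps_X - fps_X * fps_X) * fps_deriv (legendre_fps a))) n
     = fps_nth (- (fps_const a * legendre_fps a)) n" by simp
qed

lemma leg_ode: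
  assumes z: "\<bar>z\<bar> < 1/2"
  shows "((\<lambda>z. (z - z * z) * leg' \<alpha> z) has_real_derivative - (\<alpha> * leg \<alpha> z)) (at z)"
proof -
  let ?F = "legendre_fps \<alpha>"
  let ?G = "(fps_X - fps_X * fps_X) * fps_deriv ?F"
  have rX: "fps_conv_radius (fps_X - fps_X * fps_X :: real fps) = \<infinity>"
    by (metis fps_conv_radius_diff fps_conv_radius_fps_X fps_conv_radius_mult ereal_infty_less_eq(1) min.idem)
  have rF: "fps_conv_radius ?F \<le> fps_conv_radius (fps_deriv ?F)" by (rule fps_conv_radius_deriv)
  have rG: "fps_conv_radius ?F \<le> fps_conv_radius ?G"
    using fps_conv_radius_mult[of "fps_X - fps_X * fps_X" "fps_deriv ?F"] rX rF by (simp add: min_def split: if_splits)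
  have ev: "eval_fps ?G w = (w - w * w) * leg' \<alpha> w" if "\<bar>w\<bar> < 1/2" for w
  proof -
    have w: "ereal (norm w) < fps_conv_radius (fps_deriv ?F)" using in_legendre_disc[OF that, of \<alpha>] rF by (rule less_le_trans)
    have "eval_fps ?G w = eval_fps (fps_X - fps_X * fps_X) w * eval_fps (fps_deriv ?F) w"
      using w rX by (intro eval_fps_mult) auto
    also have "eval_fps (fps_X - fps_X * fps_X) w = w - w * w"
      by (subst eval_fps_diff) (auto simp: eval_fps_mult intro: order.strict_trans2[OF _ fps_conv_radius_mult])
    finally show ?thesis by (simp add: leg'_def)
  qed
  have zG: "z \<in> eball 0 (fps_conv_radius ?G)"
    using in_legendre_disc[OF z, of \<alpha>] rG by (simp add: in_eball_iff)
  have "(eval_fps ?G has_real_derivative eval_fps (fps_deriv ?G) z) (at z)"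
    using zG by (intro has_field_derivative_eval_fps) simp
  then have "((\<lambda>w. (w - w * w) * leg' \<alpha> w) has_real_derivative eval_fps (fps_deriv ?G) z) (at z)"
    by (rule has_field_derivative_transform_within_open[where S="{-1/2<..<1/2}"]) (use z ev in auto)
  moreover have "- (fps_const \<alpha> * ?F) = fps_const (- \<alpha>) * ?F" by (simp flip: fps_const_neg)
  then have "eval_fps (fps_deriv ?G) z = - (\<alpha> * leg \<alpha> z)"
    unfolding legendre_fps_ode leg_def using in_legendre_disc[OF z, of \<alpha>]
    by (simp add: eval_fps_mult del: fps_const_neg)
  ultimately show ?thesis by simp
qed

section \<open>The degenerate case and Legendre functions\<close>

definition leg_y :: "real \<Rightarrow> real \<Rightarrow> real" where
  "leg_y \<alpha> x = leg \<alpha> ((1 - cosh x) / 2)"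

definition leg_y' :: "real \<Rightarrow> real \<Rightarrow> real" where
  "leg_y' \<alpha> x = - (leg' \<alpha> ((1 - cosh x) / 2) * sinh x / 2)"

text \<open>The factor cosh 1 + 1 is (e + 1)^2 / (2 e), and -1/2 is the inner derivative of (1 - z)
  / 2.\<close>

definition L_real :: "real \<Rightarrow> real" where
  "L_real \<alpha> = (cosh 1 + 1) * (- (leg' \<alpha> ((1 - cosh 1) / 2)) / 2 / leg \<alpha> ((1 - cosh 1) / 2))"

lemma arg_in_disc: "x \<in> {0..1} \<Longrightarrow> \<bar>(1 - cosh x) / 2\<bar> < (1/2 :: real)"
  using cosh_real_ge_1[of x] cosh_real_nonneg_le_iff[of x 1] cosh_1_bounds by auto

lemma arg_deriv: "((\<lambda>x. (1 - cosh x) / 2) has_real_derivative - sinh x / 2) (at x)"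
  by (auto intro!: derivative_eq_intros)

lemma leg_y_deriv:
  assumes "x \<in> {0..1}"
  shows "(leg_y \<alpha> has_real_derivative leg_y' \<alpha> x) (at x)"
proof -
  have "((\<lambda>x. leg \<alpha> ((1 - cosh x) / 2)) has_real_derivative leg' \<alpha> ((1 - cosh x) / 2) * (- sinh x / 2)) (at x)"
    by (rule DERIV_chain2[where g="\<lambda>x. (1 - cosh x) / 2", OF leg_deriv[OF arg_in_disc[OF assms]] arg_deriv])
  then show ?thesis unfolding leg_y_def[abs_def] leg_y'_def by simp
qed

text \<open>With z = (1 - cosh x) / 2 one has z - z^2 = - (sinh x)^2 / 4. The flux is thus a
  constant multiple of z - z^2 times the derivative in z, the quantity differentiated in
  \<open>leg_ode\<close>.\<close>

lemma leg_flux: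
  "wt coth_half x * leg_y' \<alpha> x
    = ((1 - cosh x) / 2 - (1 - cosh x) / 2 * ((1 - cosh x) / 2)) * leg' \<alpha> ((1 - cosh x) / 2) / (sinh (1/2))\<^sup>2"
proof -
  have e: "(1 - cosh x) / 2 - (1 - cosh x) / 2 * ((1 - cosh x) / 2) = - (sinh x * sinh x) / 4"
  proof -
    have "(1 - c) / 2 - (1 - c) / 2 * ((1 - c) / 2) = - (c * c - 1) / 4" for c :: real
      by (simp add: field_simps)
    moreover have "sinh x * sinh x = cosh x * cosh x - 1" using sinh_square_eq[of x] by (simp add: power2_eq_square)
    ultimately show ?thesis by metis
  qed
  show ?thesis unfolding e by (simp add: wt_coth_half leg_y'_def)
qed

lemma leg_flux_deriv:
  assumes "x \<in> {0..1}"
  shows "((\<lambda>x. wt coth_half x * leg_y' \<alpha> x) has_real_derivative \<alpha> * wt coth_half x * leg_y \<alpha> x) (at x)"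
proof -
  have "((\<lambda>x. ((1 - cosh x) / 2 - (1 - cosh x) / 2 * ((1 - cosh x) / 2)) * leg' \<alpha> ((1 - cosh x) / 2))
     has_real_derivative - (\<alpha> * leg \<alpha> ((1 - cosh x) / 2)) * (- sinh x / 2)) (at x)"
    by (rule DERIV_chain2[where g="\<lambda>x. (1 - cosh x) / 2" and f="\<lambda>z. (z - z * z) * leg' \<alpha> z",
          OF leg_ode[OF arg_in_disc[OF assms]] arg_deriv])
  from DERIV_cdivide[OF this, of "(sinh (1/2))\<^sup>2"] show ?thesis
    unfolding leg_flux by (simp add: wt_coth_half leg_y_def mult_ac)
qed

lemma leg_y_cont: "continuous_on {0..1} (leg_y \<alpha>)"
  by (intro continuous_at_imp_continuous_on ballI DERIV_isCont[OF leg_y_deriv])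

lemma leg'_isCont:
  assumes "\<bar>z\<bar> < 1/2"
  shows "isCont (leg' \<alpha>) z"
proof -
  have "(leg' \<alpha> has_real_derivative eval_fps (fps_deriv (fps_deriv (legendre_fps \<alpha>))) z) (at z)"
    unfolding leg'_def using in_legendre_disc[OF assms, of \<alpha>]
    by (intro has_field_derivative_eval_fps less_le_trans[OF _ fps_conv_radius_deriv]) simp
  then show ?thesis by (rule DERIV_isCont)
qed

lemma leg_y'_cont: "continuous_on {0..1} (leg_y' \<alpha>)"
proof -
  have "isCont (\<lambda>x. - (leg' \<alpha> ((1 - cosh x) / 2) * sinh x / 2)) x" if "x \<in> {0..1}" for x
    by (intro continuous_intros isCont_o2[where f="\<lambda>x. (1 - cosh x) / 2", OF DERIV_isCont[OF arg_deriv] leg'_isCont[OF arg_in_disc[OF that]]]) auto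
  then show ?thesis
    unfolding leg_y'_def[abs_def] by (auto intro: continuous_at_imp_continuous_on)
qed

lemma leg_y_0: "leg_y \<alpha> 0 = 1"
  by (simp add: leg_y_def leg_def eval_fps_at_0 legendre_fps_def)

lemma leg_0: "leg 0 z = 1"
proof -
  have "legendre_fps (0::real) = 1"
    by (rule fps_ext) (auto simp: legendre_fps_def intro!: prod_zero bexI[of _ 0])
  then show ?thesis by (simp add: leg_def)
qed

lemma leg_flux_1: "wt coth_half 1 * leg_y' \<alpha> 1 / leg_y \<alpha> 1 = L_real \<alpha>"
proof -
  have "wt coth_half 1 * leg_y' \<alpha> 1 = wt coth_half 1 * sinh 1 * (- leg' \<alpha> ((1 - cosh 1) / 2) / 2)"
    by (simp add: leg_y'_def)
  then show ?thesis unfolding wt_coth_half_1 by (simp add: L_real_def leg_y_def)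
qed

lemma wt_coth_half_0: "wt coth_half 0 = 0"
  by (simp add: wt_coth_half)

text \<open>The weight, and with it the flux, vanishes at 0, so the flux difference consists of the
  contribution at 1 alone.\<close>

lemma energy_ge_L:
  assumes pos: "\<And>x. x \<in> {0..1} \<Longrightarrow> 0 < leg_y \<alpha> x"
    and uv: "competitor u v" "\<bar>\<beta>\<bar> \<le> coth_half"
  shows "L_real \<alpha> \<le> energy \<alpha> \<beta> u v"
proof -
  have "wt coth_half 1 * leg_y' \<alpha> 1 / leg_y \<alpha> 1 - wt coth_half 0 * leg_y' \<alpha> 0 / leg_y \<alpha> 0 \<le> energy \<alpha> \<beta> u v"
  proof (rule energy_lower_supersolution[OF uv wt_pos pos leg_y_deriv leg_y'_cont leg_flux_deriv])
    show "continuous_on {0..1} (\<lambda>x. \<alpha> * wt coth_half x * leg_y \<alpha> x)"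
      by (intro continuous_intros wt_cont leg_y_cont)
  qed (use coth_half_gt_1 in auto)
  then show ?thesis unfolding leg_flux_1 wt_coth_half_0 by simp
qed

text \<open>The multiple of \<open>leg_y\<close> with value 1 at the right end has the value c at
  the left end, which \<open>energy_degenerate_endpoint\<close> permits. Its energy is again a flux
  difference.\<close>

lemma le_L_real:
  assumes y1: "leg_y \<alpha> 1 \<noteq> 0"
    and K: "\<And>u v. competitor u v \<Longrightarrow> K \<le> energy \<alpha> coth_half u v"
  shows "K \<le> L_real \<alpha>"
proof -
  define c where "c = 1 / leg_y \<alpha> 1"
  let ?f = "\<lambda>x. c * leg_y \<alpha> x" and ?g = "\<lambda>x. c * leg_y' \<alpha> x"
  have pw: "pw_C1 ?f ?g"
    by (intro pw_C1_scale pw_C1_smooth leg_y_deriv leg_y'_cont)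
  note L = pw_C1_L2[OF pw]
  have "K \<le> energy \<alpha> coth_half ?f ?g"
    by (rule energy_degenerate_endpoint[OF pw _ K]) (use y1 in \<open>auto simp: c_def\<close>)
  also have "\<dots> = (LBINT x:{0<..<1}. wt coth_half x * (\<alpha> * (?f x)\<^sup>2 + (?g x)\<^sup>2))" by (rule energy_wt)
  also have "\<dots> = c\<^sup>2 * (wt coth_half 1 * leg_y' \<alpha> 1 * leg_y \<alpha> 1) - c\<^sup>2 * (wt coth_half 0 * leg_y' \<alpha> 0 * leg_y \<alpha> 0)"
  proof (rule set_integral_FTC_finite[where S="{}" and F="\<lambda>x. c\<^sup>2 * (wt coth_half x * leg_y' \<alpha> x * leg_y \<alpha> x)"])
    have d: "((\<lambda>x. c\<^sup>2 * (wt coth_half x * leg_y' \<alpha> x * leg_y \<alpha> x)) has_real_derivative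
       wt coth_half x * (\<alpha> * (?f x)\<^sup>2 + (?g x)\<^sup>2)) (at x)" if "x \<in> {0..1}" for x
      using DERIV_cmult[OF DERIV_mult[OF leg_flux_deriv[OF that, of \<alpha>] leg_y_deriv[OF that, of \<alpha>]], of "c\<^sup>2"]
      by (simp add: algebra_simps power2_eq_square)
    show "((\<lambda>x. c\<^sup>2 * (wt coth_half x * leg_y' \<alpha> x * leg_y \<alpha> x)) has_real_derivative
       wt coth_half x * (\<alpha> * (?f x)\<^sup>2 + (?g x)\<^sup>2)) (at x)" if "0 < x" "x < 1" for x using that by (intro d) auto
    show "continuous_on {0..1} (\<lambda>x. c\<^sup>2 * (wt coth_half x * leg_y' \<alpha> x * leg_y \<alpha> x))"
      by (intro continuous_at_imp_continuous_on ballI DERIV_isCont[OF d])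
    have "set_integrable lborel {0<..<1} (\<lambda>x. \<alpha> * (wt coth_half x * (?f x * ?f x)) + wt coth_half x * (?g x * ?g x))"
      using L by (intro set_integral_add(1) set_integrable_mult_right wt_L2_integrable) auto
    then show "set_integrable lborel {0<..<1} (\<lambda>x. wt coth_half x * (\<alpha> * (?f x)\<^sup>2 + (?g x)\<^sup>2))"
      by (simp add: algebra_simps power2_eq_square)
  qed auto
  also have "\<dots> = wt coth_half 1 * leg_y' \<alpha> 1 / leg_y \<alpha> 1"
    using y1 by (simp add: c_def wt_coth_half_0 power2_eq_square)
  finally show ?thesis unfolding leg_flux_1 .
qed

text \<open>If \<open>leg_y \<alpha>\<close> vanished first at \<open>x0\<close>, its truncation at \<open>x0\<close> would be a null direction of the
  quadratic form along which the linear part of the energy is nonzero.\<close>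

lemma leg_y_pos:
  assumes adm: "admissible \<alpha> coth_half" and x: "x \<in> {0..1}"
  shows "0 < leg_y \<alpha> x"
proof (rule ccontr)
  assume neg: "\<not> 0 < leg_y \<alpha> x"
  define Z where "Z = {x \<in> {0..1}. leg_y \<alpha> x = 0}"
  have zero: "\<exists>z\<in>Z. z \<le> b" if b: "b \<in> {0..1}" "leg_y \<alpha> b \<le> 0" for b
  proof -
    have "\<exists>z. 0 \<le> z \<and> z \<le> b \<and> leg_y \<alpha> z = 0"
      by (rule IVT2') (use b leg_y_0 in \<open>auto intro: continuous_on_subset[OF leg_y_cont]\<close>)
    then show ?thesis using b by (auto simp: Z_def)
  qed
  have "closed Z"
    unfolding Z_def by (rule continuous_closed_preimage_constant[OF leg_y_cont]) simp
  moreover have "Z \<noteq> {}" using zero[OF x] neg by auto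
  moreover have bb: "bdd_below Z" by (auto simp: Z_def)
  ultimately have "Inf Z \<in> Z" by (intro closed_contains_Inf)
  define x0 where "x0 = Inf Z"
  have x0: "x0 \<in> {0..1}" "leg_y \<alpha> x0 = 0" using \<open>Inf Z \<in> Z\<close> by (auto simp: x0_def Z_def)
  have x0p: "0 < x0" using x0 leg_y_0[of \<alpha>] by (cases "x0 = 0") auto
  have pos: "0 < leg_y \<alpha> t" if "0 \<le> t" "t < x0" for t
  proof (rule ccontr)
    assume "\<not> 0 < leg_y \<alpha> t"
    moreover have "t \<in> {0..1}" using that x0(1) by auto
    ultimately obtain z where "z \<in> Z" "z \<le> t" using zero[of t] by (meson not_less)
    then have "x0 \<le> t" unfolding x0_def using cInf_lower[OF _ bb] by force
    with that show False by simp
  qed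
  define f where "f t = (if t \<le> x0 then leg_y \<alpha> t else 0)" for t
  define g where "g t = (if t \<le> x0 then leg_y' \<alpha> t else 0)" for t
  have dcut: "((\<lambda>t. if t \<le> x0 then F t else 0) has_real_derivative (if t \<le> x0 then F' t else 0)) (at t)"
    if F: "(F has_real_derivative F' t) (at t)" and t: "t \<noteq> x0" for F F' :: "real \<Rightarrow> real" and t
  proof (cases "t < x0")
    case True
    have "((\<lambda>t. if t \<le> x0 then F t else 0) has_real_derivative F' t) (at t)"
      by (rule has_field_derivative_transform_within_open[OF F, where S="{..<x0}"]) (use True in auto)
    with True show ?thesis by simp
  next
    case False
    have "((\<lambda>t. if t \<le> x0 then F t else 0) has_real_derivative 0) (at t)"
      by (rule has_field_derivative_transform_within_open[where S="{x0<..}" and f="\<lambda>_. 0"]) (use False t in auto)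
    with False t show ?thesis by simp
  qed
  have ccut: "continuous_on {0..1} (\<lambda>t. if t \<le> x0 then F t else 0)"
    if F: "continuous_on {0..1} F" "F x0 = 0" for F :: "real \<Rightarrow> real"
  proof -
    have "continuous_on ({0..x0} \<union> {x0..1}) (\<lambda>t. if t \<le> x0 then F t else 0)"
      by (rule continuous_on_If) (use F x0 in \<open>auto intro: continuous_on_subset\<close>)
    moreover have "{0..x0} \<union> {x0..1} = {0..1}" using x0 by auto
    ultimately show ?thesis by simp
  qed
  have pwf: "pw_C1 f g"
    unfolding pw_C1_def
  proof (intro conjI)
    show "continuous_on {0..1} f" unfolding f_def[abs_def] by (rule ccut[OF leg_y_cont x0(2)])
    have "(\<lambda>t. indicator {..x0} t * (indicator {0<..<1} t * leg_y' \<alpha> t)) \<in> borel_measurable borel"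
      by (rule borel_measurable_times[OF _ indicator_continuous_measurable[OF leg_y'_cont]]) simp
    moreover have "(\<lambda>t. indicator {..x0} t * (indicator {0<..<1} t * leg_y' \<alpha> t)) = (\<lambda>t. indicator {0<..<1} t * g t)"
      by (auto simp: g_def indicator_def fun_eq_iff)
    ultimately show "(\<lambda>t. indicator {0<..<1} t * g t) \<in> borel_measurable borel" by simp
    obtain K where K: "\<And>t. t \<in> {0..1} \<Longrightarrow> \<bar>leg_y' \<alpha> t\<bar> \<le> K" using continuous_bounded_01[OF leg_y'_cont] by blast
    have "\<bar>g t\<bar> \<le> K" if "t \<in> {0<..<1}" for t
      using K[of t] that by (auto simp: g_def)
    then show "\<exists>K. \<forall>t\<in>{0<..<1}. \<bar>g t\<bar> \<le> K" by blast
    show "\<exists>S. finite S \<and> (\<forall>t\<in>{0<..<1} - S. (f has_real_derivative g t) (at t))"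
      unfolding f_def[abs_def] g_def
      by (intro exI[of _ "{x0}"] conjI ballI dcut leg_y_deriv) auto
  qed
  note L = pw_C1_L2[OF pwf]
  have L1: "(\<lambda>x. 1) \<in> L2_01" "(\<lambda>x. 0) \<in> L2_01" by (rule const_L2)+
  have f1: "f 1 = 0" using x0 by (auto simp: f_def)
  \<comment> \<open>The primitive w y' y vanishes at 0 with the weight and at x0 with y.\<close>
  have Q: "energy \<alpha> coth_half f g = 0"
  proof -
    define F where "F t = (if t \<le> x0 then wt coth_half t * leg_y' \<alpha> t * leg_y \<alpha> t else 0)" for t
    have d0: "((\<lambda>t. wt coth_half t * leg_y' \<alpha> t * leg_y \<alpha> t) has_real_derivative
        wt coth_half t * (\<alpha> * (leg_y \<alpha> t)\<^sup>2 + (leg_y' \<alpha> t)\<^sup>2)) (at t)" if "t \<in> {0..1}" for t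
      using DERIV_mult[OF leg_flux_deriv[OF that] leg_y_deriv[OF that], of \<alpha> \<alpha>]
      by (simp add: algebra_simps power2_eq_square)
    have "energy \<alpha> coth_half f g = (LBINT x:{0<..<1}. wt coth_half x * (\<alpha> * (f x)\<^sup>2 + (g x)\<^sup>2))" by (rule energy_wt)
    also have "\<dots> = F 1 - F 0"
    proof (rule set_integral_FTC_finite[where S="{x0}"])
      show "continuous_on {0..1} F" unfolding F_def[abs_def]
        by (rule ccut) (auto intro!: continuous_at_imp_continuous_on DERIV_isCont[OF d0] simp: x0)
      show "(F has_real_derivative wt coth_half t * (\<alpha> * (f t)\<^sup>2 + (g t)\<^sup>2)) (at t)"
        if t: "0 < t" "t < 1" "t \<notin> {x0}" for t
      proof -
        have "(F has_real_derivative (if t \<le> x0 then wt coth_half t * (\<alpha> * (leg_y \<alpha> t)\<^sup>2 + (leg_y' \<alpha> t)\<^sup>2) else 0)) (at t)"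
          unfolding F_def[abs_def] using t by (intro dcut d0) auto
        then show ?thesis by (cases "t \<le> x0") (simp_all add: f_def g_def)
      qed
      have "set_integrable lborel {0<..<1} (\<lambda>x. \<alpha> * (wt coth_half x * (f x * f x)) + wt coth_half x * (g x * g x))"
        using L by (intro set_integral_add(1) set_integrable_mult_right wt_L2_integrable) auto
      then show "set_integrable lborel {0<..<1} (\<lambda>x. wt coth_half x * (\<alpha> * (f x)\<^sup>2 + (g x)\<^sup>2))"
        by (simp add: algebra_simps power2_eq_square)
    qed simp
    also have "\<dots> = 0" using x0 by (auto simp: F_def wt_coth_half_0)
    finally show ?thesis .
  qed
  define m where "m = (LBINT x:{0<..<1}. wt coth_half x * f x)"
  have "set_integrable lborel {0<..<1} (\<lambda>x. wt coth_half x * f x)"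
    using wt_L2_integrable[OF conjunct1[OF L] L1(1), of coth_half] by simp
  then have m: "0 < m"
    unfolding m_def
  proof (rule set_integral_pos[of _ x0])
    show "0 < x0" "x0 \<le> 1" using x0p x0 by auto
    show "0 < wt coth_half t * f t" if "0 < t" "t < x0" for t
      using pos[of t] that x0 wt_pos[of coth_half t] coth_half_gt_1 by (simp add: f_def)
    show "0 \<le> wt coth_half t * f t" if "0 < t" "t < 1" for t
      using pos[of t] that x0 wt_pos[of coth_half t] coth_half_gt_1
      by (cases "t < x0"; cases "t = x0") (simp_all add: f_def)
  qed
  have "\<alpha> - coth_half\<^sup>2 \<le> \<alpha> + 2 * t * (\<alpha> * m)" for t
  proof -
    have pw: "pw_C1 (\<lambda>x. 1 + t * f x) (\<lambda>x. 0 + t * g x)" by (intro pw_C1_add pw_C1_scale pw_C1_const pwf)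
    \<comment> \<open>At 0 this function has the value 1 + t, so it is no competitor and the
      degenerate endpoint has to absorb the defect.\<close>
    have "\<alpha> - coth_half\<^sup>2 \<le> energy \<alpha> coth_half (\<lambda>x. 1 + t * f x) (\<lambda>x. 0 + t * g x)"
      by (rule energy_degenerate_endpoint[OF pw]) (use adm f1 in \<open>auto simp: admissible_iff\<close>)
    also have "\<dots> = energy \<alpha> coth_half (\<lambda>x. 1) (\<lambda>x. 0)
        + 2 * t * (LBINT x:{0<..<1}. wt coth_half x * (\<alpha> * 1 * f x + 0 * g x)) + t\<^sup>2 * energy \<alpha> coth_half f g"
      using L L1 by (intro energy_expand) auto
    also have "(LBINT x:{0<..<1}. wt coth_half x * (\<alpha> * 1 * f x + 0 * g x)) = \<alpha> * m"
      unfolding m_def by (subst set_integral_mult_right[symmetric]) (simp add: mult_ac)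
    finally show ?thesis using Q energy_one by simp
  qed
  note lin = this
  \<comment> \<open>A lower bound on an affine function of t forces its slope to vanish. For
    \<alpha> = 0, however, the series is constantly 1 and has no zero.\<close>
  have "\<alpha> = 0"
  proof (rule ccontr)
    assume "\<alpha> \<noteq> 0"
    then have "\<alpha> * m \<noteq> 0" using m by simp
    then have "2 * ((- (coth_half\<^sup>2) - 1) / (2 * (\<alpha> * m))) * (\<alpha> * m) = - (coth_half\<^sup>2) - 1" by simp
    with lin[of "(- (coth_half\<^sup>2) - 1) / (2 * (\<alpha> * m))"] show False by linarith
  qed
  then show False using neg by (simp add: leg_y_def leg_0)
qed

section \<open>Agreement with the Legendre function of complex degree\<close>

lemma legendre_fps_complex:
  "legendre_fps (complex_of_real a) = Abs_fps (\<lambda>n. of_real (fps_nth (legendre_fps a) n))"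
  by (rule fps_ext) (simp add: legendre_fps_def)

text \<open>The Pochhammer factors pair up as (j - \<nu>) (j + \<nu> + 1) = j (j + 1) - \<nu> (\<nu>
  + 1).\<close>

lemma fps_hypergeo_legendre:
  assumes "\<nu> * (\<nu> + 1) = a"
  shows "fps_hypergeo [- \<nu>, \<nu> + 1] [1] 1 = legendre_fps (a :: complex)"
proof (rule fps_ext)
  fix n
  have "pochhammer (- \<nu>) n * pochhammer (\<nu> + 1) n = (\<Prod>j<n. of_nat (j * (j + 1)) - a)"
    unfolding pochhammer_prod prod.distrib[symmetric] assms[symmetric] atLeast0LessThan
    by (intro prod.cong) (auto simp: algebra_simps)
  then show "fps_nth (fps_hypergeo [- \<nu>, \<nu> + 1] [1] 1) n = fps_nth (legendre_fps a) n"
    by (simp add: legendre_fps_def pochhammer_fact[symmetric] power2_eq_square)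
qed

lemma eval_fps_of_real:
  fixes F :: "real fps"
  assumes "ereal (norm z) < fps_conv_radius F"
  shows "eval_fps (Abs_fps (\<lambda>n. complex_of_real (fps_nth F n))) (of_real z) = of_real (eval_fps F z)"
proof -
  have "(\<lambda>n. fps_nth F n * z ^ n) sums eval_fps F z" by (rule sums_eval_fps[OF assms])
  then have "(\<lambda>n. complex_of_real (fps_nth F n * z ^ n)) sums of_real (eval_fps F z)" by (rule sums_of_real)
  then show ?thesis by (simp add: eval_fps_def sums_iff)
qed

lemma L_const_real:
  assumes "\<mu>\<^sup>2 = of_real (1/4 + \<alpha>)"
  shows "L_const \<mu> = of_real (L_real \<alpha>)"
proof -
  define z where "z = (1 - cosh 1) / (2::real)"
  define F where "F = legendre_fps \<alpha>"
  define FC where "FC = legendre_fps (complex_of_real \<alpha>)"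
  have z: "\<bar>z\<bar> < 1/2" using arg_in_disc[of 1] by (simp add: z_def)
  have FC: "FC = Abs_fps (\<lambda>n. of_real (fps_nth F n))" unfolding FC_def F_def by (rule legendre_fps_complex)
  have nu: "(- 1/2 + \<mu>) * ((- 1/2 + \<mu>) + 1) = of_real \<alpha>"
    using assms by (simp add: power2_eq_square algebra_simps)
  have lP: "legendre_P (- 1/2 + \<mu>) = (\<lambda>w. eval_fps FC ((1 - w) / 2))"
    unfolding legendre_P_def fps_hypergeo_legendre[OF nu] FC_def ..
  have zc: "(1 - cosh 1) / 2 = complex_of_real z" using cosh_complex_of_real[of 1] by (simp add: z_def)
  have rF: "ereal (norm z) < fps_conv_radius F" unfolding F_def by (rule in_legendre_disc[OF z])
  have rFC: "fps_conv_radius FC = fps_conv_radius F"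
    unfolding fps_conv_radius_def FC conv_radius_def by simp
  have v: "legendre_P (- 1/2 + \<mu>) (cosh 1) = of_real (leg \<alpha> z)"
    unfolding lP zc FC eval_fps_of_real[OF rF] by (simp add: leg_def F_def)
  have dF: "fps_deriv FC = Abs_fps (\<lambda>n. of_real (fps_nth (fps_deriv F) n))"
    unfolding FC by (rule fps_ext) simp
  have rF': "ereal (norm z) < fps_conv_radius (fps_deriv F)"
    using rF fps_conv_radius_deriv[of F] by (rule less_le_trans)
  have "(eval_fps FC has_field_derivative eval_fps (fps_deriv FC) (of_real z)) (at ((1 - cosh 1) / 2))"
    unfolding zc using rF rFC by (intro has_field_derivative_eval_fps) simp
  then have "((\<lambda>w. eval_fps FC ((1 - w) / 2)) has_field_derivative eval_fps (fps_deriv FC) (of_real z) * (- 1/2)) (at (cosh 1))"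
    by (rule DERIV_chain2) (auto intro!: derivative_eq_intros)
  then have d: "deriv (legendre_P (- 1/2 + \<mu>)) (cosh 1) = of_real (- leg' \<alpha> z / 2)"
    unfolding lP dF eval_fps_of_real[OF rF'] by (simp add: DERIV_imp_deriv leg'_def F_def)
  have e: "(exp 1 + 1)\<^sup>2 / (2 * exp 1) = cosh 1 + (1::real)"
    by (simp add: cosh_def exp_minus field_simps power2_eq_square)
  show ?thesis unfolding L_const_def v d e L_real_def z_def[symmetric] by simp
qed

section \<open>The bounds and the limit\<close>

lemma alpha_bounds_one: "alpha_bounds 1 (alpha_minus 1) (alpha_plus 1)" "alpha_minus 1 < -1"
  by (rule alpha_bounds_ex[of 1], use coth_half_gt_1 in simp_all)+

lemma alpha_bounds_coth_half:
  "alpha_bounds coth_half (alpha_minus coth_half) (alpha_plus coth_half)" "alpha_minus coth_half < -1"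
  by (rule alpha_bounds_ex[of coth_half], use coth_half_gt_1 in simp_all)+

text \<open>Strict inequality at \<alpha> would make both neighbours \<alpha> - d and \<alpha> + d
  admissible, one of them beyond the end of the admissible interval.\<close>

lemma A_le_outside:
  assumes D: "- (pi\<^sup>2) < 1/4 + \<alpha>" and out: "\<alpha> \<le> alpha_minus 1 \<or> alpha_plus 1 \<le> \<alpha>"
  shows "A_real \<alpha> \<le> \<alpha> - 1"
proof (rule ccontr)
  assume "\<not> A_real \<alpha> \<le> \<alpha> - 1"
  then have "\<alpha> - 1 < A_real \<alpha>" by simp
  then obtain d where d: "0 < d" "\<And>\<alpha>'. \<bar>\<alpha>' - \<alpha>\<bar> \<le> d \<Longrightarrow> admissible \<alpha>' 1"
    using admissible_one_nearby[OF D] by blast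
  have "admissible (\<alpha> - d) 1" "admissible (\<alpha> + d) 1" using d by auto
  then have "alpha_minus 1 \<le> \<alpha> - d" "\<alpha> + d \<le> alpha_plus 1"
    using alpha_bounds_one(1) by (auto simp: alpha_bounds_def)
  with out d show False by auto
qed

text \<open>Because coth (1/2) - 1 = 2 / (e - 1), b is the slope of the chord through (1, A) and
  (coth (1/2), L). Replacing I by this chord turns \<beta>^2 + I - \<alpha> into q = \<beta>^2 + b
  \<beta> + c, whose larger root is r.\<close>

lemma admissible_interpolated:
  assumes adm: "admissible \<alpha> coth_half" and out: "\<alpha> \<le> alpha_minus 1 \<or> alpha_plus 1 \<le> \<alpha>"
  defines "b \<equiv> (exp 1 - 1) / 2 * (L_real \<alpha> - A_real \<alpha>)"
  defines "c \<equiv> (exp 1 + 1) / 2 * A_real \<alpha> - (exp 1 - 1) / 2 * L_real \<alpha> - \<alpha>"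
  defines "r \<equiv> - b / 2 + 1/2 * sqrt (b\<^sup>2 - 4 * c)"
  shows "0 \<le> b\<^sup>2 - 4 * c" "1 \<le> r" "admissible \<alpha> r"
proof -
  define A where "A = A_real \<alpha>"
  define L where "L = L_real \<alpha>"
  define \<kappa> where "\<kappa> = coth_half"
  define e :: real where "e = exp 1"
  have e: "e > 1" by (simp add: e_def)
  have k: "\<kappa> > 1" "\<kappa> * (e - 1) = e + 1" using coth_half_gt_1 e by (simp_all add: \<kappa>_def coth_half_def e_def)
  have b: "b = (e - 1) / 2 * (L - A)" and c: "c = (e + 1) / 2 * A - (e - 1) / 2 * L - \<alpha>"
    by (simp_all add: b_def c_def L_def A_def e_def)
  note pos = leg_y_pos[OF adm]
  have EL: "L \<le> energy \<alpha> \<beta> u v" if "competitor u v" "\<bar>\<beta>\<bar> \<le> coth_half" for u v \<beta>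
    unfolding L_def by (rule energy_ge_L[OF pos that])
  have D: "- (pi\<^sup>2) < 1/4 + \<alpha>"
    by (rule D_gt_of_energy_bounded_below[of L]) (use EL coth_half_gt_1 in auto)
  \<comment> \<open>q is nonpositive at 1 because \<alpha> is not interior to the admissible
    interval of \<beta> = 1, and nonnegative at \<kappa> because \<alpha> is admissible there. This
    will place r in [1, \<kappa>], where the chord is a valid lower bound.\<close>
  have q1: "1 + b + c \<le> 0"
  proof -
    have "b + c = A - \<alpha>" unfolding b c by (simp add: field_simps)
    then show ?thesis using A_le_outside[OF D out] by (simp add: A_def)
  qed
  have bk: "b * (\<kappa> - 1) = L - A"
  proof -
    have "b * (\<kappa> - 1) = (\<kappa> * (e - 1) - (e - 1)) / 2 * (L - A)" unfolding b by (simp add: algebra_simps)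
    then show ?thesis unfolding k(2) by simp
  qed
  have "\<alpha> - \<kappa>\<^sup>2 \<le> L"
    unfolding L_def \<kappa>_def
    by (rule le_L_real) (use pos[of 1] adm in \<open>auto simp: admissible_iff\<close>)
  moreover have cA: "c = A - b - \<alpha>" unfolding b c by (simp add: field_simps)
  ultimately have qk: "0 \<le> \<kappa>\<^sup>2 + b * \<kappa> + c" using bk by (simp add: algebra_simps)
  have disc: "(2 + b)\<^sup>2 \<le> b\<^sup>2 - 4 * c" using q1 by (simp add: power2_eq_square algebra_simps)
  then show nn: "0 \<le> b\<^sup>2 - 4 * c" using zero_le_power2[of "2 + b"] by linarith
  have "\<bar>2 + b\<bar> \<le> sqrt (b\<^sup>2 - 4 * c)" using real_sqrt_le_mono[OF disc] by simp
  then show r1: "1 \<le> r" by (simp add: r_def)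
  \<comment> \<open>The product is q(\<kappa>) - q(1); the sign of its second factor selects the
    larger root when the discriminant is compared with (2 \<kappa> + b)^2.\<close>
  have "0 \<le> (\<kappa> - 1) * (\<kappa> + 1 + b)" using qk q1 by (simp add: power2_eq_square algebra_simps)
  then have "0 \<le> \<kappa> + 1 + b" using k(1) by (simp add: zero_le_mult_iff)
  then have kb: "0 \<le> 2 * \<kappa> + b" using k(1) by simp
  have "b\<^sup>2 - 4 * c \<le> (2 * \<kappa> + b)\<^sup>2" using qk by (simp add: power2_eq_square algebra_simps)
  then have "sqrt (b\<^sup>2 - 4 * c) \<le> 2 * \<kappa> + b" using kb by (rule real_le_lsqrt[rotated])
  then have rk: "r \<le> \<kappa>" by (simp add: r_def)
  have "2 * r + b = sqrt (b\<^sup>2 - 4 * c)" by (simp add: r_def)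
  then have "(2 * r + b)\<^sup>2 = b\<^sup>2 - 4 * c" using nn by simp
  then have qr: "r\<^sup>2 + b * r + c = 0" by (simp add: power2_eq_square algebra_simps)
  define t where "t = (r - 1) / (\<kappa> - 1)"
  have t: "0 \<le> t" "t \<le> 1" using r1 rk k(1) by (simp_all add: t_def)
  have tk: "t * (\<kappa> - 1) = r - 1" using k(1) by (simp add: t_def)
  then have rt: "(1 - t) * 1 + t * \<kappa> = r" by (simp add: algebra_simps)
  show "admissible \<alpha> r"
    unfolding admissible_iff
  proof (intro allI impI)
    fix u v assume uv: "competitor u v"
    have "\<alpha> - r\<^sup>2 = A + (r - 1) * b" using qr cA by (simp add: algebra_simps)
    also have "\<dots> = (1 - t) * A + t * L"
    proof -
      have "(r - 1) * b = t * (b * (\<kappa> - 1))" unfolding tk[symmetric] by simp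
      then show ?thesis unfolding bk by (simp add: algebra_simps)
    qed
    also have "\<dots> \<le> (1 - t) * energy \<alpha> 1 u v + t * energy \<alpha> \<kappa> u v"
      using t energy_ge_A[OF refl D uv, of 1] EL[OF uv, of \<kappa>] k(1)
      by (intro add_mono mult_left_mono) (simp_all add: A_def \<kappa>_def)
    also have "\<dots> = energy \<alpha> r u v"
      using energy_convex_beta[of u v \<alpha> t 1 \<kappa>] uv unfolding rt by (simp add: competitor_def)
    finally show "\<alpha> - r\<^sup>2 \<le> energy \<alpha> r u v" .
  qed
qed

section \<open>Numerical values at \<alpha> = -1\<close>

lemma taylor_bounds:
  defines "\<omega> \<equiv> sqrt 3 / 2"
  shows "0.647843 \<le> cos \<omega>" "cos \<omega> \<le> 0.64786" "0.879602 * \<omega> \<le> sin \<omega>" "sin \<omega> \<le> 0.879606 * \<omega>"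
proof -
  \<comment> \<open>Even powers are rational and odd powers are rational multiples of \<omega>, so
    the Taylor polynomials are evaluated exactly.\<close>
  have w2: "\<omega> * \<omega> = 3/4" by (simp add: \<omega>_def)
  have w0: "0 < \<omega>" by (simp add: \<omega>_def)
  have p: "\<omega>^2 = 3/4" "\<omega>^3 = 3/4 * \<omega>" "\<omega>^4 = 9/16" "\<omega>^5 = 9/16 * \<omega>" "\<omega>^6 = 27/64" "\<omega>^7 = 27/64 * \<omega>"
    "\<omega>^8 = 81/256" "\<omega>^9 = 81/256 * \<omega>"
    by (simp_all add: power_numeral_reduce w2 flip: mult.assoc)
  obtain t where t: "cos \<omega> = (\<Sum>m<8. cos_coeff m * \<omega> ^ m) + (cos (t + 1/2 * real 8 * pi) / fact 8) * \<omega> ^ 8"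
    using Maclaurin_cos_expansion[of \<omega> 8] by blast
  have "\<bar>cos \<omega> - (1 - 3/8 + 9/384 - 27/46080)\<bar> \<le> 81/256/40320"
  proof -
    have s: "(\<Sum>m<8. cos_coeff m * \<omega> ^ m) = 1 - 3/8 + 9/384 - 27/46080"
      by (simp add: lessThan_nat_numeral cos_coeff_def p fact_numeral)
    have "\<bar>cos (t + 1/2 * real 8 * pi) / fact 8 * \<omega> ^ 8\<bar> = \<bar>cos (t + 1/2 * real 8 * pi)\<bar> * (81/256/40320)"
      by (simp add: abs_mult p fact_numeral)
    also have "\<dots> \<le> 1 * (81/256/40320)" by (intro mult_right_mono) auto
    finally show ?thesis using t s by simp
  qed
  then show "0.647843 \<le> cos \<omega>" "cos \<omega> \<le> 0.64786" unfolding abs_le_iff by simp_all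
  have "\<bar>sin \<omega> - (\<Sum>m<9. sin_coeff m * \<omega> ^ m)\<bar> \<le> inverse (fact 9) * \<bar>\<omega>\<bar> ^ 9"
    by (rule Maclaurin_sin_bound)
  moreover have "(\<Sum>m<9. sin_coeff m * \<omega> ^ m) = \<omega> * (1 - 1/8 + 9/1920 - 27/322560)"
    by (simp add: lessThan_nat_numeral sin_coeff_def p fact_numeral algebra_simps)
  moreover have "inverse (fact 9) * \<bar>\<omega>\<bar> ^ 9 = 81/256/362880 * \<omega>" using w0 by (simp add: p fact_numeral)
  ultimately show "0.879602 * \<omega> \<le> sin \<omega>" "sin \<omega> \<le> 0.879606 * \<omega>" using w0 by (simp_all add: abs_le_iff)
qed

lemma exp_bounds:
  "2.718281 \<le> exp (1::real)" "exp (1::real) \<le> 2.718282" "1.64872 \<le> exp (1/2::real)" "exp (1/2::real) \<le> 1.64873"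
proof -
  have "\<bar>exp 1 - 5837465777 / 2147483648\<bar> \<le> (1 / 4294967296 :: real)" using e_approx_32 by simp
  then show e: "2.718281 \<le> exp (1::real)" "exp (1::real) \<le> 2.718282" unfolding abs_le_iff by simp_all
  have "1.64872\<^sup>2 \<le> (exp (1/2::real))\<^sup>2" "(exp (1/2::real))\<^sup>2 \<le> 1.64873\<^sup>2"
    unfolding exp_half_square[symmetric] by (rule order_trans[OF _ e(1)] order_trans[OF e(2)], simp add: power2_eq_square)+
  note sq = this
  show "1.64872 \<le> exp (1/2::real)" using sq(1) by (rule power2_le_imp_le) simp
  show "exp (1/2::real) \<le> 1.64873" using sq(2) by (rule power2_le_imp_le) simp
qed

text \<open>The radicand \<alpha> - A at \<alpha> = -1, where \<mu> is i sqrt 3 / 2.\<close>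

definition R_sq :: real where
  "R_sq = sqrt 3 * (1 - cosh (1/2) * cos (sqrt 3 / 2)) / (2 * sinh (1/2) * sin (sqrt 3 / 2)) - 1/2"

lemma R_sq_bounds: "0.296\<^sup>2 \<le> R_sq" "R_sq < 0.297\<^sup>2"
proof -
  define \<omega> where "\<omega> = sqrt 3 / 2"
  define c where "c = cos \<omega>"
  define s where "s = sin \<omega> / \<omega>"
  define e :: real where "e = exp 1"
  define E :: real where "E = exp (1/2)"
  have w0: "0 < \<omega>" by (simp add: \<omega>_def)
  have c: "0.647843 \<le> c" "c \<le> 0.64786" using taylor_bounds unfolding c_def \<omega>_def by auto
  have s: "0.879602 \<le> s" "s \<le> 0.879606"
    using taylor_bounds(3,4) w0 unfolding s_def \<omega>_def[symmetric] by (simp_all add: field_simps)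
  have e: "2.718281 \<le> e" "e \<le> 2.718282" and E: "1.64872 \<le> E" "E \<le> 1.64873"
    using exp_bounds unfolding e_def E_def by auto
  have h: "cosh (1/2) = (e + 1) / (2 * E)" "sinh (1/2) = (e - 1) / (2 * E)"
    using two_sinh_half E unfolding e_def[symmetric] E_def[symmetric] by (simp_all add: field_simps)
  have "R_sq = 2 * \<omega> * (1 - cosh (1/2) * c) / (2 * sinh (1/2) * (s * \<omega>)) - 1/2"
    using w0 by (simp add: R_sq_def c_def s_def \<omega>_def)
  also have "\<dots> = (1 - (e + 1) / (2 * E) * c) / ((e - 1) / (2 * E) * s) - 1/2"
  proof -
    have "2 * w * a / (2 * h * (t * w)) = a / (h * t)" if "0 < w" for w a h t :: real using that by simp
    then show ?thesis unfolding h[symmetric] by (simp only: w0)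
  qed
  also have "\<dots> = (2 * E - (e + 1) * c) / ((e - 1) * s) - 1/2"
    using E e s by (simp add: field_simps)
  finally have R: "R_sq = (2 * E - (e + 1) * c) / ((e - 1) * s) - 1/2" .
  have sq: "0.296\<^sup>2 = (0.587616 - 1/2 :: real)" "0.297\<^sup>2 = (0.588209 - 1/2 :: real)"
    by (simp_all add: power2_eq_square)
  have es: "1.718281 * 0.879602 \<le> (e - 1) * s" "(e - 1) * s \<le> 1.718282 * 0.879606"
    by (rule mult_mono; use e s in simp)+
  have ec: "3.718281 * 0.647843 \<le> (e + 1) * c" "(e + 1) * c \<le> 3.718282 * 0.64786"
    by (rule mult_mono; use e c in simp)+
  have "0.587616 * ((e - 1) * s) \<le> 2 * E - (e + 1) * c" using es ec E by simp
  then have "0.587616 \<le> (2 * E - (e + 1) * c) / ((e - 1) * s)" using es by (simp add: pos_le_divide_eq)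
  then show "0.296\<^sup>2 \<le> R_sq" unfolding R sq by (rule diff_right_mono)
  have "2 * E - (e + 1) * c < 0.588209 * ((e - 1) * s)" using es ec E by simp
  then have "(2 * E - (e + 1) * c) / ((e - 1) * s) < 0.588209" using es by (simp add: pos_divide_less_eq)
  then show "R_sq < 0.297\<^sup>2" unfolding R sq by (rule diff_strict_right_mono)
qed

lemma A_real_minus_one: "- 1 - A_real (- 1) = R_sq"
proof -
  have D: "1/4 + (- 1) = - ((sqrt 3 / 2)\<^sup>2)" by (simp add: power_divide)
  have "- 1 - ((a - 1) / (h * (s / (q / 2))) - 1/2) = q * (1 - a) / (2 * h * s) - 1/2" for a h s q :: real
  proof -
    have "(a - 1) / (h * (s / (q / 2))) = q * (a - 1) / (2 * h * s)" by (simp add: mult_ac)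
    moreover have "q * (1 - a) / (2 * h * s) = - (q * (a - 1) / (2 * h * s))"
      unfolding minus_divide_left by (rule arg_cong[where f="\<lambda>z. z / _"]) (simp add: algebra_simps)
    ultimately show ?thesis by simp
  qed
  then show ?thesis
    unfolding A_real_def R_sq_def D by (subst S_fn_square, simp, subst S_fn_square, simp, simp only: mult_1_right)
qed

section \<open>Continuity of the critical value at \<alpha> = -1\<close>

lemma D_gt_minus_one: "- (pi\<^sup>2) < 1/4 + (- 1 :: real)"
  using admissible_one_D[of "-1"] alpha_bounds_one by (auto simp: alpha_bounds_def)

text \<open>The energy at \<beta> is compared with the chord between the bounds -1 - b0^2 at b0 and
  -1 - \<open>R_sq\<close> at 1. The gain over -1 - \<beta>^2 is c, whose leading term in t is
  positive if 2 b0 - b0^2 > \<open>R_sq\<close>.\<close>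

lemma admissible_right_strict:
  assumes adm: "admissible (- 1) b0" and b0: "1/20 \<le> b0" "b0 < \<beta>" and b1: "\<beta> \<le> 1"
  obtains c where "0 < c" "\<And>u v. competitor u v \<Longrightarrow> - 1 - \<beta>\<^sup>2 + c \<le> energy (- 1) \<beta> u v"
proof -
  define t where "t = (\<beta> - b0) / (1 - b0)"
  have t: "0 < t" "t \<le> 1" using b0 b1 by (auto simp: t_def)
  have "t * (1 - b0) = \<beta> - b0" using b0 b1 by (simp add: t_def)
  then have bt: "(1 - t) * b0 + t * 1 = \<beta>" by (simp add: algebra_simps)
  define c where "c = t * (2 * b0 - b0\<^sup>2 - R_sq) + t\<^sup>2 * (1 - b0)\<^sup>2"
  \<comment> \<open>The numbers 1/20 and 39/20 are the solutions of 2 b - b^2 = 39/400, a value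
    larger than \<open>R_sq\<close>.\<close>
  have "0 \<le> (b0 - 1/20) * (39/20 - b0)" using b0 b1 by (intro mult_nonneg_nonneg) auto
  moreover have "(b0 - 1/20) * (39/20 - b0) = 2 * b0 - b0\<^sup>2 - 39/400" by (simp add: power2_eq_square field_simps)
  ultimately have "39/400 \<le> 2 * b0 - b0\<^sup>2" by linarith
  then have "0 < 2 * b0 - b0\<^sup>2 - R_sq" using R_sq_bounds by (simp add: power2_eq_square)
  then have "0 < t * (2 * b0 - b0\<^sup>2 - R_sq)" using t by simp
  then have c0: "0 < c" unfolding c_def by (intro add_pos_nonneg) auto
  show thesis
  proof (rule that[OF c0])
    fix u v assume uv: "competitor u v"
    have "- 1 - \<beta>\<^sup>2 + c = (1 - t) * (- 1 - b0\<^sup>2) + t * (- 1 - R_sq)"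
      unfolding bt[symmetric] c_def by (simp add: power2_eq_square algebra_simps)
    also have "\<dots> \<le> (1 - t) * energy (- 1) b0 u v + t * energy (- 1) 1 u v"
      using t adm uv energy_ge_A[OF refl D_gt_minus_one uv, of 1] A_real_minus_one
      by (intro add_mono mult_left_mono) (auto simp: admissible_iff)
    also have "\<dots> = energy (- 1) \<beta> u v"
      using energy_convex_beta[of u v "- 1" t b0 1] uv unfolding bt by (simp add: competitor_def)
    finally show "- 1 - \<beta>\<^sup>2 + c \<le> energy (- 1) \<beta> u v" .
  qed
qed

text \<open>The competitor 1 + (3/20) x (1 - x) has energy at most -1 - 9/400: its linear
  coefficient is at least 3/20 in size and its quadratic one at most 1, so 3/20 is also the natural
  amplitude. Admissibility would force b^2 \<ge> 9/400, but b^2 is below 1/400.\<close>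

lemma not_admissible_small:
  assumes b: "0 \<le> b" "b < 1/20"
  shows "\<not> admissible (- 1) b"
proof
  assume adm: "admissible (- 1) b"
  let ?f = "\<lambda>x::real. x * (1 - x)" and ?g = "\<lambda>x::real. 1 - 2 * x"
  note L = pw_C1_L2[OF bump_pw_C1]
  have L1: "(\<lambda>x. 1) \<in> L2_01" "(\<lambda>x. 0) \<in> L2_01" by (rule const_L2)+
  have bc: "\<bar>b\<bar> \<le> coth_half" using b coth_half_gt_1 by simp
  \<comment> \<open>The constant 1 / (2 sinh (1/2)) is about 0.96, and the term with b costs at most
    1/40. Since x (1 - x) integrates to 1/6, this yields the linear coefficient 3/20.\<close>
  have w: "9/10 \<le> wt b x" if "x \<in> {0<..<1}" for x
  proof -
    have s: "0 < sinh (1/2::real)" by simp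
    have "2 * sinh (1/2::real) \<le> 10423 / 10000"
    proof -
      have "(exp 1 - 1) / exp (1/2) \<le> (1.718282 / 1.64872 :: real)"
        using exp_bounds by (intro frac_le) auto
      also have "\<dots> \<le> 10423 / 10000" by simp
      finally show ?thesis unfolding two_sinh_half .
    qed
    moreover have "- sinh (1/2) \<le> sinh (x - 1/2)"
      using that sinh_real_le_iff[of "- (1/2)" "x - 1/2"] by (simp only: sinh_minus) simp
    then have "b * (- sinh (1/2)) \<le> b * sinh (x - 1/2)" using b by (intro mult_left_mono)
    moreover have "b * sinh (1/2) \<le> 1/20 * sinh (1/2)" using b s by (intro mult_right_mono) auto
    ultimately have "9/10 * (2 * sinh (1/2)) \<le> cosh (x - 1/2) + b * sinh (x - 1/2)"
      using cosh_real_ge_1[of "x - 1/2"] by linarith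
    then show ?thesis unfolding wt_def using s by (simp add: pos_le_divide_eq)
  qed
  have im: "set_integrable lborel {0<..<1} (\<lambda>x. wt b x * ?f x)"
    using wt_L2_integrable[OF conjunct1[OF L] L1(1), of b] by simp
  have cf: "continuous_on {0..1} (\<lambda>x. 9/10 * ?f x)" by (intro continuous_intros)
  have ip: "set_integrable lborel {0<..<1} (\<lambda>x. 9/10 * ?f x)" by (rule set_integrable_L2[OF continuous_L2[OF cf]])
  have "(LBINT x:{0<..<1}. 9/10 * ?f x) = 9/10 * (1\<^sup>2 / 2 - 1^3 / 3) - 9/10 * (0\<^sup>2 / 2 - 0^3 / 3)"
    by (rule set_integral_FTC_finite[where S="{}", OF _ _ _ ip])
      (auto intro!: derivative_eq_intros continuous_intros simp: power2_eq_square algebra_simps)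
  moreover have "(LBINT x:{0<..<1}. 9/10 * ?f x) \<le> (LBINT x:{0<..<1}. wt b x * ?f x)"
    by (rule set_integral_mono[OF ip im], rule mult_right_mono[OF w]) auto
  ultimately have m: "3/20 \<le> (LBINT x:{0<..<1}. wt b x * ?f x)" by simp
  have iq: "set_integrable lborel {0<..<1} (\<lambda>x. wt b x * (- 1 * (?f x)\<^sup>2 + (?g x)\<^sup>2))"
  proof -
    have "set_integrable lborel {0<..<1} (\<lambda>x. - 1 * (wt b x * (?f x * ?f x)) + wt b x * (?g x * ?g x))"
      using L by (intro set_integral_add(1) set_integrable_mult_right wt_L2_integrable) auto
    then show ?thesis by (simp add: algebra_simps power2_eq_square)
  qed
  have i1: "set_integrable lborel {0<..<1} (wt b)" using wt_L2_integrable[OF L1(1) L1(1), of b] by simp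
  have "energy (- 1) b ?f ?g \<le> (LBINT x:{0<..<1}. wt b x)"
    unfolding energy_wt
  proof (rule set_integral_mono[OF iq i1])
    fix x :: real assume x: "x \<in> {0<..<1}"
    have "\<bar>?g x\<bar> \<le> 1" using x unfolding abs_le_iff by auto
    then have "(?g x)\<^sup>2 \<le> 1" by (simp add: abs_square_le_1)
    then have "- 1 * (?f x)\<^sup>2 + (?g x)\<^sup>2 \<le> 1" using zero_le_power2[of "?f x"] by linarith
    then show "wt b x * (- 1 * (?f x)\<^sup>2 + (?g x)\<^sup>2) \<le> wt b x" using w[OF x] by (intro mult_left_le) auto
  qed
  also have "\<dots> = 1" using energy_one[of 1 b] by (simp add: energy_wt)
  finally have Q: "energy (- 1) b ?f ?g \<le> 1" .
  have "pw_C1 (\<lambda>x. 1 + 3/20 * ?f x) (\<lambda>x. 0 + 3/20 * ?g x)" by (intro pw_C1_add pw_C1_scale pw_C1_const bump_pw_C1)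
  then have "competitor (\<lambda>x. 1 + 3/20 * ?f x) (\<lambda>x. 0 + 3/20 * ?g x)" by (rule pw_C1_competitor) auto
  then have "- 1 - b\<^sup>2 \<le> energy (- 1) b (\<lambda>x. 1 + 3/20 * ?f x) (\<lambda>x. 0 + 3/20 * ?g x)"
    using adm unfolding admissible_iff by blast
  also have "\<dots> = energy (- 1) b (\<lambda>x. 1) (\<lambda>x. 0)
      + 2 * (3/20) * (LBINT x:{0<..<1}. wt b x * (- 1 * 1 * ?f x + 0 * ?g x)) + (3/20)\<^sup>2 * energy (- 1) b ?f ?g"
    using L L1 by (intro energy_expand) auto
  also have "(LBINT x:{0<..<1}. wt b x * (- 1 * 1 * ?f x + 0 * ?g x)) = - (LBINT x:{0<..<1}. wt b x * ?f x)"
    by (subst set_integral_uminus[symmetric, OF im]) simp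
  finally have "9/400 \<le> b\<^sup>2" using m Q energy_one[of "- 1" b] by (simp add: power2_eq_square)
  moreover have "b\<^sup>2 \<le> (1/20)\<^sup>2" using b by (intro power_mono) auto
  ultimately show False by (simp add: power2_eq_square)
qed

text \<open>Every single competitor gives a polynomial inequality in the two parameters.\<close>

lemma closed_admissible: "closed {p. admissible (fst p) (snd p)}"
proof -
  have "closed {p. fst p - (snd p)\<^sup>2 \<le> energy (fst p) (snd p) u v}" if uv: "competitor u v" for u v
  proof -
    have "H1_deriv u v" using uv by (simp add: competitor_def)
    from energy_bilinear[OF this] obtain U0 U1 V0 V1
      where e: "\<And>\<alpha> \<beta>. energy \<alpha> \<beta> u v = \<alpha> * (U0 + \<beta> * U1) + (V0 + \<beta> * V1)" by blast
    show ?thesis unfolding e by (intro closed_Collect_le continuous_intros)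
  qed
  moreover have "{p. admissible (fst p) (snd p)}
      = (\<Inter>(u,v)\<in>{(u,v). competitor u v}. {p. fst p - (snd p)\<^sup>2 \<le> energy (fst p) (snd p) u v})"
    unfolding admissible_iff by auto
  ultimately show ?thesis by (auto intro!: closed_INT)
qed

text \<open>The critical value formally belonging to \<gamma> = \<infinity>, as a real
  number.\<close>

definition beta_inf :: real where "beta_inf = Inf {\<beta>. 0 \<le> \<beta> \<and> admissible (- 1) \<beta>}"

lemma beta_inf_props:
  shows "admissible (- 1) beta_inf" "1/20 \<le> beta_inf" "beta_inf \<le> sqrt R_sq" "beta_inf < 1"
    and "\<And>\<beta>. 0 \<le> \<beta> \<Longrightarrow> admissible (- 1) \<beta> \<Longrightarrow> beta_inf \<le> \<beta>"
proof -
  let ?S = "{\<beta>. 0 \<le> \<beta> \<and> admissible (- 1) \<beta>}"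
  have adm1: "admissible (- 1) 1" using alpha_bounds_one by (auto simp: alpha_bounds_def)
  have RS: "sqrt R_sq \<in> ?S"
    using admissible_sqrt[OF adm1] unfolding A_real_minus_one by simp
  have bdd: "bdd_below ?S" by (rule bdd_belowI[of _ 0]) auto
  have "closed {\<beta>. admissible (- 1) \<beta>}"
    using continuous_closed_vimage[OF closed_admissible, of "\<lambda>\<beta>. (- 1, \<beta>)"]
    by (simp add: vimage_def continuous_Pair)
  moreover have "?S = {0..} \<inter> {\<beta>. admissible (- 1) \<beta>}" by auto
  ultimately have "closed ?S" by (simp add: closed_Int)
  moreover have "?S \<noteq> {}" using RS by blast
  ultimately have "beta_inf \<in> ?S" unfolding beta_inf_def using bdd by (intro closed_contains_Inf)
  then show adm: "admissible (- 1) beta_inf" and "1/20 \<le> beta_inf" using not_admissible_small[of beta_inf] by force+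
  show low: "beta_inf \<le> \<beta>" if "0 \<le> \<beta>" "admissible (- 1) \<beta>" for \<beta>
    unfolding beta_inf_def using that bdd by (intro cInf_lower) auto
  show le: "beta_inf \<le> sqrt R_sq" using low RS by simp
  have "R_sq < 1" using R_sq_bounds by (simp add: power2_eq_square)
  then have "sqrt R_sq < 1" by simp
  with le show "beta_inf < 1" by (rule le_less_trans)
qed

text \<open>Slightly to the right of \<open>beta_inf\<close> there is slack at \<alpha> = -1.
  Concavity in \<alpha> spreads it to the left with the help of \<alpha> = -21/20 and to the right
  with the help of \<alpha> = 0.\<close>

lemma beta_inf_upper:
  assumes e: "0 < \<epsilon>"
  obtains d where "0 < d" "\<And>\<alpha>. \<bar>\<alpha> + 1\<bar> < d \<Longrightarrow> \<exists>\<beta>\<ge>0. \<beta> \<le> beta_inf + \<epsilon> \<and> admissible \<alpha> \<beta>"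
proof -
  \<comment> \<open>The chord argument ends at 1, so \<beta> must not exceed it.\<close>
  define \<beta> where "\<beta> = min (beta_inf + \<epsilon>) 1"
  have b: "beta_inf < \<beta>" "\<beta> \<le> 1" "\<beta> \<le> beta_inf + \<epsilon>" "0 \<le> \<beta>"
    using e beta_inf_props(2,4) by (auto simp: \<beta>_def)
  have bc: "\<bar>\<beta>\<bar> \<le> coth_half" using b coth_half_gt_1 by simp
  have "\<exists>c>0. \<forall>u v. competitor u v \<longrightarrow> - 1 - \<beta>\<^sup>2 + c \<le> energy (- 1) \<beta> u v"
    by (rule admissible_right_strict[OF beta_inf_props(1,2) b(1,2)]) blast
  then obtain c where c: "0 < c" "\<And>u v. competitor u v \<Longrightarrow> - 1 - \<beta>\<^sup>2 + c \<le> energy (- 1) \<beta> u v" by blast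
  have ex: "\<exists>d>0. \<forall>t. 0 \<le> t \<and> t \<le> d \<longrightarrow> admissible ((1 - t) * (- 1) + t * \<alpha>1) \<beta>"
    if "\<And>u v. competitor u v \<Longrightarrow> K \<le> energy \<alpha>1 \<beta> u v" for K \<alpha>1
    by (rule admissible_nearby[OF c that], assumption+) blast
  obtain d1 where d1: "0 < d1" "\<And>t. 0 \<le> t \<Longrightarrow> t \<le> d1 \<Longrightarrow> admissible ((1 - t) * (- 1) + t * (- 21/20)) \<beta>"
    using ex[OF energy_lower_below[OF _ bc]] by blast
  obtain d2 where d2: "0 < d2" "\<And>t. 0 \<le> t \<Longrightarrow> t \<le> d2 \<Longrightarrow> admissible ((1 - t) * (- 1) + t * 0) \<beta>"
    using ex[OF energy_nonneg[OF bc order_refl]] by blast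
  show thesis
  proof (rule that[of "min (d1 / 20) d2"])
    show "0 < min (d1 / 20) d2" using d1 d2 by simp
    fix \<alpha> :: real assume a: "\<bar>\<alpha> + 1\<bar> < min (d1 / 20) d2"
    have "admissible \<alpha> \<beta>"
    proof (cases "\<alpha> \<le> - 1")
      case True
      have eq: "(1 - (- 20 * (\<alpha> + 1))) * (- 1) + (- 20 * (\<alpha> + 1)) * (- 21/20) = \<alpha>" by (simp add: algebra_simps)
      have "admissible ((1 - (- 20 * (\<alpha> + 1))) * (- 1) + (- 20 * (\<alpha> + 1)) * (- 21/20)) \<beta>"
        by (rule d1(2)) (use a True in auto)
      then show ?thesis unfolding eq .
    next
      case False
      then show ?thesis using d2(2)[of "\<alpha> + 1"] a by simp
    qed
    then show "\<exists>\<beta>\<ge>0. \<beta> \<le> beta_inf + \<epsilon> \<and> admissible \<alpha> \<beta>" using b by auto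
  qed
qed

text \<open>Compactness: the admissible pairs with \<beta> in
  [0, \<open>beta_inf\<close> - \<epsilon>] and \<alpha> in a compact neighbourhood of -1 project
  onto a closed set of \<alpha> that misses -1.\<close>

lemma beta_inf_lower:
  assumes e: "0 < \<epsilon>"
  obtains d where "0 < d" "\<And>\<alpha> \<beta>. \<bar>\<alpha> + 1\<bar> < d \<Longrightarrow> 0 \<le> \<beta> \<Longrightarrow> admissible \<alpha> \<beta> \<Longrightarrow> beta_inf - \<epsilon> < \<beta>"
proof -
  define P where "P = ({-2..0} \<times> {0..beta_inf - \<epsilon>}) \<inter> {p. admissible (fst p) (snd p)}"
  have "compact P" unfolding P_def
    by (intro compact_Int_closed compact_Times compact_Icc closed_admissible)
  then have "compact (fst ` P)" by (intro compact_continuous_image continuous_on_fst continuous_on_id)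
  then have "closed (fst ` P)" by (rule compact_imp_closed)
  moreover have "- 1 \<notin> fst ` P"
  proof
    assume "- 1 \<in> fst ` P"
    then obtain \<beta> where "0 \<le> \<beta>" "\<beta> \<le> beta_inf - \<epsilon>" "admissible (- 1) \<beta>" by (auto simp: P_def)
    then show False using beta_inf_props(5)[of \<beta>] e by simp
  qed
  ultimately obtain d where d: "0 < d" "ball (- 1) d \<subseteq> - (fst ` P)"
    by (metis ComplI closed_def openE)
  show thesis
  proof (rule that[of "min d 1"])
    show "0 < min d 1" using d by simp
    fix \<alpha> \<beta> :: real assume a: "\<bar>\<alpha> + 1\<bar> < min d 1" "0 \<le> \<beta>" "admissible \<alpha> \<beta>"
    have "\<alpha> \<in> ball (- 1) d" using a by (simp add: dist_real_def abs_minus_commute)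
    then have "\<alpha> \<notin> fst ` P" using d by blast
    moreover have "\<alpha> \<in> {-2..0}" using a by auto
    moreover have "(\<alpha>, \<beta>) \<notin> P" using calculation(1) by force
    ultimately show "beta_inf - \<epsilon> < \<beta>" using a by (auto simp: P_def)
  qed
qed

text \<open>The filter is left open because \<gamma> tending to either infinity sends \<alpha> =
  3/\<gamma> - 1 to -1; this is why both limits coincide.\<close>

lemma beta_crit_tendsto:
  assumes lim: "((\<lambda>\<gamma>. (3 - \<gamma>) / \<gamma>) \<longlongrightarrow> - 1) F"
  shows "(beta_crit \<longlongrightarrow> ereal beta_inf) F"
proof (rule order_tendstoI)
  have ev: "\<forall>\<^sub>F \<gamma> in F. \<bar>(3 - \<gamma>) / \<gamma> + 1\<bar> < d" if "0 < d" for d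
    using tendstoD[OF lim that] by (simp add: dist_real_def)
  fix a :: ereal assume "a < ereal beta_inf"
  then obtain r where r: "a < ereal r" "r < beta_inf" using ereal_dense2[of a "ereal beta_inf"] by auto
  have "\<exists>d>0. \<forall>\<alpha> \<beta>. \<bar>\<alpha> + 1\<bar> < d \<longrightarrow> 0 \<le> \<beta> \<longrightarrow> admissible \<alpha> \<beta> \<longrightarrow> beta_inf - (beta_inf - r) < \<beta>"
    by (rule beta_inf_lower[of "beta_inf - r"], use r in simp, blast)
  then obtain d where d: "0 < d"
    "\<And>\<alpha> \<beta>. \<bar>\<alpha> + 1\<bar> < d \<Longrightarrow> 0 \<le> \<beta> \<Longrightarrow> admissible \<alpha> \<beta> \<Longrightarrow> beta_inf - (beta_inf - r) < \<beta>"
    by blast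
  show "\<forall>\<^sub>F \<gamma> in F. a < beta_crit \<gamma>" using ev[OF d(1)]
  proof eventually_elim
    case (elim \<gamma>)
    have "ereal r \<le> beta_crit \<gamma>"
      unfolding beta_crit_def by (rule Inf_greatest) (use d(2)[OF elim] in \<open>auto intro: less_imp_le\<close>)
    with r show ?case by (rule_tac less_le_trans)
  qed
next
  have ev: "\<forall>\<^sub>F \<gamma> in F. \<bar>(3 - \<gamma>) / \<gamma> + 1\<bar> < d" if "0 < d" for d
    using tendstoD[OF lim that] by (simp add: dist_real_def)
  fix a :: ereal assume "ereal beta_inf < a"
  then obtain r where r: "ereal r < a" "beta_inf < r" using ereal_dense2[of "ereal beta_inf" a] by auto
  have "\<exists>d>0. \<forall>\<alpha>. \<bar>\<alpha> + 1\<bar> < d \<longrightarrow> (\<exists>\<beta>\<ge>0. \<beta> \<le> beta_inf + (r - beta_inf) \<and> admissible \<alpha> \<beta>)"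
    by (rule beta_inf_upper[of "r - beta_inf"], use r in simp, blast)
  then obtain d where d: "0 < d"
    "\<And>\<alpha>. \<bar>\<alpha> + 1\<bar> < d \<Longrightarrow> \<exists>\<beta>\<ge>0. \<beta> \<le> beta_inf + (r - beta_inf) \<and> admissible \<alpha> \<beta>"
    by blast
  show "\<forall>\<^sub>F \<gamma> in F. beta_crit \<gamma> < a" using ev[OF d(1)]
  proof eventually_elim
    case (elim \<gamma>)
    then obtain \<beta> where "0 \<le> \<beta>" "\<beta> \<le> r" "admissible ((3 - \<gamma>) / \<gamma>) \<beta>" using d(2) by force
    then have "beta_crit \<gamma> \<le> ereal r" by (meson beta_crit_le ereal_less_eq(3) order_trans)
    with r show ?case by (rule_tac le_less_trans)
  qed
qed

section \<open>From \<alpha> back to \<gamma>\<close>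

lemma gamma_le_minus:
  fixes a \<gamma> :: real
  assumes "a < - 1" "\<gamma> \<le> 3 / (1 + a)"
  shows "\<gamma> < 0" "a \<le> (3 - \<gamma>) / \<gamma>" "(3 - \<gamma>) / \<gamma> < - 1"
proof -
  have "3 / (1 + a) < 0" using assms by (simp add: divide_pos_neg)
  with assms(2) show g: "\<gamma> < 0" by (rule le_less_trans)
  then show "a \<le> (3 - \<gamma>) / \<gamma>" "(3 - \<gamma>) / \<gamma> < - 1" using assms by (simp_all add: field_simps)
qed

lemma gamma_ge_plus:
  fixes b \<gamma> :: real
  assumes "0 < b" "3 / (1 + b) \<le> \<gamma>"
  shows "0 < \<gamma>" "(3 - \<gamma>) / \<gamma> \<le> b" "- 1 < (3 - \<gamma>) / \<gamma>"
proof -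
  have "0 < 3 / (1 + b)" using assms by simp
  then show g: "0 < \<gamma>" using assms(2) by (rule less_le_trans)
  then show "(3 - \<gamma>) / \<gamma> \<le> b" "- 1 < (3 - \<gamma>) / \<gamma>" using assms by (simp_all add: field_simps)
qed

lemma gamma_ge_minus: "a < - 1 \<Longrightarrow> 3 / (1 + a) \<le> \<gamma> \<Longrightarrow> \<gamma> < 0 \<Longrightarrow> (3 - \<gamma>) / \<gamma> \<le> a" for a \<gamma> :: real
  by (simp add: field_simps)

lemma gamma_le_plus: "0 < b \<Longrightarrow> \<gamma> \<le> 3 / (1 + b) \<Longrightarrow> 0 < \<gamma> \<Longrightarrow> b \<le> (3 - \<gamma>) / \<gamma>" for b \<gamma> :: real
  by (simp add: field_simps)

text \<open>The map \<gamma> -> 3/\<gamma> - 1 decreases on each side of 0. As 1 + a < 0 < 1 + b, it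
  takes the lower half-line into [a, -1) and the upper one into (-1, b].\<close>

lemma admissible_of_gamma:
  assumes ab: "alpha_bounds \<beta> a b" and a: "a < - 1" and g: "\<gamma> \<le> 3 / (1 + a) \<or> 3 / (1 + b) \<le> \<gamma>"
  shows "\<gamma> \<noteq> 0" "admissible ((3 - \<gamma>) / \<gamma>) \<beta>"
proof -
  have b: "0 < b" using ab by (simp add: alpha_bounds_def)
  show "\<gamma> \<noteq> 0" using g gamma_le_minus(1)[OF a] gamma_ge_plus(1)[OF b] by force
  have "a \<le> (3 - \<gamma>) / \<gamma> \<and> (3 - \<gamma>) / \<gamma> \<le> b"
    using g gamma_le_minus[OF a, of \<gamma>] gamma_ge_plus[OF b, of \<gamma>] a b by linarith
  then show "admissible ((3 - \<gamma>) / \<gamma>) \<beta>" using ab by (simp add: alpha_bounds_def)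
qed

lemma mu_square:
  assumes "s\<^sup>2 = complex_of_real (1 + 4 * (3 - \<gamma>) / \<gamma>)" "\<mu> = s / 2"
  shows "\<mu>\<^sup>2 = of_real (1/4 + (3 - \<gamma>) / \<gamma>)"
  unfolding assms(2) power_divide assms(1) by (simp add: field_simps)

theorem theorem2p2:
  shows "(\<forall>\<gamma> \<in> {..gamma1_minus} \<union> {gamma1_plus..}. beta_crit \<gamma> < \<infinity>)
    \<and> (\<forall>\<gamma> \<in> {..gamma2_minus} \<union> {gamma2_plus..}. \<forall>s \<mu> :: complex.
         s\<^sup>2 = of_real (1 + 4 * (3 - \<gamma>) / \<gamma>) \<longrightarrow> \<mu> = s / 2 \<longrightarrow>
         M_const \<mu> \<in> \<real> \<and>
         0 \<le> 3 / \<gamma> - 1/2 - Re (M_const \<mu>) \<and>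
         beta_crit \<gamma> \<le> ereal (sqrt (3 / \<gamma> - 1/2 - Re (M_const \<mu>))))
    \<and> (\<forall>\<gamma> \<in> {gamma2_minus..gamma1_minus} \<union> {gamma1_plus..gamma2_plus}. \<forall>s \<mu> :: complex. \<forall>b c :: real.
         s\<^sup>2 = of_real (1 + 4 * (3 - \<gamma>) / \<gamma>) \<longrightarrow> \<mu> = s / 2 \<longrightarrow>
         b = Re (b_const \<mu>) \<longrightarrow> c = Re (c_const ((3 - \<gamma>) / \<gamma>) \<mu>) \<longrightarrow>
         b_const \<mu> \<in> \<real> \<and> c_const ((3 - \<gamma>) / \<gamma>) \<mu> \<in> \<real> \<and>
         0 \<le> b\<^sup>2 - 4 * c \<and>
         beta_crit \<gamma> \<le> ereal (- b / 2 + 1/2 * sqrt (b\<^sup>2 - 4 * c)))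
    \<and> (\<exists>B :: real.
         (beta_crit \<longlongrightarrow> ereal B) at_top \<and> (beta_crit \<longlongrightarrow> ereal B) at_bot \<and>
         B \<le> sqrt (sqrt 3 * (1 - cosh (1/2) * cos (sqrt 3 / 2)) /
                      (2 * sinh (1/2) * sin (sqrt 3 / 2)) - 1/2))
    \<and> (let R = sqrt (sqrt 3 * (1 - cosh (1/2) * cos (sqrt 3 / 2)) /
                      (2 * sinh (1/2) * sin (sqrt 3 / 2)) - 1/2) :: real
        in 0.296 \<le> R \<and> R < 0.297)"
proof (intro conjI ballI allI impI)
  note g1 = gamma1_minus_def[folded coth_half_def] gamma1_plus_def[folded coth_half_def]
  note g2 = gamma2_minus_def gamma2_plus_def
  \<comment> \<open>Both half-lines avoid \<gamma> = 0, so the value 0 of division by zero never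
    enters.\<close>
  have adm1: "\<gamma> \<noteq> 0 \<and> admissible ((3 - \<gamma>) / \<gamma>) coth_half" if "\<gamma> \<in> {..gamma1_minus} \<union> {gamma1_plus..}" for \<gamma>
    using admissible_of_gamma[OF alpha_bounds_coth_half, of \<gamma>] that unfolding g1 by auto
  have adm2: "\<gamma> \<noteq> 0 \<and> admissible ((3 - \<gamma>) / \<gamma>) 1" if "\<gamma> \<in> {..gamma2_minus} \<union> {gamma2_plus..}" for \<gamma>
    using admissible_of_gamma[OF alpha_bounds_one, of \<gamma>] that unfolding g2 by auto
  {
    fix \<gamma> assume "\<gamma> \<in> {..gamma1_minus} \<union> {gamma1_plus..}"
    then have "beta_crit \<gamma> \<le> ereal coth_half" using adm1 coth_half_gt_1 by (intro beta_crit_le) auto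
    then show "beta_crit \<gamma> < \<infinity>" by (rule le_less_trans) simp
  }
  {
    fix \<gamma> and s \<mu> :: complex
    assume g: "\<gamma> \<in> {..gamma2_minus} \<union> {gamma2_plus..}"
      and s: "s\<^sup>2 = of_real (1 + 4 * (3 - \<gamma>) / \<gamma>)" "\<mu> = s / 2"
    define \<alpha> where "\<alpha> = (3 - \<gamma>) / \<gamma>"
    have M: "M_const \<mu> = of_real (A_real \<alpha> + 1/2)"
      unfolding \<alpha>_def by (rule M_const_real[OF mu_square[OF s]])
    have g0: "\<gamma> \<noteq> 0" and adm: "admissible \<alpha> 1" using adm2[OF g] by (auto simp: \<alpha>_def)
    have eq: "3 / \<gamma> - 1/2 - Re (M_const \<mu>) = \<alpha> - A_real \<alpha>"
      unfolding M using g0 by (simp add: \<alpha>_def diff_divide_distrib)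
    show "M_const \<mu> \<in> \<real>" unfolding M by simp
    show "0 \<le> 3 / \<gamma> - 1/2 - Re (M_const \<mu>)" unfolding eq by (rule admissible_sqrt(1)[OF adm])
    show "beta_crit \<gamma> \<le> ereal (sqrt (3 / \<gamma> - 1/2 - Re (M_const \<mu>)))"
      unfolding eq using admissible_sqrt[OF adm] by (intro beta_crit_le) (auto simp: \<alpha>_def)
  }
  {
    fix \<gamma> b c :: real and s \<mu> :: complex
    assume g: "\<gamma> \<in> {gamma2_minus..gamma1_minus} \<union> {gamma1_plus..gamma2_plus}"
      and s: "s\<^sup>2 = of_real (1 + 4 * (3 - \<gamma>) / \<gamma>)" "\<mu> = s / 2"
      and bc: "b = Re (b_const \<mu>)" "c = Re (c_const ((3 - \<gamma>) / \<gamma>) \<mu>)"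
    define \<alpha> where "\<alpha> = (3 - \<gamma>) / \<gamma>"
    note mu = mu_square[OF s, folded \<alpha>_def]
    have A: "A_const \<mu> = of_real (A_real \<alpha>)" unfolding A_const_def M_const_real[OF mu] by simp
    have L: "L_const \<mu> = of_real (L_real \<alpha>)" by (rule L_const_real[OF mu])
    have b: "b_const \<mu> = of_real ((exp 1 - 1) / 2 * (L_real \<alpha> - A_real \<alpha>))"
      unfolding b_const_def A L by simp
    have c: "c_const ((3 - \<gamma>) / \<gamma>) \<mu> = of_real ((exp 1 + 1) / 2 * A_real \<alpha> - (exp 1 - 1) / 2 * L_real \<alpha> - \<alpha>)"
      unfolding c_const_def A L \<alpha>_def[symmetric] by simp
    have bc': "b = (exp 1 - 1) / 2 * (L_real \<alpha> - A_real \<alpha>)"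
      "c = (exp 1 + 1) / 2 * A_real \<alpha> - (exp 1 - 1) / 2 * L_real \<alpha> - \<alpha>"
      unfolding bc b c by (simp_all only: Re_complex_of_real)
    have adm: "admissible \<alpha> coth_half" using adm1[of \<gamma>] g by (auto simp: \<alpha>_def)
    \<comment> \<open>The sign of \<gamma> is known from the thresholds for coth (1/2); the
      thresholds for \<beta> = 1 then place \<alpha> at or beyond an end of the admissible interval
      there.\<close>
    have out: "\<alpha> \<le> alpha_minus 1 \<or> alpha_plus 1 \<le> \<alpha>"
    proof (cases "\<gamma> \<in> {gamma2_minus..gamma1_minus}")
      case True
      then have "\<gamma> < 0" using gamma_le_minus(1)[OF alpha_bounds_coth_half(2)] unfolding g1 by auto
      then have "\<alpha> \<le> alpha_minus 1"
        unfolding \<alpha>_def using True by (intro gamma_ge_minus alpha_bounds_one) (auto simp: g2)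
      then show ?thesis ..
    next
      case False
      then have *: "\<gamma> \<in> {gamma1_plus..gamma2_plus}" using g by auto
      have p: "0 < alpha_plus coth_half" "0 < alpha_plus 1"
        using alpha_bounds_coth_half alpha_bounds_one by (auto simp: alpha_bounds_def)
      have "0 < \<gamma>" using * gamma_ge_plus(1)[OF p(1)] unfolding g1 by auto
      then have "alpha_plus 1 \<le> \<alpha>"
        unfolding \<alpha>_def using * p by (intro gamma_le_plus) (auto simp: g2)
      then show ?thesis ..
    qed
    note ip = admissible_interpolated[OF adm out, folded bc']
    show "b_const \<mu> \<in> \<real>" unfolding b by (rule Reals_of_real)
    show "c_const ((3 - \<gamma>) / \<gamma>) \<mu> \<in> \<real>" unfolding c by (rule Reals_of_real)
    show "0 \<le> b\<^sup>2 - 4 * c" by (rule ip(1))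
    show "beta_crit \<gamma> \<le> ereal (- b / 2 + 1/2 * sqrt (b\<^sup>2 - 4 * c))"
      using ip by (intro beta_crit_le) (auto simp: \<alpha>_def)
  }
  have lim: "((\<lambda>\<gamma>. (3 - \<gamma>) / \<gamma>) \<longlongrightarrow> - 1) F" if F: "filterlim (\<lambda>\<gamma>. \<gamma>) at_infinity F" "\<forall>\<^sub>F \<gamma> in F. \<gamma> \<noteq> 0" for F :: "real filter"
  proof -
    have "((\<lambda>\<gamma>. 3 / \<gamma> - 1) \<longlongrightarrow> 0 - 1) F"
      by (intro tendsto_intros tendsto_divide_0[OF tendsto_const] F)
    moreover have "\<forall>\<^sub>F \<gamma> in F. 3 / \<gamma> - 1 = (3 - \<gamma>) / \<gamma>"
      using F(2) by eventually_elim (simp add: diff_divide_distrib)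
    ultimately show ?thesis by (auto elim: Lim_transform_eventually)
  qed
  have "(beta_crit \<longlongrightarrow> ereal beta_inf) at_top"
    by (intro beta_crit_tendsto lim filterlim_at_top_imp_at_infinity filterlim_ident)
      (rule eventually_mono[OF eventually_gt_at_top[of 0]], simp)
  moreover have "(beta_crit \<longlongrightarrow> ereal beta_inf) at_bot"
    by (intro beta_crit_tendsto lim filterlim_at_bot_imp_at_infinity filterlim_ident)
      (rule eventually_mono[OF eventually_le_at_bot[of "-1"]], simp)
  ultimately show "\<exists>B :: real. (beta_crit \<longlongrightarrow> ereal B) at_top \<and> (beta_crit \<longlongrightarrow> ereal B) at_bot \<and>
         B \<le> sqrt (sqrt 3 * (1 - cosh (1/2) * cos (sqrt 3 / 2)) / (2 * sinh (1/2) * sin (sqrt 3 / 2)) - 1/2)"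
    using beta_inf_props(3) unfolding R_sq_def by blast
  have "sqrt (0.296\<^sup>2) \<le> sqrt R_sq" "sqrt R_sq < sqrt (0.297\<^sup>2)"
    using R_sq_bounds by (simp_all only: real_sqrt_le_iff real_sqrt_less_iff)
  then show "let R = sqrt (sqrt 3 * (1 - cosh (1/2) * cos (sqrt 3 / 2)) /
                      (2 * sinh (1/2) * sin (sqrt 3 / 2)) - 1/2) :: real
        in 0.296 \<le> R \<and> R < 0.297"
    unfolding R_sq_def[symmetric] Let_def by simp
qed

end
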